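(* Let $G$ be a (countable) free group with more than one generator and let $\lambda$ be the left regular representation of $G$ on $l^2(G)$. Then: (i) For any non-zero projection $p'\in L(G)'$, there exists a Parseval frame vector $\eta$ for the subrepresentation $\pi:=\lambda|_{p'l^2(G)}$ such that $\{\pi(g)\eta\,|\,g\in G\}$ is a finite union of Riesz sequences. (ii) For any ONB vector $\psi$ for the left regular representation $\lambda$ and any $\alpha$ with $0<\alpha\le1$, there exists a projection $p'\in L(G)'$ such that $\mathrm{tr}_{L(G)'}(p')=\alpha$ and $\{p'\lambda(g)\psi\,|\,g\in G\}$ is a finite union of Riesz sequences. When $\alpha=\frac1N$ for some $N\in\mathbb N$, $p'$ can be chosen so that these Riesz sequences are orthogonal, i.e. $\{p'\lambda(g)\psi\,|\,g\in G\}$ is a finite union of orthogonal Riesz sequences.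
   Context: The left regular representation is $\lambda(g)\delta_h=\delta_{gh}$ on $l^2(G)$, where $\{\delta_h\}_{h\in G}$ is the canonical orthonormal basis; $L(G)$ is the von Neumann algebra generated by $\lambda(G)$ and $L(G)'$ its commutant, a $II_1$ factor with unique normalized trace $\mathrm{tr}_{L(G)'}(T)=\langle T\delta_e,\delta_e\rangle$. Given a unitary representation $\pi$ of $G$ on $\mathcal K$, a vector $\xi\in\mathcal K$ is a Parseval frame vector (resp. ONB vector) for $\pi$ if the family $\{\pi(g)\xi\,|\,g\in G\}$, indexed by $G$, is a Parseval frame for $\mathcal K$, i.e. $\|f\|^2=\sum_{g\in G}|\langle f,\pi(g)\xi\rangle|^2$ for all $f\in\mathcal K$ (resp. an orthonormal basis of $\mathcal K$). A Riesz sequence is a family $\{x_i\}_{i\in J}$ for which there are constants $A,B>0$ with $A\sum|c_i|^2\le\|\sum c_ix_i\|^2\le B\sum|c_i|^2$ for all finitely supported scalar families $(c_i)$. A family indexed by $G$ is a finite union of Riesz sequences (resp. orthogonal Riesz sequences) if $G$ can be partitioned into finitely many subsets such that the subfamily indexed by each of them is a Riesz sequence (resp. a Riesz sequence whose members are pairwise orthogonal). "Projection" means orthogonal projection. *)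

theory Defs
  imports
    "HOL-Analysis.Analysis"
    "HOL-Algebra.Group"
    "HOL-Library.Disjoint_Sets"
begin

section \<open>Free groups\<close>

text \<open>A letter \<open>(x, True)\<close> stands for \<open>x\<close> and \<open>(x, False)\<close> for the inverse of \<open>x\<close>.\<close>

definition reduced_words :: "'a set \<Rightarrow> ('a \<times> bool) list set" where
  "reduced_words X = {w \<in> lists (X \<times> UNIV).
     \<forall>i. Suc i < length w \<longrightarrow>
       \<not> (fst (w ! i) = fst (w ! Suc i) \<and> snd (w ! i) \<noteq> snd (w ! Suc i))}"

definition word_value :: "('a, 'b) monoid_scheme \<Rightarrow> ('a \<times> bool) list \<Rightarrow> 'a" where
  "word_value G w =
     foldr (\<lambda>(x, b) g. (if b then x else inv\<^bsub>G\<^esub> x) \<otimes>\<^bsub>G\<^esub> g) w \<one>\<^bsub>G\<^esub>"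

text \<open>\<open>G\<close> is free on \<open>X\<close>: every element is the value of exactly one reduced word in \<open>X\<close>.\<close>

definition free_group_on :: "('a, 'b) monoid_scheme \<Rightarrow> 'a set \<Rightarrow> bool" where
  "free_group_on G X \<longleftrightarrow> group G \<and> X \<subseteq> carrier G \<and>
     bij_betw (word_value G) (reduced_words X) (carrier G)"

section \<open>The Hilbert space of square-summable functions on a set\<close>

text \<open>Vectors are total functions that vanish off the index set \<open>S\<close>, so that equality of vectors
  is equality of functions. The inner product is linear in the first argument.\<close>

definition l2 :: "'a set \<Rightarrow> ('a \<Rightarrow> complex) set" where
  "l2 S = {f. (\<forall>x. x \<notin> S \<longrightarrow> f x = 0) \<and> (\<lambda>x. (cmod (f x))\<^sup>2) summable_on S}"

definition l2_inner :: "'a set \<Rightarrow> ('a \<Rightarrow> complex) \<Rightarrow> ('a \<Rightarrow> complex) \<Rightarrow> complex" where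
  "l2_inner S f g = (\<Sum>\<^sub>\<infinity>x\<in>S. f x * cnj (g x))"

definition l2_norm :: "'a set \<Rightarrow> ('a \<Rightarrow> complex) \<Rightarrow> real" where
  "l2_norm S f = sqrt (\<Sum>\<^sub>\<infinity>x\<in>S. (cmod (f x))\<^sup>2)"

definition delta :: "'a \<Rightarrow> 'a \<Rightarrow> complex" where
  "delta h = (\<lambda>x. if x = h then 1 else 0)"

section \<open>Families of vectors\<close>

definition lin_comb :: "'i set \<Rightarrow> ('i \<Rightarrow> complex) \<Rightarrow> ('i \<Rightarrow> 'a \<Rightarrow> complex) \<Rightarrow> 'a \<Rightarrow> complex" where
  "lin_comb F c v = (\<lambda>x. \<Sum>i\<in>F. c i * v i x)"

definition parseval_frame ::
    "'a set \<Rightarrow> ('a \<Rightarrow> complex) set \<Rightarrow> 'i set \<Rightarrow> ('i \<Rightarrow> 'a \<Rightarrow> complex) \<Rightarrow> bool" where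
  "parseval_frame S K J v \<longleftrightarrow> v \<in> J \<rightarrow> K \<and>
     (\<forall>f\<in>K. ((\<lambda>i. (cmod (l2_inner S f (v i)))\<^sup>2) has_sum (l2_norm S f)\<^sup>2) J)"

text \<open>The last conjunct says that the closed linear span of the family is all of \<open>K\<close>.\<close>

definition orthonormal_basis ::
    "'a set \<Rightarrow> ('a \<Rightarrow> complex) set \<Rightarrow> 'i set \<Rightarrow> ('i \<Rightarrow> 'a \<Rightarrow> complex) \<Rightarrow> bool" where
  "orthonormal_basis S K J v \<longleftrightarrow> v \<in> J \<rightarrow> K \<and>
     (\<forall>i\<in>J. \<forall>j\<in>J. l2_inner S (v i) (v j) = (if i = j then 1 else 0)) \<and>
     (\<forall>f\<in>K. \<forall>e>0. \<exists>F c. finite F \<and> F \<subseteq> J \<and> l2_norm S (\<lambda>x. f x - lin_comb F c v x) < e)"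

definition riesz_sequence ::
    "'a set \<Rightarrow> 'i set \<Rightarrow> ('i \<Rightarrow> 'a \<Rightarrow> complex) \<Rightarrow> bool" where
  "riesz_sequence S J v \<longleftrightarrow> v \<in> J \<rightarrow> l2 S \<and>
     (\<exists>A B. A > 0 \<and> B > 0 \<and>
       (\<forall>F c. finite F \<and> F \<subseteq> J \<longrightarrow>
          A * (\<Sum>i\<in>F. (cmod (c i))\<^sup>2) \<le> (l2_norm S (lin_comb F c v))\<^sup>2 \<and>
          (l2_norm S (lin_comb F c v))\<^sup>2 \<le> B * (\<Sum>i\<in>F. (cmod (c i))\<^sup>2)))"

definition orthogonal_riesz_sequence ::
    "'a set \<Rightarrow> 'i set \<Rightarrow> ('i \<Rightarrow> 'a \<Rightarrow> complex) \<Rightarrow> bool" where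
  "orthogonal_riesz_sequence S J v \<longleftrightarrow> riesz_sequence S J v \<and>
     pairwise (\<lambda>i j. l2_inner S (v i) (v j) = 0) J"

definition finite_union_of_riesz_sequences ::
    "'a set \<Rightarrow> 'i set \<Rightarrow> ('i \<Rightarrow> 'a \<Rightarrow> complex) \<Rightarrow> bool" where
  "finite_union_of_riesz_sequences S J v \<longleftrightarrow>
     (\<exists>P. partition_on J P \<and> finite P \<and> (\<forall>I\<in>P. riesz_sequence S I v))"

definition finite_union_of_orthogonal_riesz_sequences ::
    "'a set \<Rightarrow> 'i set \<Rightarrow> ('i \<Rightarrow> 'a \<Rightarrow> complex) \<Rightarrow> bool" where
  "finite_union_of_orthogonal_riesz_sequences S J v \<longleftrightarrow>
     (\<exists>P. partition_on J P \<and> finite P \<and> (\<forall>I\<in>P. orthogonal_riesz_sequence S I v))"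

section \<open>Bounded operators and von Neumann algebras\<close>

type_synonym 'a l2_op = "('a \<Rightarrow> complex) \<Rightarrow> ('a \<Rightarrow> complex)"

text \<open>Operators are extensional on \<open>l2 S\<close>, so that equality of operators is equality of
  functions.\<close>

definition bounded_ops :: "'a set \<Rightarrow> 'a l2_op set" where
  "bounded_ops S = {T \<in> l2 S \<rightarrow>\<^sub>E l2 S.
     (\<forall>f\<in>l2 S. \<forall>g\<in>l2 S. \<forall>a b. T (\<lambda>x. a * f x + b * g x) = (\<lambda>x. a * T f x + b * T g x)) \<and>
     (\<exists>C. \<forall>f\<in>l2 S. l2_norm S (T f) \<le> C * l2_norm S f)}"

definition adjoint_ops :: "'a set \<Rightarrow> 'a l2_op \<Rightarrow> 'a l2_op \<Rightarrow> bool" where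
  "adjoint_ops S T U \<longleftrightarrow>
     (\<forall>f\<in>l2 S. \<forall>g\<in>l2 S. l2_inner S (T f) g = l2_inner S f (U g))"

definition commutant :: "'a set \<Rightarrow> 'a l2_op set \<Rightarrow> 'a l2_op set" where
  "commutant S M = {T \<in> bounded_ops S. \<forall>U\<in>M. \<forall>f\<in>l2 S. T (U f) = U (T f)}"

definition von_neumann_algebra :: "'a set \<Rightarrow> 'a l2_op set \<Rightarrow> bool" where
  "von_neumann_algebra S M \<longleftrightarrow> M \<subseteq> bounded_ops S \<and>
     (\<forall>T\<in>M. \<forall>U\<in>bounded_ops S. adjoint_ops S T U \<longrightarrow> U \<in> M) \<and>
     commutant S (commutant S M) = M"

definition generated_von_neumann_algebra :: "'a set \<Rightarrow> 'a l2_op set \<Rightarrow> 'a l2_op set" where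
  "generated_von_neumann_algebra S M = \<Inter>{N. von_neumann_algebra S N \<and> M \<subseteq> N}"

definition orthogonal_projection :: "'a set \<Rightarrow> 'a l2_op \<Rightarrow> bool" where
  "orthogonal_projection S p \<longleftrightarrow> p \<in> bounded_ops S \<and> adjoint_ops S p p \<and>
     (\<forall>f\<in>l2 S. p (p f) = p f)"

section \<open>The left regular representation\<close>

definition left_regular :: "('a, 'b) monoid_scheme \<Rightarrow> 'a \<Rightarrow> 'a l2_op" where
  "left_regular G g = (\<lambda>f\<in>l2 (carrier G).
     \<lambda>h. if h \<in> carrier G then f (inv\<^bsub>G\<^esub> g \<otimes>\<^bsub>G\<^esub> h) else 0)"

lemma delta_in_l2: "h \<in> S \<Longrightarrow> delta h \<in> l2 S"
proof -
  assume "h \<in> S"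
  have "(\<lambda>x. (cmod (delta h x))\<^sup>2) summable_on {h}"
    by simp
  then have "(\<lambda>x. (cmod (delta h x))\<^sup>2) summable_on S"
    by (rule summable_on_cong_neutral[THEN iffD1, rotated -1]) (use \<open>h \<in> S\<close> in \<open>auto simp: delta_def\<close>)
  with \<open>h \<in> S\<close> show ?thesis
    by (auto simp: l2_def delta_def)
qed

lemma left_regular_delta:
  assumes "group G" "g \<in> carrier G" "h \<in> carrier G"
  shows "left_regular G g (delta h) = delta (g \<otimes>\<^bsub>G\<^esub> h)"
proof -
  interpret group G by fact
  have "inv\<^bsub>G\<^esub> g \<otimes>\<^bsub>G\<^esub> x = h \<longleftrightarrow> x = g \<otimes>\<^bsub>G\<^esub> h" if "x \<in> carrier G" for x
    using assms that by (metis inv_solve_left)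
  then show ?thesis
    using assms delta_in_l2[of h "carrier G"]
    by (auto simp: left_regular_def delta_def fun_eq_iff)
qed

definition group_vN :: "('a, 'b) monoid_scheme \<Rightarrow> 'a l2_op set" where
  "group_vN G = generated_von_neumann_algebra (carrier G) (left_regular G ` carrier G)"

definition group_vN_commutant :: "('a, 'b) monoid_scheme \<Rightarrow> 'a l2_op set" where
  "group_vN_commutant G = commutant (carrier G) (group_vN G)"

definition trace_commutant :: "('a, 'b) monoid_scheme \<Rightarrow> 'a l2_op \<Rightarrow> complex" where
  "trace_commutant G T = l2_inner (carrier G) (T (delta \<one>\<^bsub>G\<^esub>)) (delta \<one>\<^bsub>G\<^esub>)"

text \<open>In the next three definitions \<open>K\<close> is a subspace of \<open>l2 (carrier G)\<close> on which the operators
  \<open>\<pi> g\<close> act.\<close>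

definition subrepresentation ::
    "('a \<Rightarrow> 'a l2_op) \<Rightarrow> ('a \<Rightarrow> complex) set \<Rightarrow> 'a \<Rightarrow> 'a l2_op" where
  "subrepresentation \<pi> K = (\<lambda>g. restrict (\<pi> g) K)"

definition parseval_frame_vector ::
    "('a, 'b) monoid_scheme \<Rightarrow> ('a \<Rightarrow> complex) set \<Rightarrow> ('a \<Rightarrow> 'a l2_op) \<Rightarrow> ('a \<Rightarrow> complex) \<Rightarrow> bool" where
  "parseval_frame_vector G K \<pi> \<xi> \<longleftrightarrow>
     \<xi> \<in> K \<and> parseval_frame (carrier G) K (carrier G) (\<lambda>g. \<pi> g \<xi>)"

definition onb_vector ::
    "('a, 'b) monoid_scheme \<Rightarrow> ('a \<Rightarrow> complex) set \<Rightarrow> ('a \<Rightarrow> 'a l2_op) \<Rightarrow> ('a \<Rightarrow> complex) \<Rightarrow> bool" where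
  "onb_vector G K \<pi> \<xi> \<longleftrightarrow>
     \<xi> \<in> K \<and> orthonormal_basis (carrier G) K (carrier G) (\<lambda>g. \<pi> g \<xi>)"

end

theory Submission
  imports Defs
begin

text \<open>Every operator \<open>T\<close> in the commutant of the left regular representation is a convolution from
  the right and is determined by the vector \<open>T \<delta>\<^sub>e\<close>. For \<open>\<eta> = u \<delta>\<^sub>e\<close> with \<open>u\<close> in the commutant, the orbit
  of \<open>\<eta>\<close> consists of the vectors \<open>u \<delta>\<^sub>g\<close>, so its Gram matrix depends only on \<open>u\<^sup>* u\<close>. Both parts are
  proved by making \<open>u\<^sup>* u\<close> equal to a projection with a well understood orbit.

  Let \<open>a\<close> be a free generator. The left cosets of the powers of \<open>a\<close> split the space into copies of
  \<open>l\<^sup>2(\<int>)\<close>, that is, of the square-integrable functions on the circle, and right translation by \<open>a\<close> acts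
  on each copy as multiplication by the coordinate \<open>z\<close>. For \<open>0 < b \<le> 1\<close> let \<open>q\<^sub>b\<close> be multiplication by the
  indicator function of an arc whose length is the fraction \<open>b\<close> of the circle; it is a projection of
  trace \<open>b\<close> in the commutant. On one coset the vectors \<open>q\<^sub>b \<delta>\<^sub>g\<close> are the functions \<open>z\<^sup>k\<close> restricted to the
  arc. If \<open>1/N \<le> b\<close> and the exponents \<open>k\<close> run through a residue class modulo \<open>N\<close>, then a combination
  of them has a modulus of period \<open>1/N\<close>, so that its square integral over the arc is at least \<open>1/N\<close> times
  the one over the circle; and for \<open>b = 1/N\<close> the functions are orthogonal. Hence the residue classes of
  the exponents split the orbit into \<open>N\<close> Riesz sequences (\<open>orbit_finite_union\<close>,
  \<open>orbit_finite_union_orthogonal\<close>).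

  For an orthonormal basis vector \<open>\<psi>\<close> the map \<open>w\<close> with \<open>w \<delta>\<^sub>g = \<lambda>(g) \<psi>\<close> is an isometry in the commutant.
  The projection \<open>w q\<^sub>b w\<^sup>*\<close> has trace \<open>b\<close> and maps \<open>\<lambda>(g) \<psi>\<close> to \<open>w q\<^sub>b \<delta>\<^sub>g\<close>, which is the orbit for \<open>u = w q\<^sub>b\<close>
  (\<open>compressed_basis_orbit\<close>). For a non-zero projection \<open>p\<close> of trace \<open>b\<close>, comparison theory gives a
  partial isometry \<open>v\<close> in the commutant with \<open>v\<^sup>* v = q\<^sub>b\<close> and \<open>v v\<^sup>* = p\<close>, and \<open>v \<delta>\<^sub>e\<close> is the Parseval frame
  vector: the frame coefficients of \<open>f\<close> are the coordinates of \<open>v\<^sup>* f\<close>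
  (\<open>parseval_frame_vector_riesz\<close>).

  Three ingredients carry this. The comparison theorem
  \<open>equal_trace_imp_equivalent\<close> is proved for an abstract algebra of operators with a trace vector; polar
  parts are limits of the Newton iteration \<open>X \<mapsto> X (3 - X\<^sup>* X) / 2\<close>. That the commutant is a factor,
  \<open>right_algebra_factor\<close>, comes from the elements \<open>x\<^sup>m y\<^sup>m\<close> for two free generators, whose conjugations move
  finite sets of non-trivial elements off themselves (\<open>conjugate_disjoint\<close>). The projection \<open>q\<^sub>b\<close> is
  convolution by the Fourier coefficients of the arc, and it is idempotent because trigonometric
  polynomials are dense (\<open>arc_coeff_idempotent\<close>).\<close>

section \<open>The Hilbert space of square-summable functions as a type\<close>

text \<open>The index set is a whole type; the functions that vanish off a group are cut out later by a
  projection. Only the real inner product is made part of the type: bounded operators, adjoints and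
  projections can be treated as real operators, and complex linearity is the commutation with the
  multiplication by \<open>\<i>\<close>.\<close>

typedef 'a ell2 = "{f :: 'a \<Rightarrow> complex. (\<lambda>x. (cmod (f x))\<^sup>2) summable_on UNIV}"
  morphisms coord Abs_ell2
  by (rule exI[of _ "\<lambda>_. 0"]) simp

setup_lifting type_definition_ell2

lemma square_summable: "(\<lambda>x. (cmod (coord f x))\<^sup>2) summable_on UNIV"
  using coord[of f] by simp

lemma square_summable_inner:
  fixes f g :: "'a \<Rightarrow> complex"
  assumes "(\<lambda>x. (cmod (f x))\<^sup>2) summable_on A" "(\<lambda>x. (cmod (g x))\<^sup>2) summable_on A"
  shows "(\<lambda>x. inner (f x) (g x)) summable_on A"
proof -
  have "(\<lambda>x. (cmod (f x))\<^sup>2 + (cmod (g x))\<^sup>2) summable_on A"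
    by (intro summable_on_add assms)
  moreover have "norm (inner (f x) (g x)) \<le> (cmod (f x))\<^sup>2 + (cmod (g x))\<^sup>2" for x
  proof -
    have "norm (inner (f x) (g x)) \<le> norm (f x) * norm (g x)"
      using Cauchy_Schwarz_ineq2 by auto
    also have "\<dots> \<le> (cmod (f x))\<^sup>2 + (cmod (g x))\<^sup>2"
      using sum_squares_bound[of "norm (f x)" "norm (g x)"]
        mult_nonneg_nonneg[OF norm_ge_zero[of "f x"] norm_ge_zero[of "g x"] ] by linarith
    finally show ?thesis .
  qed
  ultimately have "(\<lambda>x. norm (inner (f x) (g x))) summable_on A"
    by (rule summable_on_comparison_test) auto
  then show ?thesis
    by (rule abs_summable_summable)
qed

lemma square_summable_add:
  fixes f g :: "'a \<Rightarrow> complex"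
  assumes "(\<lambda>x. (cmod (f x))\<^sup>2) summable_on A" "(\<lambda>x. (cmod (g x))\<^sup>2) summable_on A"
  shows "(\<lambda>x. (cmod (f x + g x))\<^sup>2) summable_on A"
proof -
  have "(cmod (f x + g x))\<^sup>2 = ((cmod (f x))\<^sup>2 + (cmod (g x))\<^sup>2) + 2 * inner (f x) (g x)" for x
    by (simp add: power2_norm_eq_inner inner_add inner_commute)
  then show ?thesis
    using summable_on_add[OF summable_on_add[OF assms] summable_on_cmult_right[OF square_summable_inner[OF assms], of 2] ]
    by simp
qed

lemma square_summable_cmult:
  fixes f :: "'a \<Rightarrow> complex"
  assumes "(\<lambda>x. (cmod (f x))\<^sup>2) summable_on A"
  shows "(\<lambda>x. (cmod (c * f x))\<^sup>2) summable_on A"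
  by (simp add: norm_mult power_mult_distrib summable_on_cmult_right assms)

instantiation ell2 :: (type) real_vector
begin

lift_definition zero_ell2 :: "'a ell2" is "\<lambda>_. 0" by simp

lift_definition plus_ell2 :: "'a ell2 \<Rightarrow> 'a ell2 \<Rightarrow> 'a ell2" is "\<lambda>f g x. f x + g x"
  by (rule square_summable_add)

lift_definition uminus_ell2 :: "'a ell2 \<Rightarrow> 'a ell2" is "\<lambda>f x. - f x"
  by simp

lift_definition minus_ell2 :: "'a ell2 \<Rightarrow> 'a ell2 \<Rightarrow> 'a ell2" is "\<lambda>f g x. f x - g x"
  using square_summable_add[of _ UNIV "\<lambda>x. - _ x"] by simp

lift_definition scaleR_ell2 :: "real \<Rightarrow> 'a ell2 \<Rightarrow> 'a ell2" is "\<lambda>r f x. r *\<^sub>R f x"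
  by (simp add: power_mult_distrib summable_on_cmult_right)
instance
  by standard (transfer; auto simp: fun_eq_iff algebra_simps)+

end

instantiation ell2 :: (type) real_inner
begin

definition inner_ell2 :: "'a ell2 \<Rightarrow> 'a ell2 \<Rightarrow> real" where
  "inner_ell2 f g = (\<Sum>\<^sub>\<infinity>x. inner (coord f x) (coord g x))"

definition norm_ell2 :: "'a ell2 \<Rightarrow> real" where
  "norm_ell2 f = sqrt (inner f f)"


definition sgn_ell2 :: "'a ell2 \<Rightarrow> 'a ell2" where
  "sgn_ell2 f = f /\<^sub>R norm f"

definition dist_ell2 :: "'a ell2 \<Rightarrow> 'a ell2 \<Rightarrow> real" where
  "dist_ell2 f g = norm (f - g)"

definition uniformity_ell2 :: "('a ell2 \<times> 'a ell2) filter" where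
  "uniformity_ell2 = (INF e\<in>{0<..}. principal {(f, g). dist f g < e})"

definition open_ell2 :: "'a ell2 set \<Rightarrow> bool" where
  "open_ell2 U \<longleftrightarrow> (\<forall>f\<in>U. \<forall>\<^sub>F (f', g) in uniformity. f' = f \<longrightarrow> g \<in> U)"

lemma inner_has_sum:
  "((\<lambda>x. inner (coord f x) (coord g x)) has_sum inner f g) UNIV"
  unfolding inner_ell2_def by (intro has_sum_infsum square_summable_inner square_summable)

instance
proof
  fix f g h :: "'a ell2" and r s :: real
  show "dist f g = norm (f - g)" by (rule dist_ell2_def)
  show "sgn f = f /\<^sub>R norm f" by (rule sgn_ell2_def)
  show "(uniformity :: ('a ell2 \<times> 'a ell2) filter) =
      (INF e\<in>{0<..}. principal {(f, g). dist f g < e})"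
    by (rule uniformity_ell2_def)
  show "open U \<longleftrightarrow> (\<forall>f\<in>U. \<forall>\<^sub>F (f', g) in uniformity. f' = f \<longrightarrow> g \<in> U)" for U :: "'a ell2 set"
    by (rule open_ell2_def)
  show "norm f = sqrt (inner f f)" by (rule norm_ell2_def)
  show "inner f g = inner g f"
    by (simp add: inner_ell2_def inner_commute)
  show "inner (f + g) h = inner f h + inner g h"
    by (rule has_sum_unique[OF inner_has_sum])
      (simp add: plus_ell2.rep_eq inner_add_left has_sum_add inner_has_sum)
  show "inner (r *\<^sub>R f) g = r * inner f g"
    by (rule has_sum_unique[OF inner_has_sum])
      (simp add: scaleR_ell2.rep_eq has_sum_cmult_right inner_has_sum)
  show "0 \<le> inner f f"
    by (rule has_sum_nonneg[OF inner_has_sum]) simp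
  show "inner f f = 0 \<longleftrightarrow> f = 0"
  proof
    assume "inner f f = 0"
    then have "((\<lambda>x. inner (coord f x) (coord f x)) has_sum 0) UNIV"
      using inner_has_sum[of f f] by metis
    then have "inner (coord f x) (coord f x) = 0" for x
      by (rule nonneg_has_sum_le_0D[where A = UNIV]) auto
    then show "f = 0"
      by (simp add: coord_inject[symmetric] zero_ell2.rep_eq fun_eq_iff)
  next
    assume "f = 0"
    then show "inner f f = 0"
      by (simp add: inner_ell2_def zero_ell2.rep_eq)
  qed
qed

end

lemmas coord_simps [simp] =
  zero_ell2.rep_eq plus_ell2.rep_eq minus_ell2.rep_eq uminus_ell2.rep_eq scaleR_ell2.rep_eq

lemma ell2_eqI: "(\<And>x. coord f x = coord g x) \<Longrightarrow> f = g"
  by (simp add: coord_inject[symmetric] fun_eq_iff)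

lemma coord_sum [simp]: "coord (\<Sum>i\<in>I. f i) x = (\<Sum>i\<in>I. coord (f i) x)"
  by (induction I rule: infinite_finite_induct) auto

lemma norm_has_sum: "((\<lambda>x. (cmod (coord f x))\<^sup>2) has_sum (norm f)\<^sup>2) UNIV"
  using inner_has_sum[of f f] by (simp add: power2_norm_eq_inner)

lemma partial_norm_le: "finite F \<Longrightarrow> (\<Sum>x\<in>F. (cmod (coord f x))\<^sup>2) \<le> (norm f)\<^sup>2"
  by (rule finite_sum_le_has_sum[OF norm_has_sum]) auto

lemma coord_le_norm: "cmod (coord f x) \<le> norm f"
  by (rule power2_le_imp_le) (use partial_norm_le[of "{x}" f] in auto)

text \<open>The way in which all vectors and operators below come into being: from coordinates whose finite
  square sums are bounded.\<close>

lemma ell2_of_bounded: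
  assumes "\<And>F. finite F \<Longrightarrow> (\<Sum>x\<in>F. (cmod (u x))\<^sup>2) \<le> B\<^sup>2" "0 \<le> B"
  obtains f where "coord f = u" "norm f \<le> B"
proof -
  have "(\<lambda>x. (cmod (u x))\<^sup>2) summable_on UNIV"
    by (rule nonneg_bdd_above_summable_on) (auto intro!: bdd_aboveI2 assms)
  then have eq: "coord (Abs_ell2 u) = u"
    by (simp add: Abs_ell2_inverse)
  have "(norm (Abs_ell2 u))\<^sup>2 \<le> B\<^sup>2"
    by (rule has_sum_le_finite_sums[OF norm_has_sum]) (simp add: eq assms)
  then show ?thesis
    using that[OF eq] power2_le_imp_le[OF _ assms(2)] by blast
qed

instance ell2 :: (type) complete_space
proof
  fix X :: "nat \<Rightarrow> 'a ell2"
  assume X: "Cauchy X"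
  have "Cauchy (\<lambda>n. coord (X n) x)" for x
  proof (rule metric_CauchyI)
    fix e :: real assume "0 < e"
    then obtain M where "\<forall>m\<ge>M. \<forall>n\<ge>M. dist (X m) (X n) < e"
      using X by (auto simp: Cauchy_def)
    moreover have "dist (coord (X m) x) (coord (X n) x) \<le> dist (X m) (X n)" for m n
      using coord_le_norm[of "X m - X n" x] by (simp add: dist_norm)
    ultimately show "\<exists>M. \<forall>m\<ge>M. \<forall>n\<ge>M. dist (coord (X m) x) (coord (X n) x) < e"
      by (meson le_less_trans)
  qed
  then have "\<forall>x. \<exists>l. (\<lambda>n. coord (X n) x) \<longlonglongrightarrow> l"
    by (simp add: Cauchy_convergent convergent_def[symmetric])
  then obtain u where u: "\<And>x. (\<lambda>n. coord (X n) x) \<longlonglongrightarrow> u x"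
    by metis
  \<comment> \<open>finite sums pass to the limit, so a tail bound for the sequence is one for the limit\<close>
  have tail: "\<exists>M. \<forall>n\<ge>M. \<forall>F. finite F \<longrightarrow> (\<Sum>x\<in>F. (cmod (coord (X n) x - u x))\<^sup>2) \<le> e\<^sup>2" if e: "e > 0" for e
  proof -
    obtain M where M: "\<And>m n. m \<ge> M \<Longrightarrow> n \<ge> M \<Longrightarrow> norm (X m - X n) < e"
      using X e unfolding Cauchy_def dist_norm by metis
    have "(\<Sum>x\<in>F. (cmod (coord (X n) x - u x))\<^sup>2) \<le> e\<^sup>2" if "n \<ge> M" "finite F" for n F
    proof (rule LIMSEQ_le_const2)
      show "(\<lambda>m. \<Sum>x\<in>F. (cmod (coord (X n) x - coord (X m) x))\<^sup>2)
          \<longlonglongrightarrow> (\<Sum>x\<in>F. (cmod (coord (X n) x - u x))\<^sup>2)"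
        by (intro tendsto_intros u)
      have "(\<Sum>x\<in>F. (cmod (coord (X n) x - coord (X m) x))\<^sup>2) \<le> e\<^sup>2" if "m \<ge> M" for m
        using partial_norm_le[OF \<open>finite F\<close>, of "X n - X m"] M[OF \<open>n \<ge> M\<close> that] \<open>e > 0\<close>
        by (smt (verit) minus_ell2.rep_eq norm_ge_zero power_mono sum.cong)
      then show "\<exists>N. \<forall>m\<ge>N. (\<Sum>x\<in>F. (cmod (coord (X n) x - coord (X m) x))\<^sup>2) \<le> e\<^sup>2"
        by blast
    qed
    then show ?thesis by blast
  qed
  obtain M where M: "\<And>F. finite F \<Longrightarrow> (\<Sum>x\<in>F. (cmod (coord (X M) x - u x))\<^sup>2) \<le> 1\<^sup>2"
    using tail[of 1] by auto
  obtain d where d: "coord d = (\<lambda>x. coord (X M) x - u x)"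
    using ell2_of_bounded[OF M] by auto
  define l where "l = X M - d"
  have l: "coord l = u"
    by (simp add: l_def d fun_eq_iff)
  have "\<exists>N. \<forall>n\<ge>N. norm (X n - l) < e" if "e > 0" for e
  proof -
    obtain N where N: "\<And>n F. n \<ge> N \<Longrightarrow> finite F \<Longrightarrow> (\<Sum>x\<in>F. (cmod (coord (X n) x - u x))\<^sup>2) \<le> (e/2)\<^sup>2"
      using tail[of "e/2"] \<open>e > 0\<close> by auto
    have "norm (X n - l) \<le> e/2" if "n \<ge> N" for n
    proof -
      have "(norm (X n - l))\<^sup>2 \<le> (e/2)\<^sup>2"
        by (rule has_sum_le_finite_sums[OF norm_has_sum]) (use N[OF that] in \<open>simp add: l\<close>)
      then show ?thesis
        by (rule power2_le_imp_le) (use \<open>e > 0\<close> in simp)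
    qed
    then have "norm (X n - l) < e" if "n \<ge> N" for n
      using that \<open>e > 0\<close> by fastforce
    then show ?thesis by blast
  qed
  then have "X \<longlonglongrightarrow> l"
    by (simp add: LIMSEQ_iff)
  then show "convergent X"
    by (auto simp: convergent_def)
qed

lift_definition scaleC :: "complex \<Rightarrow> 'a ell2 \<Rightarrow> 'a ell2" is "\<lambda>c f x. c * f x"
  by (rule square_summable_cmult)

text \<open>A multiple of a basis vector. Taking the multiple as an argument makes real inner products with
  \<open>single x c\<close> determine the complex coordinate at \<open>x\<close>.\<close>

lift_definition single :: "'a \<Rightarrow> complex \<Rightarrow> 'a ell2" is "\<lambda>y c x. if x = y then c else 0"
  by (rule finite_nonzero_values_imp_summable_on) (simp add: if_distrib cong: if_cong)

declare scaleC.rep_eq [simp] single.rep_eq [simp]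

lemma inner_single_right [simp]: "inner f (single x c) = inner (coord f x) c"
proof -
  have "((\<lambda>y. inner (coord f y) (coord (single x c) y)) has_sum inner (coord f x) c) UNIV"
    by (rule has_sum_finite_neutralI[of "{x}"]) auto
  then show ?thesis
    by (rule has_sum_unique[OF inner_has_sum])
qed

lemma inner_single_left [simp]: "inner (single x c) f = inner c (coord f x)"
  by (simp add: inner_commute)

lemma norm_single [simp]: "norm (single x c) = cmod c"
  by (simp add: norm_eq_sqrt_inner)

lemma scaleC_single: "scaleC c (single x d) = single x (c * d)"
  by (rule ell2_eqI) simp

lemma scaleC_add: "scaleC c (f + g) = scaleC c f + scaleC c g"
  and scaleC_diff: "scaleC c (f - g) = scaleC c f - scaleC c g"
  and scaleC_scaleR: "scaleC c (r *\<^sub>R f) = r *\<^sub>R scaleC c f"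
  and scaleC_scaleC: "scaleC c (scaleC d f) = scaleC (c * d) f"
  and scaleC_one [simp]: "scaleC 1 f = f"
  and scaleC_of_real: "scaleC (complex_of_real r) f = r *\<^sub>R f"
  by (rule ell2_eqI; simp add: algebra_simps scaleR_conv_of_real)+

lemma scaleC_ii_decompose: "scaleC c f = Re c *\<^sub>R f + Im c *\<^sub>R scaleC \<i> f"
  by (rule ell2_eqI) (simp add: complex_eq_iff)

lemma inner_scaleC: "inner (scaleC c f) g = inner f (scaleC (cnj c) g)"
  by (simp add: inner_ell2_def inner_complex_def algebra_simps)

lemma norm_scaleC [simp]: "norm (scaleC c f) = cmod c * norm f"
proof -
  have "((\<lambda>x. (cmod (coord (scaleC c f) x))\<^sup>2) has_sum (cmod c)\<^sup>2 * (norm f)\<^sup>2) UNIV"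
    using has_sum_cmult_right[OF norm_has_sum[of f], of "(cmod c)\<^sup>2"]
    by (simp add: norm_mult power_mult_distrib)
  then have "(norm (scaleC c f))\<^sup>2 = (cmod c * norm f)\<^sup>2"
    using has_sum_unique[OF norm_has_sum] by (metis power_mult_distrib)
  then show ?thesis
    by (simp add: power2_eq_iff_nonneg)
qed

lemma ell2_eq_inner_singleI:
  assumes "\<And>x c. inner f (single x c) = inner g (single x c)"
  shows "f = g"
proof (rule ell2_eqI)
  fix x
  have "inner (coord f x - coord g x) (coord f x - coord g x) = 0"
    using assms[of x "coord f x - coord g x"] by (simp add: inner_diff)
  then show "coord f x = coord g x" by simp
qed

lemma has_sum_singles: "((\<lambda>x. single x (coord f x)) has_sum f) UNIV"
proof -
  have norm: "(norm (f - (\<Sum>x\<in>F. single x (coord f x))))\<^sup>2 = (norm f)\<^sup>2 - (\<Sum>x\<in>F. (cmod (coord f x))\<^sup>2)"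
    if F: "finite F" for F
  proof -
    have *: "inner (\<Sum>x\<in>F. single x (coord f x)) (single y (coord f y)) = (cmod (coord f y))\<^sup>2" if "y \<in> F" for y
    proof -
      have "coord (\<Sum>x\<in>F. single x (coord f x)) y = coord f y"
        using that F by (simp add: if_distrib sum.delta cong: if_cong)
      then show ?thesis
        by (simp only: inner_single_right power2_norm_eq_inner)
    qed
    have "inner (\<Sum>x\<in>F. single x (coord f x)) (\<Sum>x\<in>F. single x (coord f x)) = (\<Sum>x\<in>F. (cmod (coord f x))\<^sup>2)"
      unfolding inner_sum_right[of "\<Sum>x\<in>F. single x (coord f x)"] using * by simp
    moreover have "inner f (\<Sum>x\<in>F. single x (coord f x)) = (\<Sum>x\<in>F. (cmod (coord f x))\<^sup>2)"
      by (simp add: inner_sum_right power2_norm_eq_inner)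
    ultimately show ?thesis
      by (simp add: power2_norm_eq_inner[of "_ - _"] inner_diff inner_commute)
        (simp add: power2_norm_eq_inner)
  qed
  have ev: "\<forall>\<^sub>F F in finite_subsets_at_top UNIV.
      (norm (f - (\<Sum>x\<in>F. single x (coord f x))))\<^sup>2 = (norm f)\<^sup>2 - (\<Sum>x\<in>F. (cmod (coord f x))\<^sup>2)"
    by (rule eventually_finite_subsets_at_top_weakI) (rule norm)
  have "((\<lambda>F. (norm f)\<^sup>2 - (\<Sum>x\<in>F. (cmod (coord f x))\<^sup>2)) \<longlongrightarrow> (norm f)\<^sup>2 - (norm f)\<^sup>2) (finite_subsets_at_top UNIV)"
    using norm_has_sum[of f] by (intro tendsto_intros) (simp add: has_sum_def)
  then have "((\<lambda>F. (norm (f - (\<Sum>x\<in>F. single x (coord f x))))\<^sup>2) \<longlongrightarrow> 0) (finite_subsets_at_top UNIV)"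
    using tendsto_cong[OF ev] by simp
  from tendsto_real_sqrt[OF this]
  have "((\<lambda>F. norm (f - (\<Sum>x\<in>F. single x (coord f x)))) \<longlongrightarrow> 0) (finite_subsets_at_top UNIV)"
    by simp
  then have "((\<lambda>F. f - (\<Sum>x\<in>F. single x (coord f x))) \<longlongrightarrow> 0) (finite_subsets_at_top UNIV)"
    by (simp only: tendsto_norm_zero_iff)
  from tendsto_diff[OF tendsto_const[of f] this] show ?thesis
    by (simp add: has_sum_def)
qed

section \<open>Positive polynomials of a contraction and the polar decomposition\<close>

text \<open>Adjoints are carried along as a relation. It already forces both operators to be linear.\<close>

definition adj :: "('h::real_inner \<Rightarrow> 'h) \<Rightarrow> ('h \<Rightarrow> 'h) \<Rightarrow> bool" where
  "adj T T' \<longleftrightarrow> (\<forall>f g. inner (T f) g = inner f (T' g))"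

lemma adjD: "adj T T' \<Longrightarrow> inner (T f) g = inner f (T' g)"
  by (simp add: adj_def)

lemma adj_sym: "adj T T' \<Longrightarrow> adj T' T"
  by (simp add: adj_def) (metis inner_commute)

lemma adj_comp: "adj S S' \<Longrightarrow> adj T T' \<Longrightarrow> adj (\<lambda>f. S (T f)) (\<lambda>f. T' (S' f))"
  by (simp add: adj_def)

lemma adj_add: "adj S S' \<Longrightarrow> adj T T' \<Longrightarrow> adj (\<lambda>f. S f + T f) (\<lambda>f. S' f + T' f)"
  by (simp add: adj_def inner_add)

lemma adj_diff: "adj S S' \<Longrightarrow> adj T T' \<Longrightarrow> adj (\<lambda>f. S f - T f) (\<lambda>f. S' f - T' f)"
  by (simp add: adj_def inner_diff)

lemma adj_scaleR: "adj T T' \<Longrightarrow> adj (\<lambda>f. r *\<^sub>R T f) (\<lambda>f. r *\<^sub>R T' f)"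
  by (simp add: adj_def)

lemma adj_linear:
  assumes "adj T T'"
  shows "linear T"
proof (rule linearI)
  fix f g and r :: real
  have "inner (T (f + g) - (T f + T g)) h = 0" for h
    using assms by (simp add: adj_def inner_diff_left inner_add_left)
  then show "T (f + g) = T f + T g"
    by (metis eq_iff_diff_eq_0 inner_eq_zero_iff)
  have "inner (T (r *\<^sub>R f) - r *\<^sub>R T f) h = 0" for h
    using assms by (simp add: adj_def inner_diff_left)
  then show "T (r *\<^sub>R f) = r *\<^sub>R T f"
    by (metis eq_iff_diff_eq_0 inner_eq_zero_iff)
qed

lemma adj_unique:
  assumes "adj T T'" "adj T T''"
  shows "T' f = T'' f"
proof -
  have "inner (T' f - T'' f) (T' f - T'' f) = 0"
    using adjD[OF assms(1), of _ f] adjD[OF assms(2), of _ f] by (metis inner_diff_right right_minus_eq)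
  then show ?thesis by simp
qed

lemma adj_contraction:
  assumes "adj T T'" "\<And>f. norm (T f) \<le> norm f"
  shows "norm (T' f) \<le> norm f"
proof -
  have "(norm (T' f))\<^sup>2 = inner (T (T' f)) f"
    using adjD[OF assms(1), of "T' f" f] by (simp add: power2_norm_eq_inner)
  also have "\<dots> \<le> norm (T (T' f)) * norm f"
    by (rule norm_cauchy_schwarz)
  also have "\<dots> \<le> norm (T' f) * norm f"
    by (intro mult_right_mono assms) simp
  finally have "norm (T' f) * norm (T' f) \<le> norm (T' f) * norm f"
    by (simp add: power2_eq_square)
  then show ?thesis
    by (metis mult_le_cancel_left_pos norm_ge_zero norm_le_zero_iff norm_zero not_le order_refl order_trans)
qed

text \<open>The polynomials in \<open>S\<close> with non-negative coefficients in the products of powers of \<open>S\<close> and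
  \<open>1 - S\<close>. For \<open>0 \<le> S \<le> 1\<close> they are positive operators, and this is shown by inspection of
  exponents, without square roots.\<close>

inductive_set pos_cone :: "('h::real_inner \<Rightarrow> 'h) \<Rightarrow> ('h \<Rightarrow> 'h) set" for S where
  one: "(\<lambda>f. f) \<in> pos_cone S"
| add: "A \<in> pos_cone S \<Longrightarrow> B \<in> pos_cone S \<Longrightarrow> (\<lambda>f. A f + B f) \<in> pos_cone S"
| scale: "A \<in> pos_cone S \<Longrightarrow> 0 \<le> r \<Longrightarrow> (\<lambda>f. r *\<^sub>R A f) \<in> pos_cone S"
| mult: "A \<in> pos_cone S \<Longrightarrow> (\<lambda>f. S (A f)) \<in> pos_cone S"
| mult_compl: "A \<in> pos_cone S \<Longrightarrow> (\<lambda>f. A f - S (A f)) \<in> pos_cone S"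

lemma pos_cone_zero: "(\<lambda>f. 0) \<in> pos_cone S"
  using pos_cone.scale[OF pos_cone.one, of 0] by simp

lemma pos_cone_comp: "A \<in> pos_cone S \<Longrightarrow> B \<in> pos_cone S \<Longrightarrow> (\<lambda>f. A (B f)) \<in> pos_cone S"
  by (induction rule: pos_cone.induct) (auto intro: pos_cone.intros)

lemma pos_cone_linear: "A \<in> pos_cone S \<Longrightarrow> linear S \<Longrightarrow> linear A"
proof (induction rule: pos_cone.induct)
  case (mult A)
  then show ?case using linear_compose[of A S] by (simp add: o_def)
next
  case (mult_compl A)
  then show ?case using linear_compose[of A S] by (simp add: o_def linear_compose_sub)
qed (auto intro: linear_compose_add linear_compose_scale_right simp: linear_ident)

lemma pos_cone_commute:
  assumes "A \<in> pos_cone S" "linear C" "\<And>f. C (S f) = S (C f)"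
  shows "C (A f) = A (C f)"
  using assms(1)
  by (induction arbitrary: f rule: pos_cone.induct)
    (simp_all add: assms(3) linear_add[OF assms(2)] linear_diff[OF assms(2)] linear_scale[OF assms(2)])

lemma pos_cone_commute_S:
  assumes "A \<in> pos_cone S" "linear S"
  shows "S (A f) = A (S f)"
  using pos_cone_commute[OF assms] by simp

locale positive_contraction =
  fixes S :: "'h::real_inner \<Rightarrow> 'h"
  assumes self_adjoint: "adj S S"
    and nonneg: "0 \<le> inner (S f) f"
    and le_one: "(norm (S f))\<^sup>2 \<le> inner (S f) f"
begin

lemma linear_S: "linear S"
  using adj_linear self_adjoint .

lemma inner_S_le: "inner (S f) f \<le> (norm f)\<^sup>2"
proof -
  have "(norm (S f))\<^sup>2 \<le> norm (S f) * norm f"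
    using le_one norm_cauchy_schwarz order_trans by blast
  then have "norm (S f) \<le> norm f"
    by (cases "norm (S f) = 0") (simp_all add: power2_eq_square)
  then show ?thesis
    by (smt (verit) mult_right_mono norm_cauchy_schwarz norm_ge_zero power2_eq_square)
qed

definition D :: "'h \<Rightarrow> 'h" where "D f = f - S f"

lemma adj_D: "adj D D"
  using adjD[OF self_adjoint] by (simp add: adj_def D_def inner_diff)

lemma linear_D: "linear D"
  using adj_linear adj_D .

lemma S_D: "S (D f) = D (S f)"
  by (simp add: D_def linear_diff[OF linear_S])

lemma S_D_funpow: "S ((D ^^ j) f) = (D ^^ j) (S f)"
  by (induction j arbitrary: f) (simp_all add: S_D)

lemma D_S_funpow: "D ((S ^^ i) f) = (S ^^ i) (D f)"
  by (induction i arbitrary: f) (simp_all add: S_D[symmetric])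

lemma linear_funpow:
  fixes B :: "'h \<Rightarrow> 'h"
  assumes "linear B"
  shows "linear (B ^^ n)"
proof (induction n)
  case 0
  then show ?case by (simp add: id_def linear_ident)
next
  case (Suc n)
  then show ?case using linear_compose[OF Suc assms] by (simp add: o_def)
qed

text \<open>A pair of equal factors is moved to the two sides of the inner product, until at most one factor
  \<open>S\<close> and one factor \<open>1 - S\<close> are left.\<close>

lemma power_positive: "0 \<le> inner ((S ^^ i) ((D ^^ j) f)) f"
proof (induction "i + j" arbitrary: i j f rule: less_induct)
  case less
  show ?case
  proof (cases "i \<ge> 2")
    case True
    then obtain i' where i: "i = Suc (Suc i')" by (metis add_2_eq_Suc le_Suc_ex)
    have "(S ^^ i) ((D ^^ j) f) = S ((S ^^ i') (S ((D ^^ j) f)))"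
      by (simp add: i funpow_swap1)
    then have "inner ((S ^^ i) ((D ^^ j) f)) f = inner ((S ^^ i') ((D ^^ j) (S f))) (S f)"
      by (simp add: adjD[OF self_adjoint] S_D_funpow)
    then show ?thesis using less[of i' j "S f"] i by simp
  next
    case i: False
    show ?thesis
    proof (cases "j \<ge> 2")
      case True
      then obtain j' where j: "j = Suc (Suc j')" by (metis add_2_eq_Suc le_Suc_ex)
      have "(S ^^ i) ((D ^^ j) f) = D ((S ^^ i) ((D ^^ j') (D f)))"
        by (simp add: j D_S_funpow funpow_swap1)
      then have "inner ((S ^^ i) ((D ^^ j) f)) f = inner ((S ^^ i) ((D ^^ j') (D f))) (D f)"
        by (simp add: adjD[OF adj_D])
      then show ?thesis using less[of i j' "D f"] j by simp
    next
      case False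
      have "0 \<le> inner (D f) f" "0 \<le> inner (S (D f)) f"
        using inner_S_le[of f] le_one[of f] adjD[OF self_adjoint, of "S f" f]
        by (simp_all add: D_def inner_diff power2_norm_eq_inner linear_diff[OF linear_S])
      moreover have "i = 0 \<or> i = 1" "j = 0 \<or> j = 1" using i False by auto
      ultimately show ?thesis using nonneg[of f] by auto
    qed
  qed
qed

lemma pos_cone_nonneg:
  assumes "A \<in> pos_cone S"
  shows "0 \<le> inner (A f) f"
proof -
  have lin: "linear (\<lambda>f. (S ^^ i) ((D ^^ j) f))" for i j
    using linear_compose[OF linear_funpow[OF linear_D] linear_funpow[OF linear_S] ] by (simp add: o_def)
  \<comment> \<open>the factors \<open>S ^^ i\<close> and \<open>D ^^ j\<close> are what makes the induction go through\<close>
  have "0 \<le> inner ((S ^^ i) ((D ^^ j) (A f))) f" for i j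
    using assms
  proof (induction arbitrary: i j rule: pos_cone.induct)
    case one
    then show ?case by (rule power_positive)
  next
    case (add A B)
    then show ?case using linear_add[OF lin[of i j] ] by (simp add: inner_add_left)
  next
    case (scale A r)
    then show ?case using linear_scale[OF lin[of i j] ] by simp
  next
    case (mult A)
    from mult.IH[of "Suc i" j] show ?case
      by (simp add: S_D_funpow funpow_swap1)
  next
    case (mult_compl A)
    from mult_compl.IH[of i "Suc j"] show ?case
      by (simp add: funpow_swap1 D_def[of "A f"])
  qed
  from this[of 0 0] show ?thesis by simp
qed

end

text \<open>The iteration \<open>X \<mapsto> X (3 - X\<^sup>* X) / 2\<close>. It leaves the polar part of \<open>T\<close> unchanged and drives
  the absolute value to a projection.\<close>

primrec newton :: "nat \<Rightarrow> ('h::real_inner \<Rightarrow> 'h) \<Rightarrow> ('h \<Rightarrow> 'h) \<Rightarrow> 'h \<Rightarrow> 'h" where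
  "newton 0 T T' = T"
| "newton (Suc k) T T' =
     (\<lambda>f. (3/2) *\<^sub>R newton k T T' f - (1/2) *\<^sub>R newton k T T' (newton k T' T (newton k T T' f)))"

lemma newton_adj: "adj T T' \<Longrightarrow> adj (newton k T T') (newton k T' T)"
proof (induction k)
  case (Suc k)
  let ?X = "newton k T T'" and ?X' = "newton k T' T"
  have "adj (\<lambda>f. (3/2) *\<^sub>R ?X f - (1/2) *\<^sub>R ?X (?X' (?X f))) (\<lambda>f. (3/2) *\<^sub>R ?X' f - (1/2) *\<^sub>R ?X' (?X (?X' f)))"
    using Suc adj_comp[OF adj_comp[OF Suc.IH adj_sym[OF Suc.IH] ] Suc.IH]
    by (intro adj_diff adj_scaleR) auto
  then show ?case by simp
qed simp

locale contraction_pair =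
  fixes T T' :: "'h::real_inner \<Rightarrow> 'h"
  assumes adj: "adj T T'"
    and contraction: "norm (T f) \<le> norm f"
begin

abbreviation "S \<equiv> \<lambda>f. T' (T f)"
abbreviation "X k \<equiv> newton k T T'"
abbreviation "X' k \<equiv> newton k T' T"
abbreviation "compl k \<equiv> \<lambda>f. f - X' k (X k f)"
abbreviation "factor k \<equiv> \<lambda>f. f + (1/2) *\<^sub>R compl k f"

lemma inner_S: "inner (S f) f = (norm (T f))\<^sup>2"
  using adjD[OF adj_sym[OF adj], of "T f" f] by (simp add: power2_norm_eq_inner)

sublocale positive_contraction S
proof
  show "adj S S"
    using adj_comp[OF adj_sym[OF adj] adj] by simp
  show "0 \<le> inner (S f) f" for f by (simp add: inner_S)
  show "(norm (S f))\<^sup>2 \<le> inner (S f) f" for f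
    using adj_contraction[OF adj contraction, of "T f"] by (simp add: inner_S power_mono)
qed

lemma linear_X: "linear (X k)" and linear_X': "linear (X' k)"
  using adj_linear newton_adj adj adj_sym by blast+

lemma X_Suc: "X (Suc k) f = X k (factor k f)"
proof -
  have "(3/2) *\<^sub>R X k f = X k f + (1/2) *\<^sub>R X k f"
    using scaleR_add_left[of 1 "1/2" "X k f"] by simp
  then show ?thesis
    by (simp add: linear_add[OF linear_X] linear_diff[OF linear_X] linear_scale[OF linear_X] scaleR_diff_right)
qed

lemma X'_Suc: "X' (Suc k) f = X' k f + (1/2) *\<^sub>R compl k (X' k f)"
proof -
  have "(3/2) *\<^sub>R X' k f = X' k f + (1/2) *\<^sub>R X' k f"
    using scaleR_add_left[of 1 "1/2" "X' k f"] by simp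
  then show ?thesis
    by (simp add: scaleR_diff_right)
qed

text \<open>With \<open>S\<^sub>k = X\<^sub>k\<^sup>* X\<^sub>k\<close> and \<open>D\<^sub>k = 1 - S\<^sub>k\<close>, the recursion reads \<open>S\<^sub>k\<^sub>+\<^sub>1 = (1 + D\<^sub>k/2) S\<^sub>k (1 + D\<^sub>k/2)\<close> and
  \<open>D\<^sub>k\<^sub>+\<^sub>1 = (3/4) D\<^sub>k\<^sup>2 + (1/4) D\<^sub>k\<^sup>3\<close>, and both sides are visibly positive.\<close>

lemma S_D_in_pos_cone: "(\<lambda>f. X' k (X k f)) \<in> pos_cone S \<and> compl k \<in> pos_cone S"
proof (induction k)
  case 0
  then show ?case
    using pos_cone.mult[OF pos_cone.one, of S] pos_cone.mult_compl[OF pos_cone.one, of S] by simp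
next
  case (Suc k)
  let ?S = "\<lambda>f. X' k (X k f)" and ?D = "compl k"
  have D: "?D \<in> pos_cone S"
    using Suc by blast
  have R: "factor k \<in> pos_cone S"
    using pos_cone.add[OF pos_cone.one pos_cone.scale[OF D, of "1/2"] ] by simp
  have eq: "X' (Suc k) (X (Suc k) f) = factor k (?S (factor k f))" for f
    by (simp only: X_Suc X'_Suc)
  have linS: "linear ?S" and linD: "linear ?D"
    using pos_cone_linear Suc linear_S by blast+
  have "f - factor k (?S (factor k f)) = (3/4) *\<^sub>R ?D (?D f) + (1/4) *\<^sub>R ?D (?D (?D f))" for f
  proof -
    define E where "E = ?D"
    have E: "E (g + h) = E g + E h" "E (g - h) = E g - E h" "E (r *\<^sub>R g) = r *\<^sub>R E g" for g h r
      using linear_add[OF linD] linear_diff[OF linD] linear_scale[OF linD] by (simp_all only: E_def)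
    have S: "?S g = g - E g" for g by (simp add: E_def)
    have R: "factor k g = g + (1/2) *\<^sub>R E g" for g by (simp add: E_def)
    have "factor k (?S (factor k f)) = f - (3/4) *\<^sub>R E (E f) - (1/4) *\<^sub>R E (E (E f))"
      unfolding R S E
      by (rule vector_eq_ldot[THEN iffD1], rule allI) (simp add: inner_simps field_simps)
    then show ?thesis by (simp add: E_def)
  qed
  then have "compl (Suc k) = (\<lambda>f. (3/4) *\<^sub>R ?D (?D f) + (1/4) *\<^sub>R ?D (?D (?D f)))"
    by (simp only: eq)
  moreover have "(\<lambda>f. (3/4) *\<^sub>R ?D (?D f) + (1/4) *\<^sub>R ?D (?D (?D f))) \<in> pos_cone S"
    using pos_cone.add[OF pos_cone.scale[OF pos_cone_comp[OF D D], of "3/4"]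
        pos_cone.scale[OF pos_cone_comp[OF D pos_cone_comp[OF D D] ], of "1/4"] ] by simp
  moreover have "(\<lambda>f. X' (Suc k) (X (Suc k) f)) \<in> pos_cone S"
    unfolding eq using pos_cone_comp[OF R pos_cone_comp[OF conjunct1[OF Suc] R] ] by simp
  ultimately show ?case by (simp only: simp_thms)
qed

lemma norm_X: "(norm (X k f))\<^sup>2 = inner (X' k (X k f)) f"
  using adjD[OF newton_adj[OF adj, of k], of f "X k f"] by (simp add: power2_norm_eq_inner inner_commute)

lemma X_contraction: "norm (X k f) \<le> norm f"
proof (rule power2_le_imp_le)
  have "0 \<le> inner (compl k f) f"
    using pos_cone_nonneg S_D_in_pos_cone by blast
  then show "(norm (X k f))\<^sup>2 \<le> (norm f)\<^sup>2"
    by (simp add: norm_X inner_diff power2_norm_eq_inner[of f])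
qed simp

lemma X_factor:
  assumes "k \<le> l"
  obtains Q where "Q \<in> pos_cone S" "\<And>f. X l f = X k (f + Q f)"
proof -
  have "\<exists>Q\<in>pos_cone S. \<forall>f. X l f = X k (f + Q f)"
    using assms
  proof (induction l rule: dec_induct)
    case base
    then show ?case using pos_cone_zero by (intro bexI[of _ "\<lambda>f. 0"]) auto
  next
    case (step l)
    then obtain Q where Q: "Q \<in> pos_cone S" "\<And>f. X l f = X k (f + Q f)" by blast
    let ?D = "\<lambda>f. (1/2) *\<^sub>R compl l f"
    have D: "?D \<in> pos_cone S"
      using pos_cone.scale[OF conjunct2[OF S_D_in_pos_cone], of "1/2"] by simp
    have "(\<lambda>f. ?D f + Q (f + ?D f)) \<in> pos_cone S"
      using pos_cone.add[OF D pos_cone_comp[OF Q(1) pos_cone.add[OF pos_cone.one D] ] ] by simp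
    moreover have "X (Suc l) f = X k (f + (?D f + Q (f + ?D f)))" for f
      by (simp only: X_Suc Q(2) add.assoc)
    ultimately show ?case
      by (intro bexI[of _ "\<lambda>f. ?D f + Q (f + ?D f)"] allI)
  qed
  then show ?thesis using that by blast
qed

text \<open>Since \<open>X\<^sub>l = X\<^sub>k (1 + Q)\<close> with a positive polynomial \<open>Q\<close>, the increment \<open>X\<^sub>l f - X\<^sub>k f\<close> forms an
  acute angle with \<open>X\<^sub>k f\<close>.\<close>

lemma X_increment:
  assumes "k \<le> l"
  shows "(norm (X l f - X k f))\<^sup>2 \<le> (norm (X l f))\<^sup>2 - (norm (X k f))\<^sup>2"
proof -
  obtain Q where Q: "Q \<in> pos_cone S" "\<And>f. X l f = X k (f + Q f)"
    using X_factor[OF assms] by blast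
  have "0 \<le> inner (X' k (X k (Q f))) f"
    using pos_cone_nonneg[OF pos_cone_comp[OF conjunct1[OF S_D_in_pos_cone] Q(1)] ] .
  then have "0 \<le> inner (X k (Q f)) (X k f)"
    using adjD[OF newton_adj[OF adj_sym[OF adj], of k], of "X k (Q f)" f] by simp
  moreover have "X l f = X k f + X k (Q f)"
    by (simp add: Q(2) linear_add[OF linear_X])
  ultimately show ?thesis
    by (simp add: power2_norm_eq_inner inner_add inner_diff inner_commute)
qed

end

lemma tendsto_contraction_apply:
  fixes A :: "nat \<Rightarrow> 'h::real_normed_vector \<Rightarrow> 'h"
  assumes "\<And>n. linear (A n)" "\<And>n f. norm (A n f) \<le> norm f" "\<And>f. (\<lambda>n. A n f) \<longlonglongrightarrow> a f" "g \<longlonglongrightarrow> l"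
  shows "(\<lambda>n. A n (g n)) \<longlonglongrightarrow> a l"
proof -
  have "(\<lambda>n. norm (g n - l)) \<longlonglongrightarrow> 0"
    using assms(4) by (simp add: LIM_zero tendsto_norm_zero)
  then have "(\<lambda>n. A n (g n - l)) \<longlonglongrightarrow> 0"
    by (rule Lim_null_comparison[rotated]) (simp add: assms(2))
  from tendsto_add[OF this assms(3)[of l] ] show ?thesis
    by (simp add: linear_diff[OF assms(1)])
qed

text \<open>The squared norms increase and are bounded, hence are Cauchy, and their increments dominate the
  squared distances.\<close>

lemma increasing_strong_limit:
  fixes X X' :: "nat \<Rightarrow> 'h::{real_inner, complete_space} \<Rightarrow> 'h"
  assumes adj: "\<And>n. adj (X n) (X' n)"
    and contraction: "\<And>n f. norm (X n f) \<le> norm f"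
    and increment: "\<And>k l f. k \<le> l \<Longrightarrow> (norm (X l f - X k f))\<^sup>2 \<le> (norm (X l f))\<^sup>2 - (norm (X k f))\<^sup>2"
    and increment': "\<And>k l f. k \<le> l \<Longrightarrow> (norm (X' l f - X' k f))\<^sup>2 \<le> (norm (X' l f))\<^sup>2 - (norm (X' k f))\<^sup>2"
  shows "\<exists>v v'. adj v v' \<and> (\<forall>f. (\<lambda>n. X n f) \<longlonglongrightarrow> v f) \<and> (\<forall>f. (\<lambda>n. X' n f) \<longlonglongrightarrow> v' f) \<and>
    (\<forall>f. norm (v f) \<le> norm f) \<and> (\<forall>k f. norm (X k f) \<le> norm (v f))"
proof -
  have conv: "\<exists>l. (\<lambda>n. Y n f) \<longlonglongrightarrow> l"
    if c: "\<And>n f. norm (Y n f) \<le> norm f"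
      and inc: "\<And>k l f. k \<le> l \<Longrightarrow> (norm (Y l f - Y k f))\<^sup>2 \<le> (norm (Y l f))\<^sup>2 - (norm (Y k f))\<^sup>2"
    for Y :: "nat \<Rightarrow> 'h \<Rightarrow> 'h" and f
  proof -
    let ?a = "\<lambda>n. (norm (Y n f))\<^sup>2"
    have "mono ?a"
      using inc[of _ _ f] by (intro monoI) (smt (verit) zero_le_power2)
    moreover have "?a n \<le> (norm f)\<^sup>2" for n
      by (intro power_mono c) simp
    ultimately have "convergent ?a"
      by (intro Bseq_monoseq_convergent BseqI'[of _ "(norm f)\<^sup>2"]) (auto simp: mono_def monoseq_def)
    then have a: "Cauchy ?a"
      by (rule convergent_Cauchy)
    have "Cauchy (\<lambda>n. Y n f)"
      unfolding Cauchy_altdef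
    proof (intro allI impI)
      fix e :: real assume e: "0 < e"
      then obtain N where N: "\<And>m n. m \<ge> N \<Longrightarrow> n \<ge> N \<Longrightarrow> dist (?a m) (?a n) < e\<^sup>2"
        using a unfolding Cauchy_def by (metis zero_less_power)
      have "dist (Y m f) (Y n f) < e" if "m \<ge> N" "n > m" for m n
      proof -
        have "(norm (Y n f - Y m f))\<^sup>2 < e\<^sup>2"
          using inc[of m n f] N[of m n] that by (auto simp: dist_real_def)
        then show ?thesis
          using e by (simp add: dist_norm norm_minus_commute power_less_imp_less_base)
      qed
      then show "\<exists>M. \<forall>m\<ge>M. \<forall>n>m. dist (Y m f) (Y n f) < e" by blast
    qed
    then show ?thesis
      by (simp add: Cauchy_convergent convergent_def[symmetric])
  qed
  have contraction': "norm (X' n f) \<le> norm f" for n f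
    by (rule adj_contraction[OF adj contraction])
  have "\<forall>f. \<exists>l. (\<lambda>n. X n f) \<longlonglongrightarrow> l"
    using conv[of X, OF contraction increment] by blast
  from choice[OF this] obtain v where v: "\<And>f. (\<lambda>n. X n f) \<longlonglongrightarrow> v f"
    by blast
  have "\<forall>f. \<exists>l. (\<lambda>n. X' n f) \<longlonglongrightarrow> l"
    using conv[of X', OF contraction' increment'] by blast
  from choice[OF this] obtain v' where v': "\<And>f. (\<lambda>n. X' n f) \<longlonglongrightarrow> v' f"
    by blast
  have "adj v v'"
    unfolding adj_def
  proof (intro allI)
    fix f g
    have "(\<lambda>n. inner (X n f) g) \<longlonglongrightarrow> inner (v f) g"
      by (intro tendsto_intros v)
    moreover have "(\<lambda>n. inner (X n f) g) \<longlonglongrightarrow> inner f (v' g)"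
      using tendsto_inner[OF tendsto_const v'] by (simp add: adjD[OF adj])
    ultimately show "inner (v f) g = inner f (v' g)"
      using LIMSEQ_unique by blast
  qed
  moreover have "norm (v f) \<le> norm f" for f
    by (rule LIMSEQ_le_const2[OF tendsto_norm[OF v] ]) (use contraction in blast)
  moreover have "norm (X k f) \<le> norm (v f)" for k f
  proof (rule LIMSEQ_le_const[OF tendsto_norm[OF v] ])
    have "norm (X k f) \<le> norm (X n f)" if "n \<ge> k" for n
    proof (rule power2_le_imp_le)
      show "(norm (X k f))\<^sup>2 \<le> (norm (X n f))\<^sup>2"
        using increment[OF that, of f] zero_le_power2[of "norm (X n f - X k f)"] by linarith
    qed simp
    then show "\<exists>N. \<forall>n\<ge>N. norm (X k f) \<le> norm (X n f)" by blast
  qed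
  ultimately show ?thesis
    using v v' by blast
qed

section \<open>Comparison of projections in a factor with a trace\<close>

definition self_adjoint_idempotent :: "('h::real_inner \<Rightarrow> 'h) \<Rightarrow> bool" where
  "self_adjoint_idempotent p \<longleftrightarrow> adj p p \<and> (\<forall>f. p (p f) = p f)"

text \<open>What the comparison of projections uses of a finite factor in standard form: a real algebra of
  bounded operators that contains adjoints and bounded strong limits, with a separating trace vector.
  That the algebra is a factor enters as the statement that two non-zero projections are linked by
  some element.\<close>

locale tracial_factor =
  fixes M :: "('h::{real_inner, complete_space} \<Rightarrow> 'h) set" and \<delta> :: 'h
  assumes bounded: "T \<in> M \<Longrightarrow> bounded_linear T"
    and adj_closed: "T \<in> M \<Longrightarrow> \<exists>T'\<in>M. adj T T'"
    and comp_closed: "S \<in> M \<Longrightarrow> T \<in> M \<Longrightarrow> (\<lambda>f. S (T f)) \<in> M"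
    and add_closed: "S \<in> M \<Longrightarrow> T \<in> M \<Longrightarrow> (\<lambda>f. S f + T f) \<in> M"
    and scale_closed: "T \<in> M \<Longrightarrow> (\<lambda>f. r *\<^sub>R T f) \<in> M"
    and limit_closed: "(\<And>n. X n \<in> M) \<Longrightarrow> (\<And>f. (\<lambda>n. X n f) \<longlonglongrightarrow> v f) \<Longrightarrow> adj v v' \<Longrightarrow>
      (\<And>f. norm (v f) \<le> norm f) \<Longrightarrow> v \<in> M"
    and separating: "T \<in> M \<Longrightarrow> T \<delta> = 0 \<Longrightarrow> T f = 0"
    and trace: "S \<in> M \<Longrightarrow> T \<in> M \<Longrightarrow> inner (S (T \<delta>)) \<delta> = inner (T (S \<delta>)) \<delta>"
    and factor: "p \<in> M \<Longrightarrow> q \<in> M \<Longrightarrow> self_adjoint_idempotent p \<Longrightarrow> self_adjoint_idempotent q \<Longrightarrow>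
      (\<And>T f. T \<in> M \<Longrightarrow> p (T (q f)) = 0) \<Longrightarrow> (\<forall>f. p f = 0) \<or> (\<forall>f. q f = 0)"
begin

lemma diff_closed: "S \<in> M \<Longrightarrow> T \<in> M \<Longrightarrow> (\<lambda>f. S f - T f) \<in> M"
  using add_closed[OF _ scale_closed[of T "-1"] ] by simp

lemma adj_in_M: "T \<in> M \<Longrightarrow> adj T T' \<Longrightarrow> T' \<in> M"
proof -
  assume "T \<in> M" "adj T T'"
  then obtain T'' where "T'' \<in> M" "adj T T''" using adj_closed by blast
  moreover have "T' = T''" using adj_unique[OF \<open>adj T T'\<close> \<open>adj T T''\<close>] by blast
  ultimately show ?thesis by simp
qed

lemma newton_in_M:
  assumes "T \<in> M" "adj T T'"
  shows "newton k T T' \<in> M \<and> newton k T' T \<in> M"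
proof (induction k)
  case 0
  then show ?case using assms adj_in_M by simp
next
  case (Suc k)
  have "(\<lambda>f. (3/2) *\<^sub>R Y f - (1/2) *\<^sub>R Y (Z (Y f))) \<in> M" if "Y \<in> M" "Z \<in> M" for Y Z
    by (rule diff_closed[OF scale_closed[OF that(1)] scale_closed[OF comp_closed[OF that(1) comp_closed[OF that(2,1)] ] ] ])
  then show ?case using Suc by simp
qed

text \<open>The strong limit \<open>v\<close> of the iteration satisfies \<open>v = (3/2) v - (1/2) v v\<^sup>* v\<close>, so it is a partial
  isometry. It does not vanish where \<open>T\<close> does not, and it inherits from \<open>T\<close> its left and right
  units, because all iterates have them.\<close>

lemma polar_part:
  assumes "T \<in> M" "adj T T'" "\<And>f. norm (T f) \<le> norm f"
  shows "\<exists>v v'. v \<in> M \<and> adj v v' \<and> (\<forall>f. v (v' (v f)) = v f) \<and> (\<forall>f. norm (T f) \<le> norm (v f)) \<and>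
    (\<forall>p\<in>M. (\<forall>f. p (T f) = T f) \<longrightarrow> (\<forall>f. p (v f) = v f)) \<and>
    (\<forall>q. (\<forall>f. T (q f) = T f) \<longrightarrow> (\<forall>f. v (q f) = v f))"
proof -
  interpret T: contraction_pair T T'
    by standard fact+
  interpret T': contraction_pair T' T
    by standard (use assms adj_sym adj_contraction in blast)+
  let ?X = "\<lambda>k. newton k T T'" and ?X' = "\<lambda>k. newton k T' T"
  obtain v v' where v: "adj v v'" "\<And>f. (\<lambda>n. ?X n f) \<longlonglongrightarrow> v f" "\<And>f. (\<lambda>n. ?X' n f) \<longlonglongrightarrow> v' f"
    "\<And>f. norm (v f) \<le> norm f" "\<And>k f. norm (?X k f) \<le> norm (v f)"
    using increasing_strong_limit[where X = ?X and X' = ?X',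
        OF newton_adj[OF assms(2)] T.X_contraction T.X_increment T'.X_increment]
    by blast
  have "v \<in> M"
    using limit_closed[of ?X v v'] newton_in_M[OF assms(1,2)] v by blast
  moreover have "v (v' (v f)) = v f" for f
  proof -
    have "(\<lambda>k. ?X k (?X' k (?X k f))) \<longlonglongrightarrow> v (v' (v f))"
      using v(2,3) T.X_contraction T'.X_contraction T.linear_X T'.linear_X
      by (rule_tac tendsto_contraction_apply[where A = ?X, OF _ _ _ tendsto_contraction_apply[where A = ?X'] ])
    then have "(\<lambda>k. ?X (Suc k) f) \<longlonglongrightarrow> (3/2) *\<^sub>R v f - (1/2) *\<^sub>R v (v' (v f))"
      unfolding newton.simps by (intro tendsto_intros v)
    moreover have "(\<lambda>k. ?X (Suc k) f) \<longlonglongrightarrow> v f"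
      by (rule LIMSEQ_Suc[OF v(2)])
    ultimately have "v f = (3/2) *\<^sub>R v f - (1/2) *\<^sub>R v (v' (v f))"
      using LIMSEQ_unique by blast
    moreover have "(3/2) *\<^sub>R v f = v f + (1/2) *\<^sub>R v f"
      using scaleR_add_left[of 1 "1/2" "v f"] by simp
    ultimately show ?thesis by simp
  qed
  moreover have "norm (T f) \<le> norm (v f)" for f
    using v(5)[of 0] by simp
  moreover have "p (v f) = v f" if "p \<in> M" "\<And>f. p (T f) = T f" for p f
  proof -
    interpret p: bounded_linear p using bounded that(1) .
    have "p (?X k f) = ?X k f" for k f
    proof (induction k arbitrary: f)
      case (Suc k)
      then show ?case by (simp add: p.diff p.scaleR)
    qed (simp add: that)
    then have "(\<lambda>k. ?X k f) \<longlonglongrightarrow> p (v f)"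
      using p.tendsto[OF v(2)[of f] ] by simp
    then show ?thesis
      using v(2) LIMSEQ_unique by blast
  qed
  moreover have "v (q f) = v f" if "\<And>f. T (q f) = T f" for q f
  proof -
    have "?X k (q f) = ?X k f" for k f
      by (induction k arbitrary: f) (simp_all add: that)
    then show ?thesis
      using v(2)[of f] v(2)[of "q f"] LIMSEQ_unique by simp
  qed
  ultimately show ?thesis
    using v(1) by blast
qed

end

definition partial_isometry :: "('h::real_inner \<Rightarrow> 'h) \<Rightarrow> ('h \<Rightarrow> 'h) \<Rightarrow> bool" where
  "partial_isometry v v' \<longleftrightarrow> adj v v' \<and> (\<forall>f. v (v' (v f)) = v f)"

text \<open>\<open>w\<close> extends \<open>v\<close>: both agree on the support of \<open>v\<close>, and so do the adjoints.\<close>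

definition extends :: "('h \<Rightarrow> 'h) \<Rightarrow> ('h \<Rightarrow> 'h) \<Rightarrow> ('h \<Rightarrow> 'h) \<Rightarrow> bool" where
  "extends v v' w \<longleftrightarrow> (\<forall>f. w (v' (v f)) = v f) \<and> (\<forall>f. v (v' (w f)) = v f)"

lemma partial_isometry_adj: "partial_isometry v v' \<Longrightarrow> adj v v'"
  and partial_isometry_id: "partial_isometry v v' \<Longrightarrow> v (v' (v f)) = v f"
  by (simp_all add: partial_isometry_def)

lemma adj_eqI:
  assumes "adj S S'" "adj T T'" "\<And>f. S f = T f"
  shows "S' f = T' f"
proof -
  have "adj S T'" using assms(2,3) by (simp add: adj_def)
  then show ?thesis using adj_unique[OF assms(1)] by blast
qed

lemma partial_isometry_sym:
  assumes "partial_isometry v v'"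
  shows "partial_isometry v' v"
proof -
  note a = partial_isometry_adj[OF assms]
  have "v' (v (v' f)) = v' f" for f
    by (rule adj_eqI[OF adj_comp[OF a adj_comp[OF adj_sym[OF a] a] ] a])
      (rule partial_isometry_id[OF assms])
  then show ?thesis using adj_sym[OF a] by (simp add: partial_isometry_def)
qed

lemma partial_isometry_contraction:
  assumes "partial_isometry v v'"
  shows "norm (v f) \<le> norm f"
proof -
  note a = partial_isometry_adj[OF assms]
  have 1: "inner (v' (v f)) f = (norm (v f))\<^sup>2"
    using adjD[OF adj_sym[OF a], of "v f" f] by (simp add: power2_norm_eq_inner)
  have "(norm (v' (v f)))\<^sup>2 = (norm (v f))\<^sup>2"
    using adjD[OF adj_sym[OF a], of "v f" "v' (v f)"]
    by (simp add: power2_norm_eq_inner partial_isometry_id[OF assms])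
  then have "norm (v' (v f)) = norm (v f)" by simp
  then have "(norm (v f))\<^sup>2 \<le> norm (v f) * norm f"
    using norm_cauchy_schwarz[of "v' (v f)" f] 1 by simp
  then show ?thesis
    by (cases "norm (v f) = 0") (simp_all add: power2_eq_square)
qed

lemma extends_refl: "partial_isometry v v' \<Longrightarrow> extends v v' v"
  by (simp add: extends_def partial_isometry_def)

lemma extends_sym:
  assumes "extends v v' w" "adj v v'" "adj w w'"
  shows "extends v' v w'"
proof -
  have "w' (v (v' f)) = v' f" for f
    by (rule adj_eqI[OF adj_comp[OF assms(2) adj_comp[OF adj_sym[OF assms(2)] assms(3)] ] assms(2)])
      (use assms(1) in \<open>simp add: extends_def\<close>)
  moreover have "v' (v (w' f)) = v' f" for f
    by (rule adj_eqI[OF adj_comp[OF assms(3) adj_comp[OF adj_sym[OF assms(2)] assms(2)] ] assms(2)])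
      (use assms(1) in \<open>simp add: extends_def\<close>)
  ultimately show ?thesis by (simp add: extends_def)
qed

lemma extends_adjoint_apply:
  assumes "extends v v' w" "partial_isometry v v'" "adj w w'"
  shows "w' (v f) = v' (v f)"
proof -
  have "w' (v (v' (v f))) = v' (v f)"
    using extends_sym[OF assms(1) partial_isometry_adj[OF assms(2)] assms(3)] by (simp add: extends_def)
  then show ?thesis by (simp add: partial_isometry_id[OF assms(2)])
qed

lemma extends_trans:
  assumes vw: "extends v v' w" and wx: "extends w w' x"
    and v: "partial_isometry v v'" and w: "partial_isometry w w'"
  shows "extends v v' x"
proof -
  note av = partial_isometry_adj[OF v] and aw = partial_isometry_adj[OF w]
  have 1: "w' (w (v' (v f))) = v' (v f)" for f
    using extends_adjoint_apply[OF vw v aw] vw by (simp add: extends_def)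
  have 2: "w (w' (v (v' f))) = v (v' f)" for f
    using extends_adjoint_apply[OF extends_sym[OF vw av aw] partial_isometry_sym[OF v] adj_sym[OF aw] ]
      extends_sym[OF vw av aw] by (simp add: extends_def)
  have 3: "v (v' (w (w' f))) = v (v' f)" for f
    by (rule adj_eqI[OF adj_comp[OF adj_comp[OF aw adj_sym[OF aw] ] adj_comp[OF av adj_sym[OF av] ] ]
          adj_comp[OF av adj_sym[OF av] ] ]) (rule 2)
  have "x (v' (v f)) = v f" for f
  proof -
    have "x (v' (v f)) = x (w' (w (v' (v f))))" by (simp only: 1)
    also have "\<dots> = w (v' (v f))" using wx by (simp add: extends_def)
    also have "\<dots> = v f" using vw by (simp add: extends_def)
    finally show ?thesis .
  qed
  moreover have "v (v' (x f)) = v f" for f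
  proof -
    have "v (v' (x f)) = v (v' (w (w' (x f))))" by (simp only: 3)
    also have "w (w' (x f)) = w f" using wx by (simp add: extends_def)
    also have "v (v' (w f)) = v f" using vw by (simp add: extends_def)
    finally show ?thesis .
  qed
  ultimately show ?thesis by (simp add: extends_def)
qed

text \<open>The adjoint of \<open>w\<close> agrees with that of \<open>v\<close> on the range of \<open>v\<close>, so \<open>w - v\<close> is orthogonal to \<open>v\<close>.\<close>

lemma extends_increment:
  assumes "extends v v' w" "partial_isometry v v'" "adj w w'"
  shows "(norm (w f - v f))\<^sup>2 = (norm (w f))\<^sup>2 - (norm (v f))\<^sup>2"
proof -
  have "inner (w f) (v f) = inner f (w' (v f))"
    by (rule adjD[OF assms(3)])
  also have "\<dots> = inner (v f) (v f)"
    by (simp add: extends_adjoint_apply[OF assms] adjD[OF partial_isometry_adj[OF assms(2)] ])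
  finally show ?thesis
    by (simp add: power2_norm_eq_inner inner_diff inner_commute)
qed

lemma near_maximum:
  fixes A :: "real set"
  assumes "A \<noteq> {}" "\<And>a. a \<in> A \<Longrightarrow> a \<le> B" "0 < e"
  shows "\<exists>a\<in>A. \<forall>b\<in>A. b \<le> a + e"
proof -
  have bdd: "bdd_above A" using assms(2) by (auto simp: bdd_above_def)
  obtain a where "a \<in> A" "Sup A - e < a"
    using less_cSup_iff[OF assms(1) bdd, of "Sup A - e"] assms(3) by auto
  moreover have "b \<le> a + e" if "b \<in> A" for b
    using cSup_upper[OF that bdd] \<open>Sup A - e < a\<close> by linarith
  ultimately show ?thesis by blast
qed

context tracial_factor
begin

text \<open>The partial isometries from a subspace of the range of \<open>q\<close> onto one of the range of \<open>p\<close>.\<close>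

definition partial_equivalence :: "('h \<Rightarrow> 'h) \<Rightarrow> ('h \<Rightarrow> 'h) \<Rightarrow> ('h \<Rightarrow> 'h) \<Rightarrow> ('h \<Rightarrow> 'h) \<Rightarrow> bool" where
  "partial_equivalence p q v v' \<longleftrightarrow>
     v \<in> M \<and> partial_isometry v v' \<and> (\<forall>f. p (v f) = v f) \<and> (\<forall>f. v (q f) = v f)"

text \<open>A sequence of extensions in which every step comes close to the largest possible increase of
  \<open>norm (v \<delta>)\<close> converges, because the increments of the squared norms bound the distances. Its limit
  leaves no room for a further orthogonal piece.\<close>

lemma maximal_partial_equivalence:
  assumes "p \<in> M"
  shows "\<exists>v v'. partial_equivalence p q v v' \<and>
    (\<forall>z z'. partial_equivalence p q z z' \<longrightarrow> (\<forall>f. v' (z f) = 0) \<longrightarrow> (\<forall>f. z (v' f) = 0) \<longrightarrow> (\<forall>f. z f = 0))"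
proof -
  interpret p: bounded_linear p using bounded assms(1) .
  let ?V = "partial_equivalence p q"
  have V: "v \<in> M" "partial_isometry v v'" "adj v v'" "bounded_linear v" "p (v f) = v f" "v (q f) = v f"
    "norm (v f) \<le> norm f"
    if "?V v v'" for v v' f
    using that bounded partial_isometry_adj partial_isometry_contraction
    by (auto simp: partial_equivalence_def)
  have zero: "?V (\<lambda>_. 0) (\<lambda>_. 0)"
    using scale_closed[OF assms(1), of 0]
    by (simp add: partial_equivalence_def partial_isometry_def adj_def p.zero)
  (* The step from x to y nearly exhausts what any extension w of x can reach. *)
  let ?P = "\<lambda>x. ?V (fst x) (snd x)"
  let ?Q = "\<lambda>n x y. extends (fst x) (snd x) (fst y) \<and>
    (\<forall>w w'. ?V w w' \<and> extends (fst x) (snd x) w \<longrightarrow>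
      (norm (w \<delta>))\<^sup>2 \<le> (norm (fst y \<delta>))\<^sup>2 + inverse (real (Suc n)))"
  have "\<exists>y. ?P y \<and> ?Q n x y" if x: "?P x" for x n
  proof -
    let ?A = "{(norm (w \<delta>))\<^sup>2 | w w'. ?V w w' \<and> extends (fst x) (snd x) w}"
    have "(norm (fst x \<delta>))\<^sup>2 \<in> ?A"
      using x extends_refl[OF V(2)[OF x] ] by blast
    then have "?A \<noteq> {}" by blast
    moreover have "a \<le> (norm \<delta>)\<^sup>2" if "a \<in> ?A" for a
      using that V(7) by (auto intro!: power_mono)
    moreover have "0 < inverse (real (Suc n))" by simp
    ultimately have "\<exists>a\<in>?A. \<forall>b\<in>?A. b \<le> a + inverse (real (Suc n))"
      by (rule near_maximum)
    then obtain w w' where "?V w w'" "extends (fst x) (snd x) w"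
        "\<forall>b\<in>?A. b \<le> (norm (w \<delta>))\<^sup>2 + inverse (real (Suc n))"
      by blast
    then show ?thesis
      by (intro exI[of _ "(w, w')"]) auto
  qed
  note succ = this
  have "\<exists>x. \<forall>n. ?P (x n) \<and> ?Q n (x n) (x (Suc n))"
  proof (rule dependent_nat_choice)
    show "\<exists>x. ?P x"
      using zero by (intro exI[of _ "(\<lambda>_. 0, \<lambda>_. 0)"]) simp
    show "\<exists>y. ?P y \<and> ?Q n x y" if "?P x" for x n
      by (rule succ[OF that])
  qed
  then obtain x where x: "\<And>n. ?P (x n)" "\<And>n. ?Q n (x n) (x (Suc n))"
    by blast
  define X X' where "X = (\<lambda>n. fst (x n))" and "X' = (\<lambda>n. snd (x n))"
  have X: "?V (X n) (X' n)" for n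
    using x(1) by (simp add: X_def X'_def)
  have step: "extends (X n) (X' n) (X (Suc n))" for n
    using x(2) by (simp add: X_def X'_def)
  have large: "(norm (w \<delta>))\<^sup>2 \<le> (norm (X (Suc n) \<delta>))\<^sup>2 + inverse (real (Suc n))"
    if "?V w w'" "extends (X n) (X' n) w" for n w w'
    using x(2) that by (simp add: X_def X'_def) blast
  have ext: "extends (X k) (X' k) (X l)" if "k \<le> l" for k l
    using that
  proof (induction l rule: dec_induct)
    case base
    show ?case by (rule extends_refl[OF V(2)[OF X] ])
  next
    case (step l)
    show ?case by (rule extends_trans[OF step.IH \<open>\<And>n. extends (X n) (X' n) (X (Suc n))\<close> V(2)[OF X] V(2)[OF X] ])
  qed
  have inc: "(norm (X l f - X k f))\<^sup>2 \<le> (norm (X l f))\<^sup>2 - (norm (X k f))\<^sup>2" if "k \<le> l" for k l f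
    using extends_increment[OF ext[OF that] V(2)[OF X] V(3)[OF X] ] by simp
  have inc': "(norm (X' l f - X' k f))\<^sup>2 \<le> (norm (X' l f))\<^sup>2 - (norm (X' k f))\<^sup>2" if "k \<le> l" for k l f
    using extends_increment[OF extends_sym[OF ext[OF that] V(3)[OF X] V(3)[OF X] ]
        partial_isometry_sym[OF V(2)[OF X] ] adj_sym[OF V(3)[OF X] ] ] by simp
  obtain v v' where v: "adj v v'" "\<And>f. (\<lambda>n. X n f) \<longlonglongrightarrow> v f" "\<And>f. (\<lambda>n. X' n f) \<longlonglongrightarrow> v' f"
    "\<And>f. norm (v f) \<le> norm f" "\<And>k f. norm (X k f) \<le> norm (v f)"
    using increasing_strong_limit[where X = X and X' = X', OF V(3)[OF X] V(7)[OF X] inc inc']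
    by blast
  have "v \<in> M"
    by (rule limit_closed[OF V(1)[OF X] v(2,1,4)])
  have lin: "linear (X k)" "linear (X' k)" for k
    using adj_linear adj_sym V(3)[OF X] by blast+
  have contr': "norm (X' n f) \<le> norm f" for n f
    by (rule adj_contraction[OF V(3)[OF X] V(7)[OF X] ])
  have "v (v' (v f)) = v f" for f
  proof -
    have "(\<lambda>k. X k (X' k (X k f))) \<longlonglongrightarrow> v (v' (v f))"
      by (rule tendsto_contraction_apply[OF lin(1) V(7)[OF X] v(2)
            tendsto_contraction_apply[OF lin(2) contr' v(3) v(2)] ])
    then show ?thesis
      using v(2)[of f] LIMSEQ_unique by (simp add: partial_isometry_id[OF V(2)[OF X] ])
  qed
  then have pv: "partial_isometry v v'"
    using v(1) by (simp add: partial_isometry_def)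
  have "p (v f) = v f" for f
    using p.tendsto[OF v(2)[of f] ] v(2)[of f] LIMSEQ_unique by (simp add: V(5)[OF X])
  moreover have "v (q f) = v f" for f
    using v(2)[of f] v(2)[of "q f"] LIMSEQ_unique by (simp add: V(6)[OF X])
  ultimately have Vv: "?V v v'"
    using \<open>v \<in> M\<close> pv by (simp add: partial_equivalence_def)
  have extv: "extends (X k) (X' k) v" for k
  proof -
    have "v (X' k (X k f)) = X k f" for f
    proof (rule LIMSEQ_unique[OF v(2)])
      show "(\<lambda>n. X n (X' k (X k f))) \<longlonglongrightarrow> X k f"
        by (rule tendsto_eventually, rule eventually_sequentiallyI[of k])
          (use ext in \<open>auto simp: extends_def\<close>)
    qed
    moreover have "X k (X' k (v f)) = X k f" for f
    proof (rule LIMSEQ_unique)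
      show "(\<lambda>n. X k (X' k (X n f))) \<longlonglongrightarrow> X k (X' k (v f))"
        using V(4)[OF X, THEN bounded_linear.tendsto] bounded[OF adj_in_M[OF V(1)[OF X] V(3)[OF X] ], THEN bounded_linear.tendsto] v(2)
        by blast
      show "(\<lambda>n. X k (X' k (X n f))) \<longlonglongrightarrow> X k f"
        by (rule tendsto_eventually, rule eventually_sequentiallyI[of k])
          (use ext in \<open>auto simp: extends_def\<close>)
    qed
    ultimately show ?thesis by (simp add: extends_def)
  qed
  have "z f = 0" if z: "?V z z'" and orth: "\<And>f. v' (z f) = 0" "\<And>f. z (v' f) = 0" for z z' f
  proof -
    (* The sum of v and z competes with every step of the sequence, which leaves no room for z. *)
    define w w' where "w = (\<lambda>f. v f + z f)" and "w' = (\<lambda>f. v' f + z' f)"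
    note az = V(3)[OF z]
    have lin: "linear v" "linear v'" "linear z" "linear z'"
      using adj_linear adj_sym v(1) az by blast+
    have orth': "z' (v f) = 0" "v (z' f) = 0" for f
      using adj_eqI[OF adj_comp[OF adj_sym[OF v(1)] az], of "\<lambda>_. 0" "\<lambda>_. 0"]
        adj_eqI[OF adj_comp[OF az adj_sym[OF v(1)] ], of "\<lambda>_. 0" "\<lambda>_. 0"] orth
      by (simp_all add: adj_def)
    have 0: "v 0 = 0" "z 0 = 0" "v' 0 = 0" "z' 0 = 0"
      using lin linear_0 by blast+
    have aw: "adj w w'"
      unfolding w_def w'_def by (rule adj_add[OF v(1) az])
    have "w (w' (w f)) = w f" for f
      using orth orth' partial_isometry_id[OF pv] partial_isometry_id[OF V(2)[OF z] ]
      by (simp add: w_def w'_def linear_add[OF lin(1)] linear_add[OF lin(2)] linear_add[OF lin(3)] linear_add[OF lin(4)] 0)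
    then have "?V w w'"
      using aw add_closed[OF \<open>v \<in> M\<close> V(1)[OF z] ] V(5,6)[OF z] V(5,6)[OF Vv]
      by (simp add: partial_equivalence_def partial_isometry_def w_def p.add)
    moreover have "extends v v' w"
      using orth orth' partial_isometry_id[OF pv]
      by (simp add: extends_def w_def linear_add[OF lin(1)] linear_add[OF lin(2)] 0)
    then have "extends (X n) (X' n) w" for n
      using extends_trans[OF extv _ V(2)[OF X] pv] by blast
    ultimately have le: "(norm (w \<delta>))\<^sup>2 \<le> (norm (v \<delta>))\<^sup>2 + inverse (real (Suc n))" for n
      using order_trans[OF large[of w w' n] add_right_mono[OF power_mono[OF v(5)[of "Suc n" \<delta>] norm_ge_zero] ] ]
      by blast
    have "inner (v \<delta>) (z \<delta>) = 0"
      using adjD[OF v(1), of \<delta> "z \<delta>"] orth by simp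
    then have "(norm (w \<delta>))\<^sup>2 = (norm (v \<delta>))\<^sup>2 + (norm (z \<delta>))\<^sup>2"
      by (simp add: w_def power2_norm_eq_inner inner_add inner_commute)
    then have "(norm (z \<delta>))\<^sup>2 \<le> inverse (real (Suc n))" for n
      using le[of n] by simp
    then have "(norm (z \<delta>))\<^sup>2 \<le> 0"
      by (intro LIMSEQ_le_const[OF LIMSEQ_inverse_real_of_nat]) auto
    then show ?thesis
      using separating[OF V(1)[OF z] ] by simp
  qed
  then show ?thesis
    using Vv by blast
qed

text \<open>A maximal partial equivalence exhausts both projections. Otherwise the factor property links the
  two remainders by a non-zero operator, and its polar part would enlarge the equivalence; and the
  trace excludes that only one remainder vanishes.\<close>

theorem equal_trace_imp_equivalent:
  assumes pM: "p \<in> M" and qM: "q \<in> M"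
    and p: "self_adjoint_idempotent p" and q: "self_adjoint_idempotent q"
    and eq: "inner (p \<delta>) \<delta> = inner (q \<delta>) \<delta>"
  obtains v v' where "v \<in> M" "adj v v'" "\<And>f. v' (v f) = q f" "\<And>f. v (v' f) = p f"
proof -
  have ap: "adj p p" and aq: "adj q q" and pp: "\<And>f. p (p f) = p f" and qq: "\<And>f. q (q f) = q f"
    using p q by (simp_all add: self_adjoint_idempotent_def)
  note linp = adj_linear[OF ap] and linq = adj_linear[OF aq]
  obtain v v' where v: "partial_equivalence p q v v'"
    and max: "\<And>z z' f. partial_equivalence p q z z' \<Longrightarrow> (\<And>f. v' (z f) = 0) \<Longrightarrow> (\<And>f. z (v' f) = 0) \<Longrightarrow> z f = 0"
    using maximal_partial_equivalence[OF pM] by blast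
  have vM: "v \<in> M" and pv: "\<And>f. p (v f) = v f" and vq: "\<And>f. v (q f) = v f" and iso: "partial_isometry v v'"
    using v by (simp_all add: partial_equivalence_def)
  note av = partial_isometry_adj[OF iso]
  note v'M = adj_in_M[OF vM av]
  note linv = adj_linear[OF av] and linv' = adj_linear[OF adj_sym[OF av] ]
  have v'p: "v' (p f) = v' f" for f
    by (rule adj_eqI[OF adj_comp[OF ap av] av pv])
  have qv': "q (v' f) = v' f" for f
    by (rule adj_eqI[OF adj_comp[OF av aq] av vq])
  have vv'v: "v (v' (v f)) = v f" and v'vv': "v' (v (v' f)) = v' f" for f
    using iso partial_isometry_sym[OF iso] by (simp_all add: partial_isometry_def)
  define r e where "r = (\<lambda>f. p f - v (v' f))" and "e = (\<lambda>f. q f - v' (v f))"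
  have rM: "r \<in> M" and eM: "e \<in> M"
    unfolding r_def e_def
    by (rule diff_closed[OF pM comp_closed[OF vM v'M] ], rule diff_closed[OF qM comp_closed[OF v'M vM] ])
  have ar: "adj r r" and ae: "adj e e"
    unfolding r_def e_def
    by (rule adj_diff[OF ap adj_comp[OF av adj_sym[OF av] ] ],
        rule adj_diff[OF aq adj_comp[OF adj_sym[OF av] av] ])
  have r: "self_adjoint_idempotent r" and e: "self_adjoint_idempotent e"
    using ar ae pv v'p qv' vq vv'v v'vv' pp qq
    by (simp_all add: self_adjoint_idempotent_def)
      (simp_all add: r_def e_def linear_diff[OF linp] linear_diff[OF linq] linear_diff[OF linv] linear_diff[OF linv']
        linear_0[OF linv] linear_0[OF linv'])
  have rr: "r (r f) = r f" and ee: "e (e f) = e f" for f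
    using r e by (simp_all add: self_adjoint_idempotent_def)
  have "r (T (e f)) = 0" if "T \<in> M" for T f
  proof -
    define Y where "Y = (\<lambda>f. r (T (e f)))"
    have YM: "Y \<in> M"
      unfolding Y_def by (rule comp_closed[OF rM comp_closed[OF that eM] ])
    then interpret Y: bounded_linear Y by (rule bounded)
    obtain K where K: "0 < K" "\<And>f. norm (Y f) \<le> norm f * K"
      using Y.pos_bounded by blast
    define Z where "Z = (\<lambda>f. (1/K) *\<^sub>R Y f)"
    have ZM: "Z \<in> M"
      unfolding Z_def by (rule scale_closed[OF YM])
    then obtain Z' where Z': "adj Z Z'" using adj_closed by blast
    have contr: "norm (Z f) \<le> norm f" for f
      using K by (simp add: Z_def field_simps)
    note linr = adj_linear[OF ar]
    have rZ: "r (Z f) = Z f" and Ze: "Z (e f) = Z f" for f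
      by (simp_all add: Z_def Y_def linear_scale[OF linr] rr ee)
    obtain z z' where z: "z \<in> M" "adj z z'" "\<And>f. z (z' (z f)) = z f" "\<And>f. norm (Z f) \<le> norm (z f)"
      "\<And>f. r (z f) = z f" "\<And>f. z (e f) = z f"
      using polar_part[OF ZM Z' contr] rM rZ Ze by blast
    note linz = adj_linear[OF z(2)]
    have pr: "p (r f) = r f" and v'r: "v' (r f) = 0" and eq: "e (q f) = e f" and ev': "e (v' f) = 0" for f
      by (simp_all add: r_def e_def linear_diff[OF linp] linear_diff[OF linv'] pp pv v'p v'vv' qq vq qv')
    have "partial_equivalence p q z z'"
      unfolding partial_equivalence_def partial_isometry_def
      using z pr eq by metis
    moreover have "v' (z f) = 0" for f using v'r z(5) by metis
    moreover have "z (v' f) = 0" for f using ev' z(6) linear_0[OF linz] by metis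
    ultimately have "z f = 0" for f using max by blast
    then have "Z f = 0" using z(4)[of f] by simp
    then show ?thesis using K(1) by (simp add: Z_def Y_def)
  qed
  then have zero: "(\<forall>f. r f = 0) \<or> (\<forall>f. e f = 0)"
    by (rule factor[OF rM eM r e])
  have "inner (v (v' \<delta>)) \<delta> = inner (v' (v \<delta>)) \<delta>"
    by (rule trace[OF vM v'M])
  then have same: "inner (r \<delta>) \<delta> = inner (e \<delta>) \<delta>"
    by (simp add: r_def e_def inner_diff_left eq)
  have norms: "inner (r \<delta>) \<delta> = (norm (r \<delta>))\<^sup>2" "inner (e \<delta>) \<delta> = (norm (e \<delta>))\<^sup>2"
    using adjD[OF ar, of "r \<delta>" \<delta>] adjD[OF ae, of "e \<delta>" \<delta>] rr ee by (simp_all add: power2_norm_eq_inner)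
  have "r \<delta> = 0 \<and> e \<delta> = 0"
    using zero same norms by auto
  then have "r f = 0" "e f = 0" for f
    using separating rM eM by blast+
  then have "v' (v f) = q f" "v (v' f) = p f" for f
    by (simp_all add: r_def e_def)
  then show ?thesis
    using that vM av by blast
qed

end

section \<open>Operators on the space of square-summable functions\<close>

lemma norm_sum_singles:
  assumes "finite F"
  shows "(norm (\<Sum>x\<in>F. single x (c x)))\<^sup>2 = (\<Sum>x\<in>F. (cmod (c x))\<^sup>2)"
proof -
  let ?A = "\<Sum>x\<in>F. single x (c x)"
  have "coord ?A x = c x" if "x \<in> F" for x
    using that assms by (simp add: if_distrib sum.delta cong: if_cong)
  then have "inner ?A (single x (c x)) = (cmod (c x))\<^sup>2" if "x \<in> F" for x
    using that by (simp only: inner_single_right power2_norm_eq_inner)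
  then have "inner ?A ?A = (\<Sum>x\<in>F. (cmod (c x))\<^sup>2)"
    unfolding inner_sum_right[of ?A] by simp
  then show ?thesis by (simp only: power2_norm_eq_inner)
qed

lemma eq_on_singles:
  assumes "bounded_linear U" "bounded_linear V" "\<And>x c. U (single x c) = V (single x c)"
  shows "U f = (V f :: 'b::real_normed_vector)"
proof -
  have "((\<lambda>x. U (single x (coord f x))) has_sum U f) UNIV"
    by (rule has_sum_bounded_linear[OF assms(1) has_sum_singles])
  moreover have "((\<lambda>x. U (single x (coord f x))) has_sum V f) UNIV"
    unfolding assms(3) by (rule has_sum_bounded_linear[OF assms(2) has_sum_singles])
  ultimately show ?thesis by (rule has_sum_unique)
qed

text \<open>The complex inner product, linear in the first argument.\<close>

definition cinner :: "'a ell2 \<Rightarrow> 'a ell2 \<Rightarrow> complex" where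
  "cinner f g = Complex (inner f g) (inner f (scaleC \<i> g))"

lemma inner_cinner: "inner (cinner f g) c = inner f (scaleC c g)"
  by (subst scaleC_ii_decompose) (simp add: cinner_def inner_complex_def inner_add_right)

lemma bounded_linear_scaleC: "bounded_linear (scaleC c)"
  by (rule bounded_linear_intro[of _ "cmod c"]) (simp_all add: scaleC_add scaleC_scaleR mult.commute)

lemma adj_scaleC: "adj (scaleC c) (scaleC (cnj c))"
  by (simp add: adj_def inner_scaleC)

lemma scaleC_zero_right [simp]: "scaleC c 0 = 0"
  by (rule ell2_eqI) simp

lemma inner_scaleC_scaleC: "inner (scaleC c f) (scaleC d g) = inner (scaleC (c * cnj d) f) g"
  using inner_scaleC[of "cnj d" "scaleC c f" g] by (simp add: scaleC_scaleC mult.commute)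

lemma inner_scaleC_ii_self: "inner f (scaleC \<i> f) = 0"
  using inner_scaleC[of \<i> f f] scaleC_of_real[of "-1" "scaleC \<i> f"]
  by (simp add: scaleC_scaleC inner_commute)

lemma norm_sum_scaleC:
  "(norm (\<Sum>g\<in>F. scaleC (c g) (x g)))\<^sup>2 = (\<Sum>g\<in>F. \<Sum>h\<in>F. inner (scaleC (c g * cnj (c h)) (x g)) (x h))"
  by (simp add: power2_norm_eq_inner inner_sum_left inner_sum_right inner_scaleC_scaleC) (rule sum.swap)

text \<open>Testing the Bessel bound with the coefficients of \<open>f\<close> themselves bounds their square sum.\<close>

lemma analysis_operator:
  fixes x :: "'a \<Rightarrow> 'b ell2"
  assumes K: "0 \<le> K"
    and bessel: "\<And>F c. finite F \<Longrightarrow> (norm (\<Sum>g\<in>F. scaleC (c g) (x g)))\<^sup>2 \<le> K\<^sup>2 * (\<Sum>g\<in>F. (cmod (c g))\<^sup>2)"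
  shows "\<exists>A :: 'b ell2 \<Rightarrow> 'a ell2. (\<forall>f g. coord (A f) g = cinner f (x g)) \<and> (\<forall>f. norm (A f) \<le> K * norm f)"
proof -
  have "\<exists>a :: 'a ell2. coord a = (\<lambda>g. cinner f (x g)) \<and> norm a \<le> K * norm f" for f
  proof -
    have "(\<Sum>g\<in>F. (cmod (cinner f (x g)))\<^sup>2) \<le> (K * norm f)\<^sup>2" if F: "finite F" for F
    proof -
      let ?w = "\<lambda>g. cinner f (x g)"
      let ?s = "\<Sum>g\<in>F. (cmod (?w g))\<^sup>2"
      have s0: "0 \<le> ?s" by (simp add: sum_nonneg)
      have "?s = (\<Sum>g\<in>F. inner f (scaleC (?w g) (x g)))"
        by (simp add: power2_norm_eq_inner inner_cinner)
      also have "\<dots> = inner f (\<Sum>g\<in>F. scaleC (?w g) (x g))"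
        by (simp add: inner_sum_right)
      also have "\<dots> \<le> norm f * norm (\<Sum>g\<in>F. scaleC (?w g) (x g))"
        by (rule norm_cauchy_schwarz)
      finally have "?s\<^sup>2 \<le> (norm f * norm (\<Sum>g\<in>F. scaleC (?w g) (x g)))\<^sup>2"
        using s0 by (rule power_mono)
      also have "\<dots> \<le> (norm f)\<^sup>2 * (K\<^sup>2 * ?s)"
        unfolding power_mult_distrib by (intro mult_left_mono bessel F) simp
      finally have "?s * ?s \<le> (K * norm f)\<^sup>2 * ?s"
        by (simp add: power2_eq_square ac_simps)
      then show ?thesis
        using s0 by (cases "?s = 0") (simp_all del: power_mult_distrib add: mult_le_cancel_right)
    qed
    moreover have "0 \<le> K * norm f" using K by simp
    ultimately obtain a :: "'a ell2" where "coord a = (\<lambda>g. cinner f (x g))" "norm a \<le> K * norm f"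
      by (rule ell2_of_bounded)
    then show ?thesis by blast
  qed
  then have "\<forall>f. \<exists>a :: 'a ell2. coord a = (\<lambda>g. cinner f (x g)) \<and> norm a \<le> K * norm f" by blast
  from choice[OF this] obtain A :: "'b ell2 \<Rightarrow> 'a ell2" where
    "\<forall>f. coord (A f) = (\<lambda>g. cinner f (x g)) \<and> norm (A f) \<le> K * norm f" by blast
  then show ?thesis by (intro exI[of _ A]) simp
qed

text \<open>The images of the basis vectors are a Bessel family, and their coefficient map is the adjoint.\<close>

lemma adjoint_exists:
  fixes T :: "'a ell2 \<Rightarrow> 'a ell2"
  assumes T: "bounded_linear T" and cplx: "\<And>c f. T (scaleC c f) = scaleC c (T f)"
  shows "\<exists>T'. adj T T'"
proof -
  interpret T: bounded_linear T by fact
  obtain K where K: "0 \<le> K" "\<And>f. norm (T f) \<le> norm f * K"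
    using T.nonneg_bounded by blast
  have bessel: "(norm (\<Sum>g\<in>F. scaleC (c g) (T (single g 1))))\<^sup>2 \<le> K\<^sup>2 * (\<Sum>g\<in>F. (cmod (c g))\<^sup>2)"
    if F: "finite F" for F c
  proof -
    have "(\<Sum>g\<in>F. scaleC (c g) (T (single g 1))) = T (\<Sum>g\<in>F. single g (c g))"
      by (simp add: T.sum cplx[symmetric] scaleC_single)
    moreover have "(norm (T (\<Sum>g\<in>F. single g (c g))))\<^sup>2 \<le> (norm (\<Sum>g\<in>F. single g (c g)) * K)\<^sup>2"
      by (intro power_mono K) simp
    ultimately show ?thesis
      by (simp add: power_mult_distrib norm_sum_singles[OF F] mult.commute)
  qed
  obtain A :: "'a ell2 \<Rightarrow> 'a ell2" where A: "\<And>f g. coord (A f) g = cinner f (T (single g 1))"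
    using analysis_operator[of K "\<lambda>g. T (single g 1)", OF K(1) bessel] by blast
  have "inner (T f) h = inner f (A h)" for f h
  proof (rule eq_on_singles[of "\<lambda>f. inner (T f) h" "\<lambda>f. inner f (A h)"])
    show "bounded_linear (\<lambda>f. inner (T f) h)"
      using bounded_linear_compose[OF bounded_linear_inner_left T] .
    show "bounded_linear (\<lambda>f. inner f (A h))"
      by (rule bounded_linear_inner_left)
    show "inner (T (single x c)) h = inner (single x c) (A h)" for x c
    proof -
      have "inner (single x c) (A h) = inner (cinner h (T (single x 1))) c"
        by (simp add: A inner_commute)
      also have "\<dots> = inner h (T (single x c))"
        by (simp add: inner_cinner cplx[symmetric] scaleC_single)
      finally show ?thesis by (simp add: inner_commute)
    qed
  qed
  then show ?thesis by (auto simp: adj_def)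
qed

lemma adj_bounded_linear:
  assumes "bounded_linear T" "adj T T'"
  shows "bounded_linear T'"
proof -
  interpret T: bounded_linear T by fact
  obtain K where K: "0 \<le> K" "\<And>f. norm (T f) \<le> norm f * K"
    using T.nonneg_bounded by blast
  have "norm (T' f) \<le> norm f * K" for f
  proof -
    have "(norm (T' f))\<^sup>2 = inner (T (T' f)) f"
      using adjD[OF assms(2), of "T' f" f] by (simp add: power2_norm_eq_inner)
    also have "\<dots> \<le> norm (T (T' f)) * norm f"
      by (rule norm_cauchy_schwarz)
    also have "\<dots> \<le> (norm (T' f) * K) * norm f"
      by (intro mult_right_mono K) simp
    finally have "norm (T' f) * norm (T' f) \<le> norm (T' f) * (norm f * K)"
      by (simp add: power2_eq_square ac_simps)
    then show ?thesis
      using K(1) by (cases "norm (T' f) = 0") (simp_all add: mult_le_cancel_left)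
  qed
  moreover have "linear T'" by (rule adj_linear[OF adj_sym[OF assms(2)] ])
  ultimately show ?thesis
    by (intro bounded_linear_intro[of _ K]) (simp_all add: linear_add linear_scale)
qed

lemma adj_commute:
  assumes "adj T T'" "adj U U'" "\<And>f. T (U' f) = U' (T f)"
  shows "T' (U f) = U (T' f)"
proof -
  have "adj (\<lambda>f. T (U' f)) (\<lambda>f. U (T' f))"
    by (rule adj_comp[OF assms(1) adj_sym[OF assms(2)] ])
  moreover have "adj (\<lambda>f. U' (T f)) (\<lambda>f. T' (U f))"
    by (rule adj_comp[OF adj_sym[OF assms(2)] assms(1)])
  ultimately show ?thesis
    using adj_eqI[OF _ _ assms(3)] by fastforce
qed

text \<open>The translations, the inversion and the restriction to the group are all of this form.\<close>

definition pullback :: "'a set \<Rightarrow> ('a \<Rightarrow> 'a) \<Rightarrow> 'a ell2 \<Rightarrow> 'a ell2" where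
  "pullback S \<sigma> f = Abs_ell2 (\<lambda>h. if h \<in> S then coord f (\<sigma> h) else 0)"

lemma pullback_aux:
  assumes "inj_on \<sigma> S"
  shows "coord (pullback S \<sigma> f) = (\<lambda>h. if h \<in> S then coord f (\<sigma> h) else 0) \<and> norm (pullback S \<sigma> f) \<le> norm f"
proof -
  have "(\<Sum>h\<in>F. (cmod (if h \<in> S then coord f (\<sigma> h) else 0))\<^sup>2) \<le> (norm f)\<^sup>2" if F: "finite F" for F
  proof -
    have "(\<Sum>h\<in>F. (cmod (if h \<in> S then coord f (\<sigma> h) else 0))\<^sup>2) = (\<Sum>h\<in>F \<inter> S. (cmod (coord f (\<sigma> h)))\<^sup>2)"
      by (rule sum.mono_neutral_cong_right) (use F in auto)
    also have "\<dots> = (\<Sum>h\<in>\<sigma> ` (F \<inter> S). (cmod (coord f h))\<^sup>2)"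
      using inj_on_subset[OF assms, of "F \<inter> S"] by (subst sum.reindex) auto
    also have "\<dots> \<le> (norm f)\<^sup>2"
      by (rule partial_norm_le) (use F in simp)
    finally show ?thesis .
  qed
  from ell2_of_bounded[OF this norm_ge_zero] obtain a :: "'a ell2" where
    a: "coord a = (\<lambda>h. if h \<in> S then coord f (\<sigma> h) else 0)" "norm a \<le> norm f"
    by blast
  then have "a = pullback S \<sigma> f"
    unfolding pullback_def by (simp only: a(1)[symmetric] coord_inverse)
  then show ?thesis using a by simp
qed

lemma coord_pullback: "inj_on \<sigma> S \<Longrightarrow> coord (pullback S \<sigma> f) h = (if h \<in> S then coord f (\<sigma> h) else 0)"
  using pullback_aux[of \<sigma> S f] by simp

lemma norm_pullback_le: "inj_on \<sigma> S \<Longrightarrow> norm (pullback S \<sigma> f) \<le> norm f"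
  using pullback_aux[of \<sigma> S f] by simp

lemma bounded_linear_pullback:
  assumes "inj_on \<sigma> S"
  shows "bounded_linear (pullback S \<sigma>)"
proof (rule bounded_linear_intro[of _ 1])
  show "pullback S \<sigma> (f + g) = pullback S \<sigma> f + pullback S \<sigma> g" for f g
    by (rule ell2_eqI) (simp add: coord_pullback[OF assms])
  show "pullback S \<sigma> (r *\<^sub>R f) = r *\<^sub>R pullback S \<sigma> f" for r f
    by (rule ell2_eqI) (simp add: coord_pullback[OF assms])
qed (simp add: norm_pullback_le[OF assms])

lemma pullback_scaleC: "inj_on \<sigma> S \<Longrightarrow> pullback S \<sigma> (scaleC c f) = scaleC c (pullback S \<sigma> f)"
  by (rule ell2_eqI) (simp add: coord_pullback)

lemma adj_pullback:
  assumes bij: "bij_betw \<sigma> S S" and inv: "\<And>h. h \<in> S \<Longrightarrow> \<tau> (\<sigma> h) = h" and inj: "inj_on \<tau> S"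
  shows "adj (pullback S \<sigma>) (pullback S \<tau>)"
  unfolding adj_def
proof (intro allI)
  fix f g :: "'a ell2"
  have inj': "inj_on \<sigma> S" using bij by (rule bij_betw_imp_inj_on)
  have S: "\<sigma> h \<in> S" if "h \<in> S" for h using bij that by (rule bij_betwE[rule_format])
  let ?r = "\<lambda>k. inner (coord f k) (coord (pullback S \<tau> g) k)"
  have "(?r has_sum inner f (pullback S \<tau> g)) UNIV"
    by (rule inner_has_sum)
  then have "(?r has_sum inner f (pullback S \<tau> g)) S"
    by (rule has_sum_cong_neutral[THEN iffD1, rotated -1]) (auto simp: coord_pullback[OF inj])
  then have "((\<lambda>h. ?r (\<sigma> h)) has_sum inner f (pullback S \<tau> g)) S"
    by (simp only: has_sum_reindex_bij_betw[OF bij, of ?r])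
  then have "((\<lambda>h. inner (coord (pullback S \<sigma> f) h) (coord g h)) has_sum inner f (pullback S \<tau> g)) UNIV"
    by (rule has_sum_cong_neutral[THEN iffD1, rotated -1])
      (auto simp: coord_pullback[OF inj] coord_pullback[OF inj'] S inv)
  then show "inner (pullback S \<sigma> f) g = inner f (pullback S \<tau> g)"
    using has_sum_unique[OF inner_has_sum] by blast
qed

section \<open>The commutant of the left translations\<close>

context group
begin

abbreviation "S \<equiv> carrier G"

definition left_tr :: "'a \<Rightarrow> 'a ell2 \<Rightarrow> 'a ell2" where
  "left_tr g = pullback S (\<lambda>h. inv g \<otimes> h)"

definition right_tr :: "'a \<Rightarrow> 'a ell2 \<Rightarrow> 'a ell2" where
  "right_tr g = pullback S (\<lambda>h. h \<otimes> g)"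

definition cut :: "'a ell2 \<Rightarrow> 'a ell2" where
  "cut = pullback S (\<lambda>h. h)"

definition \<delta> :: "'a ell2" where
  "\<delta> = single \<one> 1"

lemma inj_left: "g \<in> S \<Longrightarrow> inj_on (\<lambda>h. g \<otimes> h) S"
  by (simp add: inj_on_def)

lemma inj_right: "g \<in> S \<Longrightarrow> inj_on (\<lambda>h. h \<otimes> g) S"
  by (simp add: inj_on_def)

lemma coord_left_tr: "g \<in> S \<Longrightarrow> coord (left_tr g f) h = (if h \<in> S then coord f (inv g \<otimes> h) else 0)"
  unfolding left_tr_def by (rule coord_pullback) (simp add: inj_left)

lemma coord_right_tr: "g \<in> S \<Longrightarrow> coord (right_tr g f) h = (if h \<in> S then coord f (h \<otimes> g) else 0)"
  unfolding right_tr_def by (rule coord_pullback) (simp add: inj_right)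

lemma coord_cut: "coord (cut f) h = (if h \<in> S then coord f h else 0)"
  unfolding cut_def by (rule coord_pullback) simp

lemma bounded_left_tr: "g \<in> S \<Longrightarrow> bounded_linear (left_tr g)"
  unfolding left_tr_def by (rule bounded_linear_pullback) (simp add: inj_left)

lemma bounded_right_tr: "g \<in> S \<Longrightarrow> bounded_linear (right_tr g)"
  unfolding right_tr_def by (rule bounded_linear_pullback) (simp add: inj_right)

lemma bounded_cut: "bounded_linear cut"
  unfolding cut_def by (rule bounded_linear_pullback) simp

lemma left_tr_scaleC: "g \<in> S \<Longrightarrow> left_tr g (scaleC c f) = scaleC c (left_tr g f)"
  unfolding left_tr_def by (rule pullback_scaleC) (simp add: inj_left)

lemma right_tr_scaleC: "g \<in> S \<Longrightarrow> right_tr g (scaleC c f) = scaleC c (right_tr g f)"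
  unfolding right_tr_def by (rule pullback_scaleC) (simp add: inj_right)

lemma bij_left: "g \<in> S \<Longrightarrow> bij_betw (\<lambda>h. g \<otimes> h) S S"
  by (rule bij_betw_byWitness[where f' = "\<lambda>h. inv g \<otimes> h"]) (auto simp: m_assoc[symmetric])

lemma adj_left_tr: "g \<in> S \<Longrightarrow> adj (left_tr g) (left_tr (inv g))"
  unfolding left_tr_def
  by (rule adj_pullback) (auto simp: bij_left inj_left m_assoc[symmetric])

lemma adj_cut: "adj cut cut"
  unfolding cut_def by (rule adj_pullback) (auto simp: bij_betw_def)

lemma left_tr_single: "g \<in> S \<Longrightarrow> h \<in> S \<Longrightarrow> left_tr g (single h c) = single (g \<otimes> h) c"
proof (rule ell2_eqI)
  fix x assume gh: "g \<in> S" "h \<in> S"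
  then have "inv g \<otimes> x = h \<longleftrightarrow> x = g \<otimes> h" if "x \<in> S" for x
    using that by (metis inv_solve_left)
  then show "coord (left_tr g (single h c)) x = coord (single (g \<otimes> h) c) x"
    using gh by (auto simp: coord_left_tr)
qed

lemma right_tr_single: "g \<in> S \<Longrightarrow> h \<in> S \<Longrightarrow> right_tr g (single h c) = single (h \<otimes> inv g) c"
proof (rule ell2_eqI)
  fix x assume gh: "g \<in> S" "h \<in> S"
  then have "x \<otimes> g = h \<longleftrightarrow> x = h \<otimes> inv g" if "x \<in> S" for x
    using that by (metis inv_solve_right)
  then show "coord (right_tr g (single h c)) x = coord (single (h \<otimes> inv g) c) x"
    using gh by (auto simp: coord_right_tr)
qed

lemma left_tr_outside: "g \<in> S \<Longrightarrow> h \<notin> S \<Longrightarrow> left_tr g (single h c) = 0"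
  by (rule ell2_eqI) (auto simp: coord_left_tr)

lemma cut_single: "cut (single h c) = (if h \<in> S then single h c else 0)"
  by (rule ell2_eqI) (auto simp: coord_cut)

lemma cut_left_tr: "g \<in> S \<Longrightarrow> cut (left_tr g f) = left_tr g f"
  by (rule ell2_eqI) (simp add: coord_cut coord_left_tr)

lemma left_tr_cut: "g \<in> S \<Longrightarrow> left_tr g (cut f) = left_tr g f"
  by (rule ell2_eqI) (simp add: coord_cut coord_left_tr)

lemma left_tr_mult: "g \<in> S \<Longrightarrow> h \<in> S \<Longrightarrow> left_tr g (left_tr h f) = left_tr (g \<otimes> h) f"
  by (rule ell2_eqI) (simp add: coord_left_tr inv_mult_group m_assoc)

lemma left_tr_one: "left_tr \<one> f = cut f"
  by (rule ell2_eqI) (simp add: coord_cut coord_left_tr)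

lemma left_right_commute: "g \<in> S \<Longrightarrow> k \<in> S \<Longrightarrow> right_tr g (left_tr k f) = left_tr k (right_tr g f)"
  by (rule ell2_eqI) (simp add: coord_right_tr coord_left_tr m_assoc)

lemma left_tr_delta: "g \<in> S \<Longrightarrow> left_tr g (scaleC c \<delta>) = single g c"
  by (simp add: \<delta>_def scaleC_single left_tr_single)

text \<open>The operators that commute with the left translations, as real operators on the functions on
  the whole type: complex linearity is commutation with the scalars, and the last two conditions say
  that the operator lives on the functions that vanish off the group.\<close>

definition right_algebra :: "('a ell2 \<Rightarrow> 'a ell2) set" where
  "right_algebra = {T. bounded_linear T \<and> (\<forall>c f. T (scaleC c f) = scaleC c (T f)) \<and>
     (\<forall>g\<in>S. \<forall>f. T (left_tr g f) = left_tr g (T f)) \<and> (\<forall>f. T (cut f) = T f) \<and> (\<forall>f. cut (T f) = T f)}"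

lemma right_algebraD:
  assumes "T \<in> right_algebra"
  shows "bounded_linear T" "T (scaleC c f) = scaleC c (T f)"
    "g \<in> S \<Longrightarrow> T (left_tr g f) = left_tr g (T f)" "T (cut f) = T f" "cut (T f) = T f"
  using assms by (auto simp: right_algebra_def)

lemma right_algebraI:
  assumes "bounded_linear T" "\<And>c f. T (scaleC c f) = scaleC c (T f)"
    "\<And>g f. g \<in> S \<Longrightarrow> T (left_tr g f) = left_tr g (T f)" "\<And>f. T (cut f) = T f" "\<And>f. cut (T f) = T f"
  shows "T \<in> right_algebra"
  using assms by (simp add: right_algebra_def)

lemma right_algebra_single:
  assumes "T \<in> right_algebra" "g \<in> S"
  shows "T (single g c) = scaleC c (left_tr g (T \<delta>))"
proof -
  have "T (single g c) = T (left_tr g (scaleC c \<delta>))"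
    using assms(2) by (simp add: left_tr_delta)
  then show ?thesis
    using assms(2) by (simp add: right_algebraD(2,3)[OF assms(1)] left_tr_scaleC)
qed

lemma right_algebra_single_outside:
  assumes "T \<in> right_algebra" "g \<notin> S"
  shows "T (single g c) = 0"
  using right_algebraD(4)[OF assms(1), of "single g c"] assms(2)
    linear_simps(3)[OF right_algebraD(1)[OF assms(1)] ]
  by (simp add: cut_single)

lemma right_tr_in_right_algebra: "g \<in> S \<Longrightarrow> right_tr g \<in> right_algebra"
  by (rule right_algebraI)
    (auto simp: bounded_right_tr right_tr_scaleC left_right_commute
      intro!: ell2_eqI simp: coord_right_tr coord_cut)

lemma right_algebra_adj:
  assumes T: "T \<in> right_algebra" and a: "adj T T'"
  shows "T' \<in> right_algebra"
proof (rule right_algebraI)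
  show "bounded_linear T'"
    by (rule adj_bounded_linear[OF right_algebraD(1)[OF T] a])
  show "T' (scaleC c f) = scaleC c (T' f)" for c f
    by (rule adj_commute[of T T' "scaleC c" "scaleC (cnj c)", OF a adj_scaleC right_algebraD(2)[OF T] ])
  show "T' (left_tr g f) = left_tr g (T' f)" if "g \<in> S" for g f
    by (rule adj_commute[of T T' "left_tr g" "left_tr (inv g)", OF a adj_left_tr[OF that]
          right_algebraD(3)[OF T inv_closed[OF that] ] ])
  show "T' (cut f) = T' f" for f
    by (rule adj_eqI[of "\<lambda>f. cut (T f)" "\<lambda>f. T' (cut f)" T T', OF adj_comp[OF adj_cut a] a
          right_algebraD(5)[OF T] ])
  show "cut (T' f) = T' f" for f
    by (rule adj_eqI[of "\<lambda>f. T (cut f)" "\<lambda>f. cut (T' f)" T T', OF adj_comp[OF a adj_cut] a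
          right_algebraD(4)[OF T] ])
qed

text \<open>Such an operator is a convolution from the right, so its value at \<open>\<delta>\<close> determines it.\<close>

lemma right_algebra_separating:
  assumes T: "T \<in> right_algebra" and "T \<delta> = 0"
  shows "T f = 0"
proof (rule eq_on_singles[OF right_algebraD(1)[OF T] bounded_linear_zero])
  show "T (single g c) = 0" for g c
    using right_algebra_single[OF T, of g c] right_algebra_single_outside[OF T, of g c] assms(2)
      linear_simps(3)[OF bounded_left_tr[of g] ]
    by (cases "g \<in> S") auto
qed

lift_definition conjugate :: "'a ell2 \<Rightarrow> 'a ell2" is "\<lambda>f x. cnj (f x)"
  by simp

lemma inner_conjugate: "inner f (conjugate g) = inner (conjugate f) g"
  by (simp add: inner_ell2_def conjugate.rep_eq inner_complex_def)

lemma inj_inv: "inj_on (m_inv G) S"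
  by (rule inj_on_inverseI[of S "m_inv G"]) (rule inv_inv)

lemma inner_delta: "inner \<delta> f = Re (coord f \<one>)"
  by (simp add: \<delta>_def inner_complex_def)

lemma adjoint_delta:
  assumes T: "T \<in> right_algebra" and a: "adj T T'"
  shows "T' \<delta> = pullback S (\<lambda>h. inv h) (conjugate (T \<delta>))"
proof (rule ell2_eq_inner_singleI)
  fix g c
  note inj = inj_inv
  show "inner (T' \<delta>) (single g c) = inner (pullback S (\<lambda>h. inv h) (conjugate (T \<delta>))) (single g c)"
  proof (cases "g \<in> S")
    case True
    have "inner (T' \<delta>) (single g c) = inner \<delta> (T (single g c))"
      using adjD[OF adj_sym[OF a] ] .
    also have "\<dots> = Re (c * coord (T \<delta>) (inv g))"
      unfolding right_algebra_single[OF T True] inner_delta using True by (simp add: coord_left_tr)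
    finally show ?thesis
      using True by (simp add: coord_pullback[OF inj] conjugate.rep_eq inner_complex_def)
  next
    case False
    have "coord (T' \<delta>) g = coord (cut (T' \<delta>)) g"
      by (simp only: right_algebraD(5)[OF right_algebra_adj[OF T a] ])
    then show ?thesis using False by (simp add: coord_cut coord_pullback[OF inj])
  qed
qed

text \<open>Passing to the adjoint conjugates and reverses the convolution kernel, and this operation is
  symmetric for the inner product.\<close>

lemma right_algebra_trace:
  assumes A: "A \<in> right_algebra" and T: "T \<in> right_algebra"
  shows "inner (A (T \<delta>)) \<delta> = inner (T (A \<delta>)) \<delta>"
proof -
  obtain A' where a: "adj A A'"
    using adjoint_exists[OF right_algebraD(1,2)[OF A] ] by blast
  obtain T' where t: "adj T T'"
    using adjoint_exists[OF right_algebraD(1,2)[OF T] ] by blast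
  let ?R = "pullback S (\<lambda>h. inv h)"
  have bij: "bij_betw (\<lambda>h. inv h) S S"
    by (rule bij_betw_byWitness[where f' = "\<lambda>h. inv h"]) auto
  have R: "adj ?R ?R" by (rule adj_pullback[OF bij _ inj_inv]) (rule inv_inv)
  have conj: "?R (conjugate f) = conjugate (?R f)" for f
    by (rule ell2_eqI) (simp add: coord_pullback[OF inj_inv] conjugate.rep_eq)
  have "inner (A (T \<delta>)) \<delta> = inner (T \<delta>) (?R (conjugate (A \<delta>)))"
    by (simp only: adjD[OF a] adjoint_delta[OF A a])
  also have "\<dots> = inner (conjugate (?R (T \<delta>))) (A \<delta>)"
    by (simp only: adjD[OF R, symmetric] inner_conjugate)
  also have "\<dots> = inner (T' \<delta>) (A \<delta>)"
    by (simp only: conj[symmetric] adjoint_delta[OF T t])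
  also have "\<dots> = inner (T (A \<delta>)) \<delta>"
    using adjD[OF t, of "A \<delta>" \<delta>] by (simp add: inner_commute)
  finally show ?thesis .
qed

text \<open>The coefficient map of the left translates of \<open>\<xi>\<close> is the adjoint of the convolution by \<open>\<xi>\<close>, so a
  Bessel bound for the translates makes the convolution a bounded operator.\<close>

lemma right_algebra_of_vector:
  assumes \<xi>: "cut \<xi> = \<xi>" and K: "0 \<le> K"
    and bessel: "\<And>F c. finite F \<Longrightarrow> F \<subseteq> S \<Longrightarrow>
      (norm (\<Sum>g\<in>F. scaleC (c g) (left_tr g \<xi>)))\<^sup>2 \<le> K\<^sup>2 * (\<Sum>g\<in>F. (cmod (c g))\<^sup>2)"
  shows "\<exists>T\<in>right_algebra. T \<delta> = \<xi>"
proof -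
  define x where "x = (\<lambda>g. if g \<in> S then left_tr g \<xi> else 0)"
  have x: "(norm (\<Sum>g\<in>F. scaleC (c g) (x g)))\<^sup>2 \<le> K\<^sup>2 * (\<Sum>g\<in>F. (cmod (c g))\<^sup>2)" if F: "finite F" for F c
  proof -
    have "(\<Sum>g\<in>F. scaleC (c g) (x g)) = (\<Sum>g\<in>F \<inter> S. scaleC (c g) (left_tr g \<xi>))"
      by (rule sum.mono_neutral_cong_right) (use F in \<open>auto simp: x_def\<close>)
    also have "(norm \<dots>)\<^sup>2 \<le> K\<^sup>2 * (\<Sum>g\<in>F \<inter> S. (cmod (c g))\<^sup>2)"
      by (rule bessel) (use F in auto)
    also have "\<dots> \<le> K\<^sup>2 * (\<Sum>g\<in>F. (cmod (c g))\<^sup>2)"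
      by (intro mult_left_mono sum_mono2) (use F in auto)
    finally show ?thesis .
  qed
  obtain A :: "'a ell2 \<Rightarrow> 'a ell2" where A: "\<And>f g. coord (A f) g = cinner f (x g)"
    and normA: "\<And>f. norm (A f) \<le> K * norm f"
    using analysis_operator[OF K x] by blast
  have innerA: "inner (A f) (single g c) = inner f (scaleC c (x g))" for f g c
    by (simp add: A inner_cinner)
  have A_scaleC: "A (scaleC c f) = scaleC c (A f)" for c f
    by (rule ell2_eq_inner_singleI)
      (simp only: innerA inner_scaleC scaleC_single scaleC_scaleC)
  have "bounded_linear A"
  proof (rule bounded_linear_intro[of _ K])
    show "A (f + g) = A f + A g" for f g
      by (rule ell2_eq_inner_singleI) (simp only: innerA inner_add_left)
    show "A (r *\<^sub>R f) = r *\<^sub>R A f" for r f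
      by (rule ell2_eq_inner_singleI) (simp only: innerA inner_scaleR_left)
    show "norm (A f) \<le> norm f * K" for f
      using normA[of f] by (simp add: mult.commute)
  qed
  from adjoint_exists[OF this A_scaleC] obtain T where AT: "adj A T" by blast
  have T: "T (single g c) = scaleC c (x g)" for g c
  proof (rule vector_eq_ldot[THEN iffD1, rule_format])
    fix f
    show "inner f (T (single g c)) = inner f (scaleC c (x g))"
      using adjD[OF AT, of f "single g c"] by (simp only: innerA)
  qed
  have bT: "bounded_linear T"
    by (rule adj_bounded_linear[OF \<open>bounded_linear A\<close> AT])
  have T0: "T 0 = 0"
    using linear_simps(3)[OF bT] .
  have "T \<in> right_algebra"
  proof (rule right_algebraI[OF bT])
    show "T (scaleC c f) = scaleC c (T f)" for c f
      by (rule adj_commute[of A T "scaleC c" "scaleC (cnj c)", OF AT adj_scaleC A_scaleC])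
    show "T (left_tr g f) = left_tr g (T f)" if g: "g \<in> S" for g f
    proof (rule eq_on_singles[OF bounded_linear_compose[OF bT bounded_left_tr[OF g] ]
          bounded_linear_compose[OF bounded_left_tr[OF g] bT] ])
      show "T (left_tr g (single h c)) = left_tr g (T (single h c))" for h c
        using g linear_simps(3)[OF bounded_left_tr[OF g] ]
        by (cases "h \<in> S")
          (simp_all add: left_tr_single left_tr_outside T T0 x_def left_tr_scaleC left_tr_mult)
    qed
    show "T (cut f) = T f" for f
    proof (rule eq_on_singles[OF bounded_linear_compose[OF bT bounded_cut] bT])
      show "T (cut (single h c)) = T (single h c)" for h c
        by (simp add: cut_single T0 T x_def)
    qed
    show "cut (T f) = T f" for f
    proof (rule eq_on_singles[OF bounded_linear_compose[OF bounded_cut bT] bT])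
      show "cut (T (single h c)) = T (single h c)" for h c
      proof (rule ell2_eqI)
        show "coord (cut (T (single h c))) y = coord (T (single h c)) y" for y
          by (simp add: T x_def coord_cut coord_left_tr)
      qed
    qed
  qed
  moreover have "T \<delta> = \<xi>"
    by (simp add: \<delta>_def T x_def left_tr_one \<xi>)
  ultimately show ?thesis by blast
qed

end

text \<open>Conjugation moves every finite set of non-trivial elements off itself. This turns the commutant
  into a factor: when a projection \<open>q\<close> is conjugated by right translations that move larger and larger
  sets off themselves, it converges weakly to the multiple \<open>tr q\<close> of the identity, and the trace of the
  product with \<open>p\<close> converges to \<open>tr p tr q\<close>.\<close>

locale scattering_group = group G for G :: "('a, 'b) monoid_scheme" (structure) +
  assumes scattering: "finite F \<Longrightarrow> F \<subseteq> carrier G \<Longrightarrow> \<one> \<notin> F \<Longrightarrow> \<exists>g\<in>carrier G. \<forall>h\<in>F. inv g \<otimes> h \<otimes> g \<notin> F"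
begin

lemma norm_diff_truncation:
  assumes "0 < e"
  shows "\<exists>F. finite F \<and> (\<forall>E. finite E \<longrightarrow> F \<subseteq> E \<longrightarrow> norm (f - (\<Sum>x\<in>E. single x (coord f x))) < e)"
proof -
  have "((\<lambda>F. \<Sum>x\<in>F. single x (coord f x)) \<longlongrightarrow> f) (finite_subsets_at_top UNIV)"
    using has_sum_singles[of f] by (simp add: has_sum_def)
  then have "\<forall>\<^sub>F F in finite_subsets_at_top UNIV. dist (\<Sum>x\<in>F. single x (coord f x)) f < e"
    using assms by (rule tendstoD)
  then show ?thesis
    unfolding eventually_finite_subsets_at_top by (auto simp: dist_norm norm_minus_commute)
qed

lemma right_algebra_factor:
  assumes p: "p \<in> right_algebra" "self_adjoint_idempotent p"
    and q: "q \<in> right_algebra" "self_adjoint_idempotent q"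
    and zero: "\<And>T f. T \<in> right_algebra \<Longrightarrow> p (T (q f)) = 0"
  shows "(\<forall>f. p f = 0) \<or> (\<forall>f. q f = 0)"
proof (rule ccontr)
  assume contra: "\<not> ?thesis"
  define \<xi> \<zeta> where "\<xi> = p \<delta>" and "\<zeta> = q \<delta>"
  have "\<xi> \<noteq> 0" "\<zeta> \<noteq> 0"
    using contra right_algebra_separating p(1) q(1) by (auto simp: \<xi>_def \<zeta>_def)
  define a where "a = (norm \<zeta>)\<^sup>2 * (norm \<xi>)\<^sup>2"
  have a: "0 < a" using \<open>\<xi> \<noteq> 0\<close> \<open>\<zeta> \<noteq> 0\<close> by (simp add: a_def)
  (* Small enough that truncating both vectors changes their inner product by less than a. *)
  define e where "e = min 1 (a / (2 * (norm \<xi> + norm \<zeta> + 1)))"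
  have e: "0 < e" "e \<le> 1" "e * (norm \<xi> + norm \<zeta> + 1) < a"
  proof -
    have pos: "0 < norm \<xi> + norm \<zeta> + 1" by (simp add: add_nonneg_pos)
    show "0 < e" "e \<le> 1" using a pos by (simp_all add: e_def)
    have "e * (norm \<xi> + norm \<zeta> + 1) \<le> (a / (2 * (norm \<xi> + norm \<zeta> + 1))) * (norm \<xi> + norm \<zeta> + 1)"
      by (rule mult_right_mono) (use pos in \<open>auto simp: e_def\<close>)
    also have "\<dots> = a / 2" using pos by (simp add: field_simps)
    finally show "e * (norm \<xi> + norm \<zeta> + 1) < a" using a by linarith
  qed
  have at_one: "coord (r \<delta>) \<one> = of_real ((norm (r \<delta>))\<^sup>2)"
    if r: "r \<in> right_algebra" "self_adjoint_idempotent r" for r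
  proof -
    have adj: "adj r r" and idem: "\<And>f. r (r f) = r f" using r(2) by (auto simp: self_adjoint_idempotent_def)
    have "inner (r \<delta>) (scaleC c \<delta>) = inner (r \<delta>) (scaleC c (r \<delta>))" for c
      using adjD[OF adj, of "r \<delta>" "scaleC c \<delta>"] by (simp add: idem right_algebraD(2)[OF r(1)])
    then have *: "inner (coord (r \<delta>) \<one>) c = inner (r \<delta>) (scaleC c (r \<delta>))" for c
      by (simp add: \<delta>_def scaleC_single)
    show ?thesis
      using *[of 1] *[of \<i>] by (simp add: inner_scaleC_ii_self complex_eq_iff inner_complex_def power2_norm_eq_inner)
  qed
  let ?s = "\<lambda>E f. \<Sum>x\<in>E. single x (coord f x)"
  obtain F1 where F1: "finite F1" "\<And>E. finite E \<Longrightarrow> F1 \<subseteq> E \<Longrightarrow> norm (\<xi> - ?s E \<xi>) < e"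
    using norm_diff_truncation[OF e(1), of \<xi>] by blast
  obtain F2 where F2: "finite F2" "\<And>E. finite E \<Longrightarrow> F2 \<subseteq> E \<Longrightarrow> norm (\<zeta> - ?s E \<zeta>) < e"
    using norm_diff_truncation[OF e(1), of \<zeta>] by blast
  define E0 where "E0 = insert \<one> (F1 \<union> F2)"
  define E where "E = E0 \<inter> S"
  have E: "finite E" "E \<subseteq> S" "\<one> \<in> E" using F1(1) F2(1) by (auto simp: E_def E0_def)
  have sE: "?s E0 (r \<delta>) = ?s E (r \<delta>)" if r: "r \<in> right_algebra" for r
  proof (rule sum.mono_neutral_right)
    have "coord (r \<delta>) x = 0" if "x \<notin> S" for x
      using arg_cong[OF right_algebraD(5)[OF r, of \<delta>], of "\<lambda>f. coord f x"] that by (simp add: coord_cut)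
    then show "\<forall>x\<in>E0 - E. single x (coord (r \<delta>) x) = 0"
      by (auto simp: E_def intro!: ell2_eqI)
  qed (use F1(1) F2(1) in \<open>auto simp: E_def E0_def\<close>)
  have close: "norm (\<xi> - ?s E \<xi>) < e" "norm (\<zeta> - ?s E \<zeta>) < e"
    using F1(2)[of E0] F2(2)[of E0] F1(1) F2(1) sE[OF p(1)] sE[OF q(1)]
    by (auto simp: E0_def \<xi>_def \<zeta>_def)
  obtain g where g: "g \<in> S" and disj: "\<And>h. h \<in> E - {\<one>} \<Longrightarrow> inv g \<otimes> h \<otimes> g \<notin> E - {\<one>}"
    using scattering[of "E - {\<one>}"] E by blast
  let ?Ad = "\<lambda>f. right_tr g (left_tr g f)"
  have blAd: "bounded_linear ?Ad"
    by (rule bounded_linear_compose[OF bounded_right_tr[OF g] bounded_left_tr[OF g] ])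
  have coordAd: "coord (?Ad f) h = (if h \<in> S then coord f (inv g \<otimes> (h \<otimes> g)) else 0)" for f h
    using g by (simp add: coord_right_tr coord_left_tr)
  have normAd: "norm (?Ad f) \<le> norm f" for f
    using norm_pullback_le[OF inj_right[OF g], of "left_tr g f"]
      norm_pullback_le[OF inj_left[OF inv_closed[OF g] ], of f]
    by (simp add: right_tr_def left_tr_def)
  have "inner (?Ad \<zeta>) \<xi> = 0"
  proof -
    have "?Ad \<zeta> = right_tr g (q (right_tr (inv g) \<delta>))"
      using g right_algebra_single[OF q(1) g, of 1]
      by (simp add: \<zeta>_def \<delta>_def right_tr_single)
    then have "p (?Ad \<zeta>) = 0"
      using zero[OF right_tr_in_right_algebra[OF g] ] by simp
    moreover have "adj p p" using p(2) by (simp add: self_adjoint_idempotent_def)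
    then have "inner (?Ad \<zeta>) \<xi> = inner (p (?Ad \<zeta>)) \<delta>"
      by (simp add: \<xi>_def adjD)
    ultimately show ?thesis by simp
  qed
  moreover have "inner (?Ad (?s E \<zeta>)) (?s E \<xi>) = a"
  proof -
    have coordE: "coord (?s E \<zeta>) x = (if x \<in> E then coord \<zeta> x else 0)" for x
      using E(1) by (simp add: if_distrib sum.delta cong: if_cong)
    have "inner (?Ad (?s E \<zeta>)) (?s E \<xi>) = (\<Sum>h\<in>E. inner (coord (?Ad (?s E \<zeta>)) h) (coord \<xi> h))"
      by (simp only: inner_sum_right inner_single_right)
    also have "\<dots> = (\<Sum>h\<in>E. if h = \<one> then a else 0)"
    proof (rule sum.cong[OF refl])
      fix h assume h: "h \<in> E"
      then have hS: "h \<in> S" using E(2) by blast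
      show "inner (coord (?Ad (?s E \<zeta>)) h) (coord \<xi> h) = (if h = \<one> then a else 0)"
      proof (cases "h = \<one>")
        case True
        then show ?thesis
          unfolding coordAd coordE
          using g E(3) at_one[OF p] at_one[OF q] by (simp add: \<xi>_def \<zeta>_def a_def inner_complex_def)
      next
        case False
        have "inv g \<otimes> (h \<otimes> g) \<notin> E - {\<one>}"
          using disj[of h] h False g hS by (simp add: m_assoc)
        moreover have "inv g \<otimes> (h \<otimes> g) \<noteq> \<one>"
        proof
          assume "inv g \<otimes> (h \<otimes> g) = \<one>"
          then have "h \<otimes> g = g" using g hS by (metis inv_solve_left m_closed one_closed r_one)
          then show False using False g hS by (simp add: l_cancel_one)
        qed
        ultimately have "inv g \<otimes> (h \<otimes> g) \<notin> E" by blast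
        then show ?thesis unfolding coordAd coordE using False by simp
      qed
    qed
    also have "\<dots> = a" using E by (simp add: sum.delta)
    finally show ?thesis .
  qed
  moreover have "\<bar>inner (?Ad \<zeta>) \<xi> - inner (?Ad (?s E \<zeta>)) (?s E \<xi>)\<bar> \<le> e * (norm \<xi> + norm \<zeta> + 1)"
  proof -
    have diff: "inner (?Ad \<zeta>) \<xi> - inner (?Ad (?s E \<zeta>)) (?s E \<xi>)
        = inner (?Ad (\<zeta> - ?s E \<zeta>)) \<xi> + inner (?Ad (?s E \<zeta>)) (\<xi> - ?s E \<xi>)"
      by (simp add: linear_simps(2)[OF blAd] inner_diff)
    have "\<bar>inner (?Ad (\<zeta> - ?s E \<zeta>)) \<xi>\<bar> \<le> e * norm \<xi>"
      by (rule order_trans[OF Cauchy_Schwarz_ineq2], rule mult_right_mono)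
        (use order_trans[OF normAd[of "\<zeta> - ?s E \<zeta>"] less_imp_le[OF close(2)] ] in auto)
    moreover have "norm (?s E \<zeta>) \<le> norm \<zeta> + 1"
      using norm_triangle_ineq3[of "\<zeta>" "?s E \<zeta>"] close(2) e(2) by linarith
    then have "norm (?Ad (?s E \<zeta>)) \<le> norm \<zeta> + 1"
      using normAd order_trans by blast
    then have "\<bar>inner (?Ad (?s E \<zeta>)) (\<xi> - ?s E \<xi>)\<bar> \<le> (norm \<zeta> + 1) * e"
      by (intro order_trans[OF Cauchy_Schwarz_ineq2] mult_mono) (use close(1) in auto)
    ultimately show ?thesis unfolding diff by (simp add: algebra_simps)
  qed
  ultimately show False using e(3) a by simp
qed

lemma right_algebra_limit:
  assumes X: "\<And>n. X n \<in> right_algebra" and lim: "\<And>f. (\<lambda>n. X n f) \<longlonglongrightarrow> v f"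
    and a: "adj v v'" and norm: "\<And>f. norm (v f) \<le> norm f"
  shows "v \<in> right_algebra"
proof -
  have "linear v" by (rule adj_linear[OF a])
  then have "bounded_linear v"
    by (intro bounded_linear_intro[of _ 1]) (simp_all add: linear_add linear_scale norm)
  moreover have "v (scaleC c f) = scaleC c (v f)" for c f
    using lim[of "scaleC c f"] bounded_linear.tendsto[OF bounded_linear_scaleC lim[of f], of c]
    by (simp add: right_algebraD(2)[OF X] LIMSEQ_unique)
  moreover have "v (left_tr g f) = left_tr g (v f)" if "g \<in> S" for g f
    using lim[of "left_tr g f"] bounded_linear.tendsto[OF bounded_left_tr[OF that] lim[of f] ]
    by (simp add: right_algebraD(3)[OF X that] LIMSEQ_unique)
  moreover have "v (cut f) = v f" for f
    using lim[of "cut f"] lim[of f] by (simp add: right_algebraD(4)[OF X] LIMSEQ_unique)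
  moreover have "cut (v f) = v f" for f
    using lim[of f] bounded_linear.tendsto[OF bounded_cut lim[of f] ]
    by (simp add: right_algebraD(5)[OF X] LIMSEQ_unique)
  ultimately show ?thesis by (rule right_algebraI)
qed

sublocale tracial_factor right_algebra \<delta>
proof (rule tracial_factor.intro)
  show "T \<in> right_algebra \<Longrightarrow> bounded_linear T" for T
    by (rule right_algebraD(1))
  show "\<exists>T'\<in>right_algebra. adj T T'" if "T \<in> right_algebra" for T
    using adjoint_exists[OF right_algebraD(1,2)[OF that] ] right_algebra_adj[OF that] by blast
  show "(\<lambda>f. A (T f)) \<in> right_algebra" if "A \<in> right_algebra" "T \<in> right_algebra" for A T
    by (rule right_algebraI)
      (simp_all add: right_algebraD(2-5)[OF that(1)] right_algebraD(2-5)[OF that(2)]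
        bounded_linear_compose[OF right_algebraD(1)[OF that(1)] right_algebraD(1)[OF that(2)] ])
  show "(\<lambda>f. A f + T f) \<in> right_algebra" if "A \<in> right_algebra" "T \<in> right_algebra" for A T
    by (rule right_algebraI)
      (simp_all add: right_algebraD(2-5)[OF that(1)] right_algebraD(2-5)[OF that(2)] scaleC_add
        linear_simps(1)[OF bounded_left_tr] linear_simps(1)[OF bounded_cut]
        bounded_linear_add[OF right_algebraD(1)[OF that(1)] right_algebraD(1)[OF that(2)] ])
  show "(\<lambda>f. r *\<^sub>R T f) \<in> right_algebra" if "T \<in> right_algebra" for r T
    by (rule right_algebraI)
      (simp_all add: right_algebraD(2-5)[OF that] scaleC_scaleR
        linear_simps(5)[OF bounded_left_tr] linear_simps(5)[OF bounded_cut]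
        bounded_linear_compose[OF bounded_linear_scaleR_right right_algebraD(1)[OF that] ])
  show "v \<in> right_algebra" if "\<And>n. X n \<in> right_algebra" "\<And>f. (\<lambda>n. X n f) \<longlonglongrightarrow> v f"
    "adj v v'" "\<And>f. norm (v f) \<le> norm f" for X v v'
    by (rule right_algebra_limit[OF that])
  show "T f = 0" if "T \<in> right_algebra" "T \<delta> = 0" for T f
    by (rule right_algebra_separating[OF that])
  show "inner (A (T \<delta>)) \<delta> = inner (T (A \<delta>)) \<delta>" if "A \<in> right_algebra" "T \<in> right_algebra" for A T
    by (rule right_algebra_trace[OF that])
  show "(\<forall>f. p f = 0) \<or> (\<forall>f. q f = 0)" if "p \<in> right_algebra" "q \<in> right_algebra"
    "self_adjoint_idempotent p" "self_adjoint_idempotent q"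
    "\<And>T f. T \<in> right_algebra \<Longrightarrow> p (T (q f)) = 0" for p q
    using right_algebra_factor[of p q] that by blast
qed

end

section \<open>Fourier coefficients of an arc\<close>

text \<open>The characters of the circle, parametrized by \<open>[0, 1]\<close>, and the Fourier coefficients of the arc
  \<open>[0, b]\<close>. The sign convention makes the coefficient at \<open>n\<close> the integral of the \<open>n\<close>-th character.\<close>

definition wave :: "int \<Rightarrow> real \<Rightarrow> complex" where
  "wave n t = cis (2 * pi * of_int n * t)"

definition arc_coeff :: "real \<Rightarrow> int \<Rightarrow> complex" where
  "arc_coeff b n = integral {0..b} (wave n)"

lemma wave_mult: "wave m t * wave n t = wave (m + n) t"
  by (simp add: wave_def cis_mult algebra_simps)

lemma cnj_wave: "cnj (wave n t) = wave (- n) t"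
  by (simp add: wave_def cis_cnj)

lemma wave_zero [simp]: "wave 0 t = 1"
  by (simp add: wave_def)

lemma norm_wave [simp]: "cmod (wave n t) = 1"
  by (simp add: wave_def)

lemma continuous_wave [continuous_intros]: "continuous_on S (wave n)"
  unfolding wave_def by (intro continuous_intros)

lemma wave_has_integral:
  assumes "n \<noteq> 0" "0 \<le> b"
  shows "(wave n has_integral (wave n b - 1) / (2 * pi * of_int n * \<i>)) {0..b}"
proof -
  let ?c = "2 * of_real pi * of_int n * \<i> :: complex"
  have c: "?c \<noteq> 0" using assms(1) by simp
  have w: "wave n t = exp (?c * of_real t)" for t
    by (simp add: wave_def cis_conv_exp algebra_simps)
  have "((\<lambda>t. exp (?c * of_real t) / ?c) has_vector_derivative exp (?c * of_real t)) (at t within {0..b})" for t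
    by (rule has_vector_derivative_real_field) (use c in \<open>auto intro!: derivative_eq_intros\<close>)
  then have "((\<lambda>t. exp (?c * of_real t)) has_integral (exp (?c * of_real b) / ?c - exp (?c * of_real 0) / ?c)) {0..b}"
    by (intro fundamental_theorem_of_calculus assms(2)) auto
  then show ?thesis
    by (simp add: w[abs_def] diff_divide_distrib)
qed

lemma wave_has_arc_coeff:
  "(wave n has_integral arc_coeff b n) {0..b}"
  unfolding arc_coeff_def
  by (intro integrable_integral integrable_continuous_interval continuous_intros)

lemma arc_coeff_zero [simp]: "0 \<le> b \<Longrightarrow> arc_coeff b 0 = of_real b"
  by (simp add: arc_coeff_def wave_zero[abs_def] scaleR_conv_of_real)

lemma arc_coeff_full: "arc_coeff 1 n = (if n = 0 then 1 else 0)"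
proof (cases "n = 0")
  case False
  have "wave n 1 = 1"
    using cis_multiple_2pi[of "real_of_int n"] by (simp add: wave_def mult.assoc)
  then show ?thesis
    using wave_has_integral[OF False, of 1] False by (simp add: arc_coeff_def integral_unique)
qed simp

lemma arc_coeff_unit_fraction:
  assumes "0 < N"
  shows "arc_coeff (1 / real N) (int N * k) = (if k = 0 then of_real (1 / real N) else 0)"
proof (cases "k = 0")
  case False
  have "wave (int N * k) (1 / real N) = 1"
    using assms cis_multiple_2pi[of "real_of_int k"] by (simp add: wave_def mult.assoc)
  then show ?thesis
    using wave_has_integral[of "int N * k" "1 / real N"] False assms
    by (simp add: arc_coeff_def integral_unique)
qed simp

lemma cnj_arc_coeff: "cnj (arc_coeff b n) = arc_coeff b (- n)"
proof -
  have "((\<lambda>t. cnj (wave n t)) has_integral cnj (arc_coeff b n)) {0..b}"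
    using has_integral_linear[OF wave_has_arc_coeff bounded_linear_cnj] by (simp add: o_def)
  then show ?thesis
    using has_integral_unique[OF _ wave_has_arc_coeff] by (simp add: cnj_wave)
qed

lemma trig_sum_has_integral:
  assumes "finite I"
  shows "((\<lambda>t. \<Sum>i\<in>I. a i * wave (k i) t) has_integral (\<Sum>i\<in>I. a i * arc_coeff b (k i))) {0..b}"
  by (intro has_integral_sum assms has_integral_mult_right wave_has_arc_coeff)

text \<open>As an integral of a square over the arc, the Toeplitz form is positive and increases with the arc.\<close>

lemma toeplitz_has_integral:
  assumes "finite I"
  shows "((\<lambda>t. complex_of_real ((cmod (\<Sum>i\<in>I. a i * wave (k i) t))\<^sup>2)) has_integral
    (\<Sum>i\<in>I. \<Sum>j\<in>I. a i * cnj (a j) * arc_coeff b (k i - k j))) {0..b}"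
proof -
  have "complex_of_real ((cmod (\<Sum>i\<in>I. a i * wave (k i) t))\<^sup>2)
      = (\<Sum>i\<in>I. \<Sum>j\<in>I. a i * cnj (a j) * wave (k i - k j) t)" for t
  proof -
    have "complex_of_real ((cmod (\<Sum>i\<in>I. a i * wave (k i) t))\<^sup>2)
        = (\<Sum>i\<in>I. a i * wave (k i) t) * cnj (\<Sum>i\<in>I. a i * wave (k i) t)"
      by (rule complex_norm_square)
    also have "\<dots> = (\<Sum>i\<in>I. \<Sum>j\<in>I. (a i * wave (k i) t) * (cnj (a j) * wave (- k j) t))"
      by (simp add: sum_product cnj_wave)
    also have "\<dots> = (\<Sum>i\<in>I. \<Sum>j\<in>I. a i * cnj (a j) * wave (k i - k j) t)"
    proof (intro sum.cong refl)
      fix i j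
      have "(a i * wave (k i) t) * (cnj (a j) * wave (- k j) t) = a i * cnj (a j) * (wave (k i) t * wave (- k j) t)"
        by (simp only: ac_simps)
      then show "(a i * wave (k i) t) * (cnj (a j) * wave (- k j) t) = a i * cnj (a j) * wave (k i - k j) t"
        by (simp add: wave_mult)
    qed
    finally show ?thesis .
  qed
  moreover have "((\<lambda>t. \<Sum>i\<in>I. \<Sum>j\<in>I. a i * cnj (a j) * wave (k i - k j) t) has_integral
    (\<Sum>i\<in>I. \<Sum>j\<in>I. a i * cnj (a j) * arc_coeff b (k i - k j))) {0..b}"
    by (intro has_integral_sum assms has_integral_mult_right wave_has_arc_coeff)
  ultimately show ?thesis by simp
qed

lemma toeplitz_has_integral_real:
  assumes "finite I"
  shows "((\<lambda>t. (cmod (\<Sum>i\<in>I. a i * wave (k i) t))\<^sup>2) has_integral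
    Re (\<Sum>i\<in>I. \<Sum>j\<in>I. a i * cnj (a j) * arc_coeff b (k i - k j))) {0..b}"
  using has_integral_linear[OF toeplitz_has_integral[OF assms] bounded_linear_Re] by (simp add: o_def)

lemma toeplitz_mono:
  assumes "finite I" "0 \<le> b" "b \<le> b'"
  shows "Re (\<Sum>i\<in>I. \<Sum>j\<in>I. a i * cnj (a j) * arc_coeff b (k i - k j))
    \<le> Re (\<Sum>i\<in>I. \<Sum>j\<in>I. a i * cnj (a j) * arc_coeff b' (k i - k j))"
  by (rule has_integral_subset_le[OF _ toeplitz_has_integral_real[OF assms(1)] toeplitz_has_integral_real[OF assms(1)] ])
    (use assms in auto)

lemma toeplitz_full:
  assumes "finite F"
  shows "(\<Sum>i\<in>F. \<Sum>j\<in>F. a i * cnj (a j) * arc_coeff 1 (i - j)) = of_real (\<Sum>i\<in>F. (cmod (a i))\<^sup>2)"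
proof -
  have "(\<Sum>j\<in>F. a i * cnj (a j) * arc_coeff 1 (i - j)) = of_real ((cmod (a i))\<^sup>2)" if "i \<in> F" for i
    using assms that by (simp add: arc_coeff_full if_distrib sum.delta complex_norm_square cong: if_cong del: of_real_power)
  then show ?thesis by simp
qed

text \<open>Bessel's inequality: for the partial Fourier sum \<open>P\<close> the integral of \<open>\<bar>1 - P\<bar>\<^sup>2\<close> over the arc is
  non-negative, and the one of \<open>\<bar>P\<bar>\<^sup>2\<close> is at most the integral over the whole circle.\<close>

lemma arc_coeff_square_sum:
  assumes b: "0 \<le> b" "b \<le> 1" and F: "finite F"
  shows "(\<Sum>m\<in>F. (cmod (arc_coeff b m))\<^sup>2) \<le> b"
proof -
  let ?s = "\<Sum>m\<in>F. (cmod (arc_coeff b m))\<^sup>2"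
  let ?a = "\<lambda>m. cnj (arc_coeff b m)"
  let ?P = "\<lambda>t. \<Sum>m\<in>F. ?a m * wave m t"
  have "(\<Sum>m\<in>F. ?a m * arc_coeff b m) = of_real ?s"
    by (simp add: complex_norm_square mult.commute del: of_real_power)
  then have "((\<lambda>t. Re (?P t)) has_integral ?s) {0..b}"
    using has_integral_linear[OF trig_sum_has_integral[OF F, of ?a "\<lambda>m. m" b] bounded_linear_Re]
    by (simp add: o_def)
  note P = this
  have one: "((\<lambda>t. 1) has_integral b) {0..b}"
    using has_integral_const_real[of "1::real" 0 b] b by simp
  have "((\<lambda>t. 1 - 2 * Re (?P t) + (cmod (?P t))\<^sup>2) has_integral
      b - 2 * ?s + Re (\<Sum>i\<in>F. \<Sum>j\<in>F. ?a i * cnj (?a j) * arc_coeff b (i - j))) {0..b}"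
    by (rule has_integral_add[OF has_integral_diff[OF one has_integral_mult_right[OF P] ]
          toeplitz_has_integral_real[OF F, of ?a "\<lambda>m. m"] ])
  moreover have "0 \<le> 1 - 2 * Re z + (cmod z)\<^sup>2" for z
  proof -
    have "1 - 2 * Re z + (cmod z)\<^sup>2 = (1 - Re z)\<^sup>2 + (Im z)\<^sup>2"
      unfolding cmod_power2 power2_diff by simp
    then show ?thesis by simp
  qed
  ultimately have "0 \<le> b - 2 * ?s + Re (\<Sum>i\<in>F. \<Sum>j\<in>F. ?a i * cnj (?a j) * arc_coeff b (i - j))"
    by (rule has_integral_nonneg)
  also have "\<dots> \<le> b - 2 * ?s + Re (\<Sum>i\<in>F. \<Sum>j\<in>F. ?a i * cnj (?a j) * arc_coeff 1 (i - j))"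
    using toeplitz_mono[OF F b, of ?a "\<lambda>m. m"] by simp
  also have "\<dots> = b - ?s"
    unfolding toeplitz_full[OF F] by simp
  finally show ?thesis by simp
qed

definition trig_poly :: "(real \<Rightarrow> complex) \<Rightarrow> bool" where
  "trig_poly f \<longleftrightarrow> (\<exists>F a. finite F \<and> (\<forall>t. f t = (\<Sum>m\<in>F. a m * wave m t)))"

lemma trig_polyI: "finite F \<Longrightarrow> (\<And>t. f t = (\<Sum>m\<in>F. a m * wave m t)) \<Longrightarrow> trig_poly f"
  unfolding trig_poly_def by blast

lemma trig_poly_wave: "trig_poly (\<lambda>t. c * wave n t)"
  by (rule trig_polyI[of "{n}" _ "\<lambda>_. c"]) auto

lemma trig_poly_const: "trig_poly (\<lambda>t. c)"
  using trig_poly_wave[of c 0] by simp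

lemma trig_poly_add:
  assumes "trig_poly f" "trig_poly g"
  shows "trig_poly (\<lambda>t. f t + g t)"
proof -
  obtain F a where f: "finite F" "\<And>t. f t = (\<Sum>m\<in>F. a m * wave m t)"
    using assms(1) unfolding trig_poly_def by blast
  obtain H b where g: "finite H" "\<And>t. g t = (\<Sum>m\<in>H. b m * wave m t)"
    using assms(2) unfolding trig_poly_def by blast
  have "f t = (\<Sum>m\<in>F \<union> H. (if m \<in> F then a m else 0) * wave m t)"
    "g t = (\<Sum>m\<in>F \<union> H. (if m \<in> H then b m else 0) * wave m t)" for t
    unfolding f(2) g(2) by (rule sum.mono_neutral_cong_left; use f(1) g(1) in auto)+
  then have "f t + g t = (\<Sum>m\<in>F \<union> H. ((if m \<in> F then a m else 0) + (if m \<in> H then b m else 0)) * wave m t)" for t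
    by (simp only: distrib_right sum.distrib)
  then show ?thesis
    by (intro trig_polyI[of "F \<union> H"]) (use f(1) g(1) in auto)
qed

lemma trig_poly_wave_mult:
  assumes "trig_poly f"
  shows "trig_poly (\<lambda>t. (c * wave n t) * f t)"
proof -
  obtain F a where f: "finite F" "\<And>t. f t = (\<Sum>m\<in>F. a m * wave m t)"
    using assms unfolding trig_poly_def by blast
  have "(c * wave n t) * f t = (\<Sum>k\<in>(\<lambda>m. n + m) ` F. (c * a (k - n)) * wave k t)" for t
  proof -
    have "(\<Sum>k\<in>(\<lambda>m. n + m) ` F. (c * a (k - n)) * wave k t) = (\<Sum>m\<in>F. (c * a m) * wave (n + m) t)"
      by (subst sum.reindex) (auto simp: inj_on_def)
    also have "\<dots> = (c * wave n t) * f t"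
      by (simp add: f(2) sum_distrib_left wave_mult[symmetric] ac_simps)
    finally show ?thesis by simp
  qed
  then show ?thesis
    by (intro trig_polyI[of "(\<lambda>m. n + m) ` F"]) (use f(1) in auto)
qed

lemma trig_poly_mult:
  assumes "trig_poly f" "trig_poly g"
  shows "trig_poly (\<lambda>t. f t * g t)"
proof -
  obtain F a where f: "finite F" "\<And>t. f t = (\<Sum>m\<in>F. a m * wave m t)"
    using assms(1) unfolding trig_poly_def by blast
  have "trig_poly (\<lambda>t. (\<Sum>m\<in>F. a m * wave m t) * g t)"
    using f(1)
  proof (induction F)
    case empty
    then show ?case using trig_poly_const[of 0] by simp
  next
    case (insert m F)
    then show ?case
      using trig_poly_add[OF trig_poly_wave_mult[OF assms(2), of "a m" m] insert.IH]
      by (simp add: distrib_right)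
  qed
  then show ?thesis by (simp add: f(2)[abs_def])
qed

text \<open>On the unit circle the real and the imaginary part are combinations of the characters \<open>1\<close> and
  \<open>- 1\<close>. So the Stone-Weierstrass theorem for polynomials on the plane gives approximation by
  trigonometric polynomials.\<close>

lemma trig_poly_real_polynomial:
  assumes "real_polynomial_function p"
  shows "trig_poly (\<lambda>t. complex_of_real (p (wave 1 t)))"
  using assms
proof (induction rule: real_polynomial_function.induct)
  case (linear f)
  then interpret bounded_linear f .
  have "complex_of_real (f (wave 1 t)) =
      (of_real (f 1) / 2 + of_real (f \<i>) / (2 * \<i>)) * wave 1 t
    + (of_real (f 1) / 2 - of_real (f \<i>) / (2 * \<i>)) * wave (-1) t" for t
  proof -
    let ?x = "Re (wave 1 t)" and ?y = "Im (wave 1 t)"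
    have w: "wave 1 t = ?x *\<^sub>R 1 + ?y *\<^sub>R \<i>"
      by (simp add: complex_eq_iff)
    have w': "wave (-1) t = ?x *\<^sub>R 1 - ?y *\<^sub>R \<i>"
      by (simp add: complex_eq_iff flip: cnj_wave)
    have "f (wave 1 t) = ?x * f 1 + ?y * f \<i>"
      using w add[of "?x *\<^sub>R 1" "?y *\<^sub>R \<i>"] scaleR[of ?x 1] scaleR[of ?y \<i>] by simp
    moreover have "(of_real (f 1) / 2 + of_real (f \<i>) / (2 * \<i>)) * wave 1 t
        + (of_real (f 1) / 2 - of_real (f \<i>) / (2 * \<i>)) * wave (-1) t = of_real (?x * f 1 + ?y * f \<i>)"
      unfolding w' by (subst (1) w) (simp add: complex_eq_iff)
    ultimately show ?thesis by simp
  qed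
  then show ?case
    using trig_poly_add[OF trig_poly_wave trig_poly_wave] by simp
next
  case (const c)
  show ?case by (rule trig_poly_const)
next
  case (add f g)
  then show ?case using trig_poly_add by simp
next
  case (mult f g)
  then show ?case using trig_poly_mult by simp
qed

lemma trig_poly_approx:
  assumes "continuous_on UNIV \<phi>" "0 < e"
  shows "\<exists>P. trig_poly P \<and> (\<forall>t. cmod (P t - complex_of_real (\<phi> (wave 1 t))) < e)"
proof -
  obtain p where p: "real_polynomial_function p" "\<And>z. z \<in> sphere 0 1 \<Longrightarrow> \<bar>\<phi> z - p z\<bar> < e"
    using Stone_Weierstrass_real_polynomial_function[of "sphere (0::complex) 1" \<phi> e]
      continuous_on_subset[OF assms(1)] assms(2) by (metis compact_sphere subset_UNIV)
  have "cmod (complex_of_real (p (wave 1 t)) - complex_of_real (\<phi> (wave 1 t))) < e" for t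
  proof -
    have "\<bar>p (wave 1 t) - \<phi> (wave 1 t)\<bar> < e"
      using p(2)[of "wave 1 t"] by (simp add: abs_minus_commute)
    then show ?thesis
      by (metis norm_of_real of_real_diff)
  qed
  then show ?thesis
    using trig_poly_real_polynomial[OF p(1)] by blast
qed

text \<open>A continuous function on the plane that increases with \<open>K\<close> to the indicator function of the
  open arc of length \<open>2 \<pi> b\<close> on the unit circle.\<close>

definition bump :: "real \<Rightarrow> real \<Rightarrow> complex \<Rightarrow> real" where
  "bump b K z = max 0 (min 1 (K * (Re (z * cis (- (pi * b))) - cos (pi * b))))"

lemma continuous_bump: "continuous_on S (bump b K)"
  unfolding bump_def by (intro continuous_intros)

lemma bump_bounds: "0 \<le> bump b K z" "bump b K z \<le> 1"
  by (auto simp: bump_def)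

lemma bump_wave:
  "bump b K (wave 1 t) = max 0 (min 1 (K * (cos (2 * pi * t - pi * b) - cos (pi * b))))"
  by (simp add: bump_def wave_def cis_mult)

lemma bump_outside:
  assumes "0 < b" "b \<le> t" "t \<le> 1" "0 \<le> K"
  shows "bump b K (wave 1 t) = 0"
proof -
  let ?x = "2 * pi * t - pi * b"
  have lo: "pi * b \<le> ?x" and hi: "?x \<le> 2 * pi - pi * b"
    using assms mult_left_mono[of b t pi] mult_left_mono[of t 1 pi] by (simp_all add: algebra_simps)
  have b0: "0 \<le> pi * b" using assms by simp
  have "cos ?x \<le> cos (pi * b)"
  proof (cases "?x \<le> pi")
    case True
    then show ?thesis using cos_monotone_0_pi_le[OF b0 lo] by blast
  next
    case False
    have "cos ?x = cos (2 * pi - ?x)" by (simp add: cos_diff)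
    also have "\<dots> \<le> cos (pi * b)"
      by (rule cos_monotone_0_pi_le) (use False lo hi b0 in linarith)+
    finally show ?thesis .
  qed
  then have "K * (cos ?x - cos (pi * b)) \<le> 0"
    using assms(4) by (simp add: mult_nonneg_nonpos)
  then show ?thesis by (simp add: bump_wave)
qed

lemma bump_tendsto:
  assumes "0 < t" "t < b" "b \<le> 1"
  shows "(\<lambda>k. bump b (real k) (wave 1 t)) \<longlonglongrightarrow> 1"
proof -
  let ?x = "2 * pi * t - pi * b"
  have "\<bar>2 * t - b\<bar> < b" using assms by auto
  then have "pi * \<bar>2 * t - b\<bar> < pi * b" by simp
  moreover have "\<bar>?x\<bar> = pi * \<bar>2 * t - b\<bar>"
  proof -
    have "?x = pi * (2 * t - b)" by (simp add: algebra_simps)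
    then show ?thesis by (simp only: abs_mult) simp
  qed
  ultimately have "\<bar>?x\<bar> < pi * b" by simp
  moreover have "pi * b \<le> pi" using assms by simp
  ultimately have "cos (pi * b) < cos \<bar>?x\<bar>"
    by (intro cos_monotone_0_pi) auto
  then have d: "0 < cos ?x - cos (pi * b)" by simp
  obtain N :: nat where N: "1 / (cos ?x - cos (pi * b)) < real N"
    using reals_Archimedean2 by blast
  have "bump b (real k) (wave 1 t) = 1" if "k \<ge> N" for k
  proof -
    have "1 / (cos ?x - cos (pi * b)) \<le> real k" using N that by linarith
    then have "1 \<le> real k * (cos ?x - cos (pi * b))" using d by (simp add: field_simps)
    then show ?thesis by (simp add: bump_wave)
  qed
  then show ?thesis
    by (intro tendsto_eventually eventually_sequentiallyI[of N])
qed

lemma continuous_bump_wave: "continuous_on S (\<lambda>t. bump b K (wave 1 t))"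
  unfolding bump_wave by (intro continuous_intros)

lemma bump_integral_tendsto:
  assumes "0 < b" "b \<le> 1"
  shows "(\<lambda>k. integral {0..b} (\<lambda>t. bump b (real k) (wave 1 t))) \<longlonglongrightarrow> b"
proof -
  let ?g = "\<lambda>t. if t \<in> {0<..<b} then 1 else 0 :: real"
  have g: "(?g has_integral b) {0..b}"
  proof (rule has_integral_spike_finite[of "{0, b}"])
    show "((\<lambda>t. 1 :: real) has_integral b) {0..b}"
      using has_integral_const_real[of "1::real" 0 b] assms by simp
  qed auto
  have "(\<lambda>k. integral {0..b} (\<lambda>t. bump b (real k) (wave 1 t))) \<longlonglongrightarrow> integral {0..b} ?g"
  proof (rule dominated_convergence(2))
    show "(\<lambda>t. bump b (real k) (wave 1 t)) integrable_on {0..b}" for k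
      by (rule integrable_continuous_interval[OF continuous_bump_wave])
    show "(\<lambda>t. 1 :: real) integrable_on {0..b}"
      by (rule integrable_const_ivl)
    show "norm (bump b (real k) (wave 1 t)) \<le> 1" for k t
      using bump_bounds[of b "real k" "wave 1 t"] by simp
    show "(\<lambda>k. bump b (real k) (wave 1 t)) \<longlonglongrightarrow> ?g t" if "t \<in> {0..b}" for t
    proof (cases "t \<in> {0<..<b}")
      case True
      then show ?thesis using bump_tendsto[of t b] assms by simp
    next
      case False
      then have "t = 0 \<or> t = b" using that by auto
      then have "bump b (real k) (wave 1 t) = 0" for k
        using bump_outside[of b b "real k"] assms by (auto simp: bump_wave)
      then show ?thesis using False by auto
    qed
  qed
  then show ?thesis using integral_unique[OF g] by simp
qed

text \<open>Trigonometric polynomials close to a bump with large \<open>K\<close>: their mean square over the circle is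
  hardly larger than the length of the arc, and on the arc their integral against any character is
  close to that of the indicator function.\<close>

lemma arc_approx:
  assumes b: "0 < b" "b \<le> 1" and e: "0 < e" "e \<le> 1"
  shows "\<exists>F a. finite F \<and> (\<Sum>m\<in>F. (cmod (a m))\<^sup>2) \<le> b + 3 * e \<and>
    (\<forall>n. cmod ((\<Sum>m\<in>F. a m * arc_coeff b (m + n)) - arc_coeff b n) \<le> 2 * e)"
proof -
  obtain k where k: "\<bar>integral {0..b} (\<lambda>t. bump b (real k) (wave 1 t)) - b\<bar> < e"
    using LIMSEQ_D[OF bump_integral_tendsto[OF b] e(1)] by auto
  let ?\<phi> = "\<lambda>t. bump b (real k) (wave 1 t)"
  obtain P where P: "trig_poly P" "\<And>t. cmod (P t - complex_of_real (?\<phi> t)) < e"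
    using trig_poly_approx[OF continuous_bump e(1)] by blast
  obtain F a where F: "finite F" and Pa: "\<And>t. P t = (\<Sum>m\<in>F. a m * wave m t)"
    using P(1) unfolding trig_poly_def by blast
  have \<phi>: "(?\<phi> has_integral integral {0..c} ?\<phi>) {0..c}" for c
    by (rule integrable_integral[OF integrable_continuous_interval[OF continuous_bump_wave] ])
  have const: "((\<lambda>t. c) has_integral c * d) {0..d}" if "0 \<le> d" for c d :: real
    using has_integral_const_real[of c 0 d] that by (simp add: mult.commute)
  have norm_P: "cmod (P t) \<le> ?\<phi> t + e" for t
  proof -
    have "cmod (P t) \<le> cmod (P t - complex_of_real (?\<phi> t)) + cmod (complex_of_real (?\<phi> t))"
      using norm_triangle_ineq[of "P t - complex_of_real (?\<phi> t)" "complex_of_real (?\<phi> t)"] by simp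
    also have "\<dots> \<le> e + ?\<phi> t"
      using P(2)[of t] bump_bounds(1)[of b "real k" "wave 1 t"] by simp
    finally show ?thesis by simp
  qed
  have "(\<Sum>m\<in>F. (cmod (a m))\<^sup>2) \<le> b + 3 * e"
  proof -
    have P2: "((\<lambda>t. (cmod (P t))\<^sup>2) has_integral (\<Sum>m\<in>F. (cmod (a m))\<^sup>2)) {0..1}"
      using toeplitz_has_integral_real[OF F, of a "\<lambda>m. m" 1] unfolding toeplitz_full[OF F] by (simp add: Pa)
    let ?h = "\<lambda>t. if t \<in> {0..b} then (1::real) else 0"
    have h: "(?h has_integral b) {0..1}"
      using has_integral_restrict[of "{0..b}" "{0..1}" "\<lambda>_. 1::real" b] const[of b 1] b by simp
    have "((\<lambda>t. ?h t + 3 * e) has_integral (b + 3 * e)) {0..1}"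
      using has_integral_add[OF h const[of 1 "3 * e"] ] by simp
    moreover have "(cmod (P t))\<^sup>2 \<le> ?h t + 3 * e" if "t \<in> {0..1}" for t
    proof (cases "t \<in> {0..b}")
      case True
      have "cmod (P t) \<le> 1 + e" using norm_P[of t] bump_bounds(2)[of b "real k" "wave 1 t"] by linarith
      then have "(cmod (P t))\<^sup>2 \<le> (1 + e)\<^sup>2" by (intro power_mono) auto
      also have "\<dots> \<le> 1 + 3 * e"
        using e mult_left_mono[of e 1 e] by (simp add: power2_eq_square algebra_simps)
      finally show ?thesis using True by simp
    next
      case False
      then have "cmod (P t) \<le> e" using norm_P[of t] bump_outside[of b t "real k"] that b by auto
      then have "(cmod (P t))\<^sup>2 \<le> e\<^sup>2" by (intro power_mono) auto
      also have "\<dots> \<le> 3 * e"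
        using e mult_left_mono[of e 1 e] by (simp add: power2_eq_square)
      finally show ?thesis using False by auto
    qed
    ultimately show ?thesis
      by (intro has_integral_le[OF P2])
  qed
  moreover have "cmod ((\<Sum>m\<in>F. a m * arc_coeff b (m + n)) - arc_coeff b n) \<le> 2 * e" for n
  proof -
    have "((\<lambda>t. P t * wave n t - wave n t) has_integral
        (\<Sum>m\<in>F. a m * arc_coeff b (m + n)) - arc_coeff b n) {0..b}"
    proof (rule has_integral_diff[OF _ wave_has_arc_coeff])
      have "P t * wave n t = (\<Sum>m\<in>F. a m * wave (m + n) t)" for t
        by (simp add: Pa sum_distrib_right wave_mult[symmetric] mult.assoc)
      then show "((\<lambda>t. P t * wave n t) has_integral (\<Sum>m\<in>F. a m * arc_coeff b (m + n))) {0..b}"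
        using trig_sum_has_integral[OF F, of a "\<lambda>m. m + n" b] by simp
    qed
    moreover have "((\<lambda>t. 1 - ?\<phi> t + e) has_integral (b - integral {0..b} ?\<phi> + e * b)) {0..b}"
      using has_integral_add[OF has_integral_diff[OF const[of b 1] \<phi>[of b] ] const[of b e] ] b by simp
    moreover have "norm (P t * wave n t - wave n t) \<le> 1 - ?\<phi> t + e" for t
    proof -
      have "norm (P t * wave n t - wave n t) = cmod (P t - 1)"
        by (metis left_diff_distrib mult_1 mult.right_neutral norm_mult norm_wave)
      also have "\<dots> \<le> cmod (P t - complex_of_real (?\<phi> t)) + cmod (complex_of_real (?\<phi> t) - 1)"
        using norm_triangle_ineq[of "P t - complex_of_real (?\<phi> t)" "complex_of_real (?\<phi> t) - 1"] by simp
      also have "cmod (complex_of_real (?\<phi> t) - 1) = 1 - ?\<phi> t"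
        using bump_bounds(2)[of b "real k" "wave 1 t"]
        by (metis abs_minus_commute abs_of_nonneg diff_ge_0_iff_ge norm_of_real of_real_1 of_real_diff)
      finally show ?thesis using P(2)[of t] by linarith
    qed
    ultimately have "norm ((\<Sum>m\<in>F. a m * arc_coeff b (m + n)) - arc_coeff b n) \<le> b - integral {0..b} ?\<phi> + e * b"
      using integral_norm_bound_integral[of "\<lambda>t. P t * wave n t - wave n t" "{0..b}" "\<lambda>t. 1 - ?\<phi> t + e"]
      by (metis (no_types, lifting) has_integral_integrable integral_unique)
    also have "\<dots> \<le> e + e"
    proof -
      have "e * b \<le> e" using mult_left_mono[of b 1 e] b e by simp
      moreover have "b - integral {0..b} ?\<phi> < e" using k by (simp only: abs_less_iff) simp
      ultimately show ?thesis by linarith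
    qed
    finally show ?thesis by simp
  qed
  ultimately show ?thesis using F by blast
qed

text \<open>The sequence of coefficients is idempotent for convolution, as the indicator function is for
  multiplication. The polynomials of the previous lemma approximate the sequence in norm, and for
  them convolution is integration over the arc.\<close>

lemma arc_coeff_idempotent:
  fixes \<xi> \<eta> :: "int ell2"
  assumes b: "0 < b" "b \<le> 1" and \<xi>: "coord \<xi> = arc_coeff b" and \<eta>: "coord \<eta> = (\<lambda>m. arc_coeff b (m - n))"
  shows "inner (scaleC z \<xi>) \<eta> = Re (z * arc_coeff b n)"
proof -
  (* An approximation with error e is within sqrt (10 e) of the sequence in norm, and changes the
     coefficient at n by at most 2 e. *)
  define C where "C = cmod z * sqrt 10 * norm \<eta> + 2 * cmod z"
  have bound: "\<bar>inner (scaleC z \<xi>) \<eta> - Re (z * arc_coeff b n)\<bar> \<le> C * sqrt e" if e: "0 < e" "e \<le> 1" for e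
  proof -
    obtain F a where F: "finite F" and a: "(\<Sum>m\<in>F. (cmod (a m))\<^sup>2) \<le> b + 3 * e"
      and conv: "\<And>n. cmod ((\<Sum>m\<in>F. a m * arc_coeff b (m + n)) - arc_coeff b n) \<le> 2 * e"
      using arc_approx[OF b e] by blast
    define A where "A = (\<Sum>m\<in>F. single (- m) (a m))"
    have coord_A: "coord A (- m) = a m" if "m \<in> F" for m
      using that F by (simp add: A_def if_distrib sum.delta cong: if_cong)
    have inner_A: "inner f A = (\<Sum>m\<in>F. inner (coord f (- m)) (a m))" for f
      by (simp add: A_def inner_sum_right)
    have AA: "inner A A = (\<Sum>m\<in>F. (cmod (a m))\<^sup>2)"
      unfolding inner_A by (intro sum.cong refl) (simp add: coord_A power2_norm_eq_inner)
    have mult: "inner x y = Re (y * cnj x)" for x y :: complex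
      by (simp add: inner_complex_def algebra_simps)
    have \<xi>A: "inner \<xi> A = Re (\<Sum>m\<in>F. a m * arc_coeff b m)"
      unfolding inner_A by (simp add: mult \<xi> cnj_arc_coeff)
    have "(norm \<xi>)\<^sup>2 \<le> b"
      by (rule has_sum_le_finite_sums[OF norm_has_sum]) (use arc_coeff_square_sum b \<xi> in auto)
    moreover have "b - 2 * e \<le> inner \<xi> A"
      using conv[of 0] abs_Re_le_cmod[of "(\<Sum>m\<in>F. a m * arc_coeff b m) - arc_coeff b 0"] b \<xi>A by simp
    ultimately have "(norm (\<xi> - A))\<^sup>2 \<le> 10 * e"
      using a e by (simp add: power2_norm_eq_inner inner_diff inner_commute AA)
    then have close: "norm (\<xi> - A) \<le> sqrt 10 * sqrt e"
      using real_le_rsqrt by (simp add: real_sqrt_mult[symmetric])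
    have "\<bar>inner (scaleC z \<xi>) \<eta> - inner (scaleC z A) \<eta>\<bar> = \<bar>inner (scaleC z (\<xi> - A)) \<eta>\<bar>"
      by (simp add: scaleC_diff inner_diff_left)
    also have "\<dots> \<le> cmod z * norm (\<xi> - A) * norm \<eta>"
      using Cauchy_Schwarz_ineq2[of "scaleC z (\<xi> - A)" \<eta>] by simp
    also have "\<dots> \<le> cmod z * (sqrt 10 * sqrt e) * norm \<eta>"
      by (intro mult_right_mono mult_left_mono close) auto
    finally have 1: "\<bar>inner (scaleC z \<xi>) \<eta> - inner (scaleC z A) \<eta>\<bar> \<le> cmod z * sqrt 10 * norm \<eta> * sqrt e"
      by (simp add: ac_simps)
    have "inner (scaleC z A) \<eta> = inner \<eta> (scaleC z A)" by (rule inner_commute)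
    also have "\<dots> = inner (scaleC (cnj z) \<eta>) A" by (simp add: inner_scaleC)
    also have "\<dots> = Re (z * (\<Sum>m\<in>F. a m * arc_coeff b (m + n)))"
      unfolding inner_A by (simp add: mult \<eta> cnj_arc_coeff sum_distrib_left ac_simps)
    finally have "inner (scaleC z A) \<eta> - Re (z * arc_coeff b n)
        = Re (z * ((\<Sum>m\<in>F. a m * arc_coeff b (m + n)) - arc_coeff b n))"
      by (simp only: right_diff_distrib minus_complex.sel)
    then have "\<bar>inner (scaleC z A) \<eta> - Re (z * arc_coeff b n)\<bar>
        \<le> cmod z * cmod ((\<Sum>m\<in>F. a m * arc_coeff b (m + n)) - arc_coeff b n)"
      by (metis abs_Re_le_cmod norm_mult)
    also have "\<dots> \<le> cmod z * (2 * e)"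
      by (intro mult_left_mono conv) auto
    also have "\<dots> \<le> cmod z * (2 * sqrt e)"
      using e real_le_rsqrt[of e e] mult_left_mono[of e 1 e]
      by (intro mult_left_mono) (auto simp: power2_eq_square)
    finally have "\<bar>inner (scaleC z A) \<eta> - Re (z * arc_coeff b n)\<bar> \<le> 2 * cmod z * sqrt e"
      by (simp add: ac_simps)
    with 1 show ?thesis unfolding C_def by (simp add: distrib_right)
  qed
  have lim: "(\<lambda>k. C * sqrt (inverse (real (Suc k)))) \<longlonglongrightarrow> 0"
    using tendsto_mult[OF tendsto_const[of C] tendsto_real_sqrt[OF LIMSEQ_inverse_real_of_nat] ]
    by (simp only: real_sqrt_zero mult_zero_right)
  have "\<bar>inner (scaleC z \<xi>) \<eta> - Re (z * arc_coeff b n)\<bar> \<le> C * sqrt (inverse (real (Suc k)))" for k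
    by (rule bound) (auto simp: field_simps)
  then have "\<bar>inner (scaleC z \<xi>) \<eta> - Re (z * arc_coeff b n)\<bar> \<le> 0"
    by (intro LIMSEQ_le_const[OF lim]) blast
  then show ?thesis by simp
qed

section \<open>The spectral projection of an arc for right translation by an element of infinite order\<close>

locale infinite_order_element = group G for G :: "('a, 'b) monoid_scheme" (structure) +
  fixes a :: 'a
  assumes a_closed: "a \<in> carrier G"
    and pow_inj: "a [^] (i::int) = a [^] (j::int) \<longleftrightarrow> i = j"
begin

definition pow :: "int \<Rightarrow> 'a" where
  "pow n = a [^] n"

lemma inj_pow: "inj pow"
  by (simp add: inj_on_def pow_def pow_inj)

lemma pow_closed: "pow n \<in> S"
  by (simp add: pow_def a_closed)

lemma pow_add: "pow (m + n) = pow m \<otimes> pow n"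
  by (simp add: pow_def int_pow_mult a_closed)

lemma pow_uminus: "pow (- n) = inv (pow n)"
  by (simp add: pow_def int_pow_neg a_closed)

lemma pow_zero: "pow 0 = \<one>"
  by (simp add: pow_def)

text \<open>The coordinates \<open>g = t a\<^sup>k\<close> with respect to a choice of representatives of the left cosets of
  the cyclic group of \<open>a\<close>.\<close>

definition representative :: "'a \<Rightarrow> 'a" where
  "representative g = (SOME r. r \<in> range (\<lambda>n. g \<otimes> pow n))"

definition exponent :: "'a \<Rightarrow> int" where
  "exponent g = inv_into UNIV pow (inv (representative g) \<otimes> g)"

lemma representative_exponent:
  assumes g: "g \<in> S"
  shows "representative g \<in> S \<and> g = representative g \<otimes> pow (exponent g)"
proof -
  have "representative g \<in> range (\<lambda>n. g \<otimes> pow n)"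
    unfolding representative_def by (rule someI_ex) blast
  then obtain n where n: "representative g = g \<otimes> pow n" by blast
  then have r: "representative g \<in> S" using g pow_closed by simp
  have "inv (representative g) \<otimes> g = pow (- n)"
    unfolding n using g pow_closed by (simp add: inv_mult_group m_assoc pow_uminus)
  then have "exponent g = - n"
    by (simp add: exponent_def inv_f_f[OF inj_pow])
  then have "representative g \<otimes> pow (exponent g) = g"
    unfolding n using g pow_closed by (simp add: m_assoc pow_add[symmetric] pow_zero)
  then show ?thesis using r by simp
qed

lemma representative_coset:
  assumes g: "g \<in> S"
  shows "representative (g \<otimes> pow n) = representative g"
proof -
  have "range (\<lambda>m. (g \<otimes> pow n) \<otimes> pow m) = range (\<lambda>m. g \<otimes> pow m)"
  proof (intro subset_antisym image_subsetI)
    fix m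
    have "(g \<otimes> pow n) \<otimes> pow m = g \<otimes> pow (n + m)"
      using g pow_closed by (simp add: pow_add m_assoc)
    then show "(g \<otimes> pow n) \<otimes> pow m \<in> range (\<lambda>m. g \<otimes> pow m)" by blast
    have "g \<otimes> pow m = (g \<otimes> pow n) \<otimes> pow (m - n)"
      using g pow_closed by (simp add: m_assoc pow_add[symmetric])
    then show "g \<otimes> pow m \<in> range (\<lambda>m. (g \<otimes> pow n) \<otimes> pow m)" by blast
  qed
  then show ?thesis by (simp add: representative_def)
qed

lemma same_representative:
  assumes g: "g \<in> S" and h: "h \<in> S" and eq: "representative g = representative h"
  shows "inv g \<otimes> h = pow (exponent h - exponent g)"
proof -
  let ?r = "representative h"
  have r: "?r \<in> S" and h': "h = ?r \<otimes> pow (exponent h)" and g': "g = ?r \<otimes> pow (exponent g)"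
    using representative_exponent[OF h] representative_exponent[OF g] eq by auto
  have "inv g = pow (- exponent g) \<otimes> inv ?r"
    by (subst g') (simp add: r pow_closed inv_mult_group pow_uminus)
  moreover have "(pow (- exponent g) \<otimes> inv ?r) \<otimes> (?r \<otimes> pow (exponent h)) = pow (- exponent g) \<otimes> pow (exponent h)"
    using r pow_closed by (metis inv_closed inv_solve_left m_assoc m_closed)
  ultimately have "inv g \<otimes> h = pow (- exponent g) \<otimes> pow (exponent h)"
    using h' by metis
  then show ?thesis by (simp add: pow_add[symmetric])
qed

lemma representative_eq_iff:
  assumes g: "g \<in> S" and h: "h \<in> S"
  shows "representative g = representative h \<longleftrightarrow> inv g \<otimes> h \<in> range pow"
proof
  assume "representative g = representative h"
  then show "inv g \<otimes> h \<in> range pow"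
    using same_representative[OF g h] by blast
next
  assume "inv g \<otimes> h \<in> range pow"
  then obtain n where "inv g \<otimes> h = pow n" by blast
  then have "h = g \<otimes> pow n" using g h pow_closed by (metis inv_solve_left)
  then show "representative g = representative h" using representative_coset[OF g] by metis
qed

lemma exponent_inj:
  assumes g: "g \<in> S" and h: "h \<in> S" and eq: "representative g = representative h" "exponent g = exponent h"
  shows "g = h"
  using representative_exponent[OF g] representative_exponent[OF h] eq by metis

text \<open>The Fourier coefficients of the arc, placed on the powers of \<open>a\<close>.\<close>

definition arc_vector :: "real \<Rightarrow> 'a ell2" where
  "arc_vector b = Abs_ell2 (\<lambda>x. if x \<in> range pow then arc_coeff b (inv_into UNIV pow x) else 0)"

lemma coord_arc_vector_aux:
  assumes b: "0 \<le> b" "b \<le> 1"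
  shows "coord (arc_vector b) = (\<lambda>x. if x \<in> range pow then arc_coeff b (inv_into UNIV pow x) else 0)"
proof -
  let ?u = "\<lambda>x. if x \<in> range pow then arc_coeff b (inv_into UNIV pow x) else 0"
  have "(\<Sum>x\<in>F. (cmod (?u x))\<^sup>2) \<le> (sqrt b)\<^sup>2" if F: "finite F" for F
  proof -
    have inj: "inj_on (inv_into UNIV pow) (F \<inter> range pow)"
      by (rule inj_on_inv_into) blast
    have "(\<Sum>x\<in>F. (cmod (?u x))\<^sup>2) = (\<Sum>x\<in>F \<inter> range pow. (cmod (arc_coeff b (inv_into UNIV pow x)))\<^sup>2)"
      by (rule sum.mono_neutral_cong_right) (use F in auto)
    also have "\<dots> = (\<Sum>n\<in>inv_into UNIV pow ` (F \<inter> range pow). (cmod (arc_coeff b n))\<^sup>2)"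
      by (simp add: sum.reindex[OF inj])
    also have "\<dots> \<le> b"
      by (rule arc_coeff_square_sum[OF b]) (use F in auto)
    finally show ?thesis using b by simp
  qed
  from ell2_of_bounded[OF this] b obtain f :: "'a ell2" where f: "coord f = ?u" by auto
  then have "f = arc_vector b"
    unfolding arc_vector_def by (simp only: f[symmetric] coord_inverse)
  then show ?thesis using f by simp
qed

lemma coord_arc_vector_pow: "0 \<le> b \<Longrightarrow> b \<le> 1 \<Longrightarrow> coord (arc_vector b) (pow n) = arc_coeff b n"
  by (simp add: coord_arc_vector_aux inv_f_f[OF inj_pow])

lemma coord_arc_vector_outside: "0 \<le> b \<Longrightarrow> b \<le> 1 \<Longrightarrow> x \<notin> range pow \<Longrightarrow> coord (arc_vector b) x = 0"
  by (simp add: coord_arc_vector_aux)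

lemma coord_arc_vector_quotient:
  assumes b: "0 \<le> b" "b \<le> 1" and g: "g \<in> S" and h: "h \<in> S"
  shows "coord (arc_vector b) (inv g \<otimes> h) =
    (if representative g = representative h then arc_coeff b (exponent h - exponent g) else 0)"
  using representative_eq_iff[OF g h] same_representative[OF g h] coord_arc_vector_pow[OF b]
    coord_arc_vector_outside[OF b] by auto

lemma cut_arc_vector: "0 \<le> b \<Longrightarrow> b \<le> 1 \<Longrightarrow> cut (arc_vector b) = arc_vector b"
  by (rule ell2_eqI) (use pow_closed in \<open>auto simp: coord_cut coord_arc_vector_aux\<close>)

lemma arc_sequence_exists:
  assumes b: "0 \<le> b" "b \<le> 1"
  shows "\<exists>U :: int ell2. coord U = (\<lambda>m. arc_coeff b (m - n))"
proof -
  have "(\<Sum>m\<in>F. (cmod (arc_coeff b (m - n)))\<^sup>2) \<le> (sqrt b)\<^sup>2" if F: "finite F" for F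
  proof -
    have "(\<Sum>m\<in>F. (cmod (arc_coeff b (m - n)))\<^sup>2) = (\<Sum>m\<in>(\<lambda>m. m - n) ` F. (cmod (arc_coeff b m))\<^sup>2)"
      by (subst sum.reindex) (auto simp: inj_on_def)
    also have "\<dots> \<le> b"
      by (rule arc_coeff_square_sum[OF b]) (use F in auto)
    finally show ?thesis using b by simp
  qed
  from ell2_of_bounded[OF this] b show ?thesis by auto
qed

lemma inner_on_powers:
  fixes U V :: "int ell2"
  assumes u: "\<And>x. x \<notin> range pow \<Longrightarrow> coord u x = 0"
    and U: "\<And>n. coord U n = coord u (pow n)" and V: "\<And>n. coord V n = coord v (pow n)"
  shows "inner u v = inner U V"
proof -
  let ?r = "\<lambda>x. inner (coord u x) (coord v x)"
  have bij: "bij_betw pow UNIV (range pow)"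
    by (simp add: inj_on_imp_bij_betw inj_pow)
  have "(?r has_sum inner u v) UNIV"
    by (rule inner_has_sum)
  then have "(?r has_sum inner u v) (range pow)"
    by (rule has_sum_cong_neutral[THEN iffD1, rotated -1]) (auto simp: u)
  then have "((\<lambda>n. ?r (pow n)) has_sum inner u v) UNIV"
    by (simp only: has_sum_reindex_bij_betw[OF bij, of ?r])
  then have "((\<lambda>n. inner (coord U n) (coord V n)) has_sum inner u v) UNIV"
    by (simp only: U V)
  then show ?thesis
    by (rule has_sum_unique[OF _ inner_has_sum])
qed

text \<open>For a power of \<open>a\<close> this is the idempotence of the coefficient sequence. For other elements the two
  vectors have disjoint supports.\<close>

lemma arc_vector_translate:
  assumes b: "0 < b" "b \<le> 1" and k: "k \<in> S"
  shows "inner (scaleC z (arc_vector b)) (left_tr k (arc_vector b)) = Re (z * coord (arc_vector b) k)"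
proof -
  let ?\<xi> = "arc_vector b"
  have b0: "0 \<le> b" using b by simp
  show ?thesis
  proof (cases "k \<in> range pow")
    case True
    then obtain n where n: "k = pow n" by blast
    obtain U :: "int ell2" where U: "coord U = (\<lambda>m. arc_coeff b (m - 0))"
      using arc_sequence_exists[OF b0 b(2), of 0] by blast
    obtain V :: "int ell2" where V: "coord V = (\<lambda>m. arc_coeff b (m - n))"
      using arc_sequence_exists[OF b0 b(2), of n] by blast
    have "inner (scaleC z ?\<xi>) (left_tr k ?\<xi>) = inner (scaleC z U) V"
    proof (rule inner_on_powers)
      show "coord (scaleC z ?\<xi>) x = 0" if "x \<notin> range pow" for x
        by (simp add: coord_arc_vector_outside[OF b0 b(2) that])
      show "coord (scaleC z U) m = coord (scaleC z ?\<xi>) (pow m)" for m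
        by (simp add: U coord_arc_vector_pow[OF b0 b(2)])
      show "coord V m = coord (left_tr k ?\<xi>) (pow m)" for m
      proof -
        have "inv k \<otimes> pow m = pow (m - n)"
          by (simp add: n pow_uminus[symmetric] pow_add[symmetric])
        then show ?thesis
          using k by (simp add: coord_left_tr V coord_arc_vector_pow[OF b0 b(2)] pow_closed)
      qed
    qed
    also have "\<dots> = Re (z * arc_coeff b n)"
      by (rule arc_coeff_idempotent[OF b _ V]) (simp add: U)
    finally show ?thesis
      by (simp only: n coord_arc_vector_pow[OF b0 b(2)])
  next
    case False
    have zero: "inner (coord (scaleC z ?\<xi>) x) (coord (left_tr k ?\<xi>) x) = 0" for x
    proof (cases "x \<in> range pow")
      case True
      then obtain m where m: "x = pow m" by blast
      have "inv k \<otimes> x \<notin> range pow"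
      proof
        assume "inv k \<otimes> x \<in> range pow"
        then obtain l where "inv k \<otimes> pow m = pow l" using m by blast
        then have "pow m = k \<otimes> pow l" using k pow_closed by (metis inv_solve_left)
        then have "k = pow m \<otimes> inv (pow l)" using k pow_closed by (metis inv_solve_right)
        then have "k = pow (m + (- l))" by (simp only: pow_add pow_uminus)
        then show False using False by blast
      qed
      then show ?thesis
        using k by (simp add: coord_left_tr coord_arc_vector_outside[OF b0 b(2)])
    next
      case False
      then show ?thesis by (simp add: coord_arc_vector_outside[OF b0 b(2)])
    qed
    have "inner (scaleC z ?\<xi>) (left_tr k ?\<xi>) = 0"
      unfolding inner_ell2_def zero by simp
    then show ?thesis using False by (simp add: coord_arc_vector_outside[OF b0 b(2)])
  qed
qed

lemma arc_vector_gram: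
  assumes b: "0 < b" "b \<le> 1" and g: "g \<in> S" and h: "h \<in> S"
  shows "inner (scaleC z (left_tr g (arc_vector b))) (left_tr h (arc_vector b))
    = Re (z * coord (arc_vector b) (inv g \<otimes> h))"
proof -
  have "inner (scaleC z (left_tr g (arc_vector b))) (left_tr h (arc_vector b))
      = inner (scaleC z (arc_vector b)) (left_tr (inv g) (left_tr h (arc_vector b)))"
    by (simp only: left_tr_scaleC[OF g, symmetric] adjD[OF adj_left_tr[OF g] ])
  also have "\<dots> = Re (z * coord (arc_vector b) (inv g \<otimes> h))"
    using g h arc_vector_translate[OF b, of "inv g \<otimes> h" z] by (simp add: left_tr_mult)
  finally show ?thesis .
qed

definition toeplitz :: "real \<Rightarrow> 'a set \<Rightarrow> ('a \<Rightarrow> complex) \<Rightarrow> real" where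
  "toeplitz b F c = Re (\<Sum>g\<in>F. \<Sum>h\<in>F. c g * cnj (c h) * coord (arc_vector b) (inv g \<otimes> h))"

lemma norm_arc_translates:
  assumes b: "0 < b" "b \<le> 1" and F: "finite F" "F \<subseteq> S"
  shows "(norm (\<Sum>g\<in>F. scaleC (c g) (left_tr g (arc_vector b))))\<^sup>2 = toeplitz b F c"
proof -
  let ?x = "\<lambda>g. left_tr g (arc_vector b)"
  have "(norm (\<Sum>g\<in>F. scaleC (c g) (?x g)))\<^sup>2
      = (\<Sum>g\<in>F. \<Sum>h\<in>F. inner (scaleC (c g * cnj (c h)) (?x g)) (?x h))"
    by (rule norm_sum_scaleC)
  also have "\<dots> = (\<Sum>g\<in>F. \<Sum>h\<in>F. Re (c g * cnj (c h) * coord (arc_vector b) (inv g \<otimes> h)))"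
    by (intro sum.cong refl arc_vector_gram[OF b]) (use F in auto)
  finally show ?thesis by (simp add: toeplitz_def)
qed

text \<open>Different cosets do not interact, and on one coset the form is the Toeplitz form of the arc.\<close>

lemma toeplitz_cosets:
  assumes b: "0 \<le> b" "b \<le> 1" and F: "finite F" "F \<subseteq> S"
  shows "toeplitz b F c = (\<Sum>r\<in>representative ` F. Re (\<Sum>g\<in>{x\<in>F. representative x = r}.
    \<Sum>h\<in>{x\<in>F. representative x = r}. c g * cnj (c h) * arc_coeff b (- exponent g - (- exponent h))))"
proof -
  let ?F = "\<lambda>r. {x\<in>F. representative x = r}"
  have "(\<Sum>g\<in>F. \<Sum>h\<in>F. c g * cnj (c h) * coord (arc_vector b) (inv g \<otimes> h))
      = (\<Sum>g\<in>F. \<Sum>h\<in>?F (representative g). c g * cnj (c h) * arc_coeff b (- exponent g - (- exponent h)))"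
  proof (rule sum.cong[OF refl])
    fix g assume g: "g \<in> F"
    show "(\<Sum>h\<in>F. c g * cnj (c h) * coord (arc_vector b) (inv g \<otimes> h))
      = (\<Sum>h\<in>?F (representative g). c g * cnj (c h) * arc_coeff b (- exponent g - (- exponent h)))"
    proof (rule sum.mono_neutral_cong_right)
      show "\<forall>h\<in>F - ?F (representative g). c g * cnj (c h) * coord (arc_vector b) (inv g \<otimes> h) = 0"
      proof
        fix h assume "h \<in> F - ?F (representative g)"
        then have "h \<in> S" "representative g \<noteq> representative h" using F by auto
        then show "c g * cnj (c h) * coord (arc_vector b) (inv g \<otimes> h) = 0"
          using g F by (simp add: coord_arc_vector_quotient[OF b] subset_iff)
      qed
      fix h assume "h \<in> ?F (representative g)"
      then show "c g * cnj (c h) * coord (arc_vector b) (inv g \<otimes> h)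
          = c g * cnj (c h) * arc_coeff b (- exponent g - (- exponent h))"
        using g F by (simp add: coord_arc_vector_quotient[OF b] subset_iff)
    qed (use F in auto)
  qed
  also have "\<dots> = (\<Sum>r\<in>representative ` F. \<Sum>g\<in>?F r. \<Sum>h\<in>?F (representative g).
      c g * cnj (c h) * arc_coeff b (- exponent g - (- exponent h)))"
    by (rule sum.image_gen[OF F(1)])
  also have "\<dots> = (\<Sum>r\<in>representative ` F. \<Sum>g\<in>?F r. \<Sum>h\<in>?F r.
      c g * cnj (c h) * arc_coeff b (- exponent g - (- exponent h)))"
    by (intro sum.cong refl) auto
  finally show ?thesis by (simp add: toeplitz_def)
qed

lemma toeplitz_increasing:
  assumes b: "0 \<le> b" "b \<le> b'" "b' \<le> 1" and F: "finite F" "F \<subseteq> S"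
  shows "toeplitz b F c \<le> toeplitz b' F c"
proof -
  have "b \<le> 1" "0 \<le> b'" using b by auto
  then show ?thesis
    unfolding toeplitz_cosets[OF b(1) \<open>b \<le> 1\<close> F] toeplitz_cosets[OF \<open>0 \<le> b'\<close> b(3) F]
    by (intro sum_mono toeplitz_mono[OF _ b(1,2)]) (use F in auto)
qed

lemma toeplitz_diagonal:
  assumes F: "finite F"
    and diag: "\<And>g h. g \<in> F \<Longrightarrow> h \<in> F \<Longrightarrow> coord (arc_vector b) (inv g \<otimes> h) = (if g = h then of_real r else 0)"
  shows "toeplitz b F c = r * (\<Sum>g\<in>F. (cmod (c g))\<^sup>2)"
proof -
  have "(\<Sum>h\<in>F. c g * cnj (c h) * coord (arc_vector b) (inv g \<otimes> h)) = of_real (r * (cmod (c g))\<^sup>2)"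
    if g: "g \<in> F" for g
  proof -
    have "(\<Sum>h\<in>F. c g * cnj (c h) * coord (arc_vector b) (inv g \<otimes> h))
        = (\<Sum>h\<in>F. if g = h then of_real r * (c g * cnj (c g)) else 0)"
      by (rule sum.cong) (auto simp: diag[OF g])
    then show ?thesis
      using F g by (simp add: complex_norm_square[symmetric])
  qed
  then have "toeplitz b F c = Re (\<Sum>g\<in>F. of_real (r * (cmod (c g))\<^sup>2))"
    by (simp add: toeplitz_def)
  then show ?thesis by (simp add: sum_distrib_left)
qed

definition residue_class :: "nat \<Rightarrow> int \<Rightarrow> 'a set" where
  "residue_class N j = {g \<in> S. exponent g mod int N = j}"

text \<open>The coefficients of an arc of length \<open>1/N\<close> vanish at the non-zero multiples of \<open>N\<close>.\<close>

lemma arc_vector_unit_fraction_diagonal: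
  assumes N: "0 < N" and g: "g \<in> residue_class N j" and h: "h \<in> residue_class N j"
  shows "coord (arc_vector (1 / real N)) (inv g \<otimes> h) = (if g = h then of_real (1 / real N) else 0)"
proof -
  have S: "g \<in> S" "h \<in> S" using g h by (auto simp: residue_class_def)
  have b: "0 \<le> 1 / real N" "1 / real N \<le> 1" using N by auto
  have "exponent h mod int N = exponent g mod int N" using g h by (simp add: residue_class_def)
  then have "int N dvd exponent h - exponent g" by (simp add: mod_eq_dvd_iff)
  then obtain m where m: "exponent h - exponent g = int N * m" by blast
  have "arc_coeff (1 / real N) (exponent h - exponent g) = (if exponent g = exponent h then of_real (1 / real N) else 0)"
    unfolding m arc_coeff_unit_fraction[OF N] using m N by auto
  then show ?thesis
    unfolding coord_arc_vector_quotient[OF b S] using exponent_inj[OF S] by auto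
qed

lemma toeplitz_full_arc:
  assumes F: "finite F" "F \<subseteq> S"
  shows "toeplitz 1 F c = (\<Sum>g\<in>F. (cmod (c g))\<^sup>2)"
proof -
  have "coord (arc_vector 1) (inv g \<otimes> h) = (if g = h then of_real 1 else 0)" if "g \<in> F" "h \<in> F" for g h
  proof -
    have "g \<in> residue_class 1 0" "h \<in> residue_class 1 0"
      using that F by (auto simp: residue_class_def)
    from arc_vector_unit_fraction_diagonal[OF _ this] show ?thesis by simp
  qed
  then show ?thesis
    using toeplitz_diagonal[OF F(1), of 1 1 c] by simp
qed

lemma arc_translates_upper:
  assumes b: "0 < b" "b \<le> 1" and F: "finite F" "F \<subseteq> S"
  shows "(norm (\<Sum>g\<in>F. scaleC (c g) (left_tr g (arc_vector b))))\<^sup>2 \<le> (\<Sum>g\<in>F. (cmod (c g))\<^sup>2)"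
  unfolding norm_arc_translates[OF b F] toeplitz_full_arc[OF F, symmetric]
  by (rule toeplitz_increasing) (use b F in auto)

text \<open>An arc of length \<open>b \<ge> 1/N\<close> contains one of length \<open>1/N\<close>, for which the translates along a residue
  class are orthogonal.\<close>

lemma arc_translates_lower:
  assumes N: "0 < N" and b: "1 / real N \<le> b" "b \<le> 1" and F: "finite F" "F \<subseteq> residue_class N j"
  shows "(1 / real N) * (\<Sum>g\<in>F. (cmod (c g))\<^sup>2)
    \<le> (norm (\<Sum>g\<in>F. scaleC (c g) (left_tr g (arc_vector b))))\<^sup>2"
proof -
  have FS: "F \<subseteq> S" using F(2) by (auto simp: residue_class_def)
  have "0 < 1 / real N" using N by simp
  then have b0: "0 < b" using b(1) by linarith
  have "toeplitz (1 / real N) F c = (1 / real N) * (\<Sum>g\<in>F. (cmod (c g))\<^sup>2)"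
    by (rule toeplitz_diagonal[OF F(1)]) (rule arc_vector_unit_fraction_diagonal[OF N], use F(2) in auto)
  moreover have "toeplitz (1 / real N) F c \<le> toeplitz b F c"
    by (rule toeplitz_increasing) (use b F FS in auto)
  ultimately show ?thesis
    unfolding norm_arc_translates[OF b0 b(2) F(1) FS] by simp
qed

text \<open>Convolution \<open>q\<close> by the arc vector satisfies \<open>q\<^sup>* q = q\<close>: this is what the Gram matrix of the
  translates says.\<close>

lemma arc_projection:
  assumes b: "0 < b" "b \<le> 1"
  shows "\<exists>q\<in>right_algebra. q \<delta> = arc_vector b \<and> self_adjoint_idempotent q"
proof -
  have b0: "0 \<le> b" using b by simp
  obtain q where q: "q \<in> right_algebra" and q\<delta>: "q \<delta> = arc_vector b"
    using right_algebra_of_vector[of "arc_vector b" 1] cut_arc_vector[OF b0 b(2)]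
      arc_translates_upper[OF b] by auto
  note bq = right_algebraD(1)[OF q]
  obtain q' where a: "adj q q'"
    using adjoint_exists[OF right_algebraD(1,2)[OF q] ] by blast
  have q': "q' \<in> right_algebra" by (rule right_algebra_adj[OF q a])
  have "inner (q' (q (single g c))) (single h d) = inner (q (single g c)) (single h d)" for g c h d
  proof (cases "g \<in> S \<and> h \<in> S")
    case True
    then have gh: "g \<in> S" "h \<in> S" by auto
    have "inner (q' (q (single g c))) (single h d) = inner (q (single g c)) (q (single h d))"
      by (rule adjD[OF adj_sym[OF a] ])
    also have "\<dots> = inner (scaleC (cnj d * c) (left_tr g (arc_vector b))) (left_tr h (arc_vector b))"
      unfolding right_algebra_single[OF q gh(1)] right_algebra_single[OF q gh(2)] q\<delta>
      using inner_scaleC[of "cnj d" "scaleC c (left_tr g (arc_vector b))" "left_tr h (arc_vector b)"]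
      by (simp add: scaleC_scaleC)
    also have "\<dots> = inner (q (single g c)) (single h d)"
      unfolding arc_vector_gram[OF b gh] right_algebra_single[OF q gh(1)] q\<delta>
      using gh by (simp add: coord_left_tr inner_complex_def algebra_simps)
    finally show ?thesis .
  next
    case False
    have "q 0 = 0" "q' 0 = 0"
      using linear_simps(3) bq right_algebraD(1)[OF q'] by blast+
    moreover have "coord (q f) h = 0" "coord (q' f) h = 0" if "h \<notin> S" for f
      using arg_cong[OF right_algebraD(5)[OF q, of f], of "\<lambda>f. coord f h"]
        arg_cong[OF right_algebraD(5)[OF q', of f], of "\<lambda>f. coord f h"] that
      by (simp_all add: coord_cut)
    moreover have "q (single g c) = 0" if "g \<notin> S"
      by (rule right_algebra_single_outside[OF q that])
    ultimately show ?thesis using False by auto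
  qed
  then have "q' (q (single g c)) = q (single g c)" for g c
    by (rule ell2_eq_inner_singleI)
  then have q'q: "q' (q f) = q f" for f
    by (rule eq_on_singles[OF bounded_linear_compose[OF right_algebraD(1)[OF q'] bq] bq])
  have "adj q q"
    using adj_comp[OF adj_sym[OF a] a] by (simp add: q'q)
  moreover have "q (q f) = q f" for f
    using adj_unique[OF a \<open>adj q q\<close>] q'q by metis
  ultimately show ?thesis
    using q q\<delta> by (auto simp: self_adjoint_idempotent_def)
qed

lemma inner_arc_vector_delta: "0 < b \<Longrightarrow> b \<le> 1 \<Longrightarrow> inner (arc_vector b) \<delta> = b"
  using coord_arc_vector_pow[of b 0] by (simp add: \<delta>_def pow_zero inner_complex_def)

end

section \<open>Conjugates in free groups\<close>

text \<open>Reducedness as a condition on successive letters splits along concatenations, which is how words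
  are multiplied below.\<close>

abbreviation cancels :: "'a \<times> bool \<Rightarrow> 'a \<times> bool \<Rightarrow> bool" where
  "cancels l m \<equiv> fst l = fst m \<and> snd l \<noteq> snd m"

lemma reduced_words_iff:
  "w \<in> reduced_words X \<longleftrightarrow> set w \<subseteq> X \<times> UNIV \<and> successively (\<lambda>l m. \<not> cancels l m) w"
  unfolding reduced_words_def successively_conv_nth by (auto simp: in_lists_conv_set)

locale free_group =
  fixes G :: "('a, 'b) monoid_scheme" (structure) and X :: "'a set"
  assumes free: "free_group_on G X"
begin

sublocale group G
  using free by (simp add: free_group_on_def)

lemma generators_closed: "X \<subseteq> carrier G"
  using free by (simp add: free_group_on_def)

abbreviation letter :: "'a \<times> bool \<Rightarrow> 'a" where
  "letter l \<equiv> if snd l then fst l else inv (fst l)"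

lemma letter_closed: "l \<in> X \<times> UNIV \<Longrightarrow> letter l \<in> carrier G"
  using generators_closed by auto

lemma word_value_Nil [simp]: "word_value G [] = \<one>"
  by (simp add: word_value_def)

lemma word_value_Cons [simp]: "word_value G (l # w) = letter l \<otimes> word_value G w"
  by (simp add: word_value_def split_beta)

lemma word_value_closed: "set w \<subseteq> X \<times> UNIV \<Longrightarrow> word_value G w \<in> carrier G"
  using letter_closed by (induction w) auto

lemma word_value_append:
  "set v \<subseteq> X \<times> UNIV \<Longrightarrow> set w \<subseteq> X \<times> UNIV \<Longrightarrow> word_value G (v @ w) = word_value G v \<otimes> word_value G w"
proof (induction v)
  case (Cons l v)
  then show ?case
    using letter_closed[of l] word_value_closed[of v] word_value_closed[of w]
    by (simp add: m_assoc del: split_paired_All)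
qed (simp add: word_value_closed)

lemma letter_cancels:
  assumes "l \<in> X \<times> UNIV" "cancels l m"
  shows "letter l \<otimes> letter m = \<one>"
proof -
  have "fst l \<in> carrier G" using assms(1) generators_closed by auto
  then show ?thesis using assms(2) by auto
qed

lemma word_value_inj:
  assumes "v \<in> reduced_words X" "w \<in> reduced_words X" "word_value G v = word_value G w"
  shows "v = w"
  using assms free by (auto simp: free_group_on_def bij_betw_def inj_on_def)

lemma reduced_word_exists:
  assumes "g \<in> carrier G"
  shows "\<exists>w. w \<in> reduced_words X \<and> word_value G w = g"
proof -
  have "g \<in> word_value G ` reduced_words X"
    using assms free by (simp add: free_group_on_def bij_betw_def)
  then show ?thesis by blast
qed

text \<open>Multiplication by a word with \<open>n\<close> letters changes only the first \<open>n\<close> letters of a reduced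
  word, or the last ones if it acts from the right.\<close>

lemma left_mult_reduced:
  assumes "set v \<subseteq> X \<times> UNIV" and w: "w \<in> reduced_words X"
  shows "\<exists>u j. length u \<le> length v \<and> j \<le> length v \<and> u @ drop j w \<in> reduced_words X \<and>
    word_value G (u @ drop j w) = word_value G v \<otimes> word_value G w"
  using assms(1)
proof (induction v)
  case Nil
  have "word_value G w \<in> carrier G" using w word_value_closed by (simp add: reduced_words_iff)
  then show ?case using w by (intro exI[of _ "[]"] exI[of _ 0]) simp
next
  case (Cons l v)
  then obtain u j where uj: "length u \<le> length v" "j \<le> length v" "u @ drop j w \<in> reduced_words X"
    "word_value G (u @ drop j w) = word_value G v \<otimes> word_value G w"
    by auto
  let ?z = "u @ drop j w"
  have z: "set ?z \<subseteq> X \<times> UNIV" using uj(3) by (simp only: reduced_words_iff)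
  have l: "l \<in> X \<times> UNIV" and lc: "letter l \<in> carrier G" using Cons.prems letter_closed[of l] by simp_all
  have vc: "word_value G v \<in> carrier G" using Cons.prems word_value_closed by simp
  have wc: "word_value G w \<in> carrier G" using w word_value_closed by (simp add: reduced_words_iff)
  have val: "word_value G (l # ?z) = word_value G (l # v) \<otimes> word_value G w"
    unfolding word_value_Cons uj(4) using lc vc wc by (simp only: m_assoc)
  show ?case
  proof (cases "?z = [] \<or> \<not> cancels l (hd ?z)")
    case True
    then have "l # ?z \<in> reduced_words X"
      using uj(3) l by (cases ?z) (auto simp: reduced_words_iff)
    then show ?thesis
      using uj(1,2) val by (intro exI[of _ "l # u"] exI[of _ j]) simp
  next
    case False
    then obtain m z' where mz: "?z = m # z'" "cancels l m" by (cases ?z) auto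
    have z': "z' \<in> reduced_words X"
      using uj(3) unfolding mz by (cases z') (auto simp: reduced_words_iff)
    have mc: "letter m \<in> carrier G" and z'c: "word_value G z' \<in> carrier G"
      using z mz letter_closed[of m] word_value_closed[of z'] by auto
    have "word_value G (l # ?z) = (letter l \<otimes> letter m) \<otimes> word_value G z'"
      unfolding mz word_value_Cons using lc mc z'c by (simp only: m_assoc)
    then have v': "word_value G z' = word_value G (l # v) \<otimes> word_value G w"
      using letter_cancels[OF l mz(2)] z'c val by simp
    show ?thesis
    proof (cases u)
      case Nil
      then have "z' = drop (Suc j) w"
        using mz(1) by (metis append_Nil drop_Suc list.sel(3) tl_drop)
      then show ?thesis
        using z' v' uj(2) by (intro exI[of _ "[]"] exI[of _ "Suc j"]) simp
    next
      case (Cons m' u')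
      then have "z' = u' @ drop j w" using mz(1) by simp
      then show ?thesis
        using z' v' uj(1,2) Cons by (intro exI[of _ u'] exI[of _ j]) simp
    qed
  qed
qed

lemma right_mult_reduced:
  assumes "set v \<subseteq> X \<times> UNIV" and w: "w \<in> reduced_words X"
  shows "\<exists>u j. length u \<le> length v \<and> j \<le> length v \<and> take (length w - j) w @ u \<in> reduced_words X \<and>
    word_value G (take (length w - j) w @ u) = word_value G w \<otimes> word_value G v"
  using assms(1)
proof (induction v rule: rev_induct)
  case Nil
  have "word_value G w \<in> carrier G" using w word_value_closed by (simp add: reduced_words_iff)
  then show ?case using w by (intro exI[of _ "[]"] exI[of _ 0]) simp
next
  case (snoc l v)
  then obtain u j where uj: "length u \<le> length v" "j \<le> length v"
    "take (length w - j) w @ u \<in> reduced_words X"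
    "word_value G (take (length w - j) w @ u) = word_value G w \<otimes> word_value G v"
    by auto
  let ?z = "take (length w - j) w @ u"
  have z: "set ?z \<subseteq> X \<times> UNIV" using uj(3) by (simp only: reduced_words_iff)
  have l: "l \<in> X \<times> UNIV" and lc: "letter l \<in> carrier G" and v: "set v \<subseteq> X \<times> UNIV"
    using snoc.prems letter_closed[of l] by simp_all
  have vc: "word_value G v \<in> carrier G" using v word_value_closed by simp
  have wc: "word_value G w \<in> carrier G" using w word_value_closed by (simp add: reduced_words_iff)
  have single: "word_value G [l] = letter l" using lc by simp
  have val: "word_value G (?z @ [l]) = word_value G w \<otimes> word_value G (v @ [l])"
    using word_value_append[OF z, of "[l]"] word_value_append[OF v, of "[l]"] l lc vc wc uj(4)
    by (simp only: single m_assoc) (simp add: m_assoc)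
  show ?case
  proof (cases "?z = [] \<or> \<not> cancels (last ?z) l")
    case True
    have zr: "successively (\<lambda>l m. \<not> cancels l m) ?z" using uj(3) by (simp only: reduced_words_iff)
    have "set (?z @ [l]) \<subseteq> X \<times> UNIV" using z l by auto
    moreover have "successively (\<lambda>l m. \<not> cancels l m) (?z @ [l])"
      unfolding successively_append_iff[of _ ?z] using zr True by simp
    ultimately have "?z @ [l] \<in> reduced_words X"
      by (simp only: reduced_words_iff simp_thms)
    then show ?thesis
      using uj(1,2) val by (intro exI[of _ "u @ [l]"] exI[of _ j]) simp
  next
    case False
    then have ne: "?z \<noteq> []" by blast
    define m z' where "m = last ?z" and "z' = butlast ?z"
    have mz: "?z = z' @ [m]" using ne by (simp add: m_def z'_def)
    have c: "cancels m l" using False by (simp add: m_def)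
    have z': "z' \<in> reduced_words X"
      using uj(3) unfolding mz by (auto simp: reduced_words_iff successively_append_iff)
    have zs: "set z' \<subseteq> X \<times> UNIV" and ml: "m \<in> X \<times> UNIV" using z unfolding mz by auto
    have mc: "letter m \<in> carrier G" and z'c: "word_value G z' \<in> carrier G"
      using ml zs letter_closed[of m] word_value_closed[of z'] by auto
    have "word_value G (?z @ [l]) = word_value G z' \<otimes> (letter m \<otimes> letter l)"
      using word_value_append[OF zs, of "[m, l]"] ml l lc mc unfolding mz by simp
    then have v': "word_value G z' = word_value G w \<otimes> word_value G (v @ [l])"
      using letter_cancels[OF ml c] z'c val by simp
    show ?thesis
    proof (cases "u = []")
      case True
      then have "z' = take (length w - Suc j) w"
        by (simp add: z'_def butlast_take)
      then show ?thesis
        using z' v' uj(2) by (intro exI[of _ "[]"] exI[of _ "Suc j"]) simp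
    next
      case False
      then have "z' = take (length w - j) w @ butlast u" by (simp add: z'_def butlast_append)
      then show ?thesis
        using z' v' uj(1,2) by (intro exI[of _ "butlast u"] exI[of _ j]) simp
    qed
  qed
qed

lemma nat_pow_generator:
  assumes "x \<in> X"
  shows "word_value G (replicate n (x, True)) = x [^] n"
proof (induction n)
  case (Suc n)
  have "x \<in> carrier G" using assms generators_closed by blast
  then show ?case by (simp only: replicate_Suc word_value_Cons Suc.IH nat_pow_Suc2) simp
qed simp

lemma replicate_reduced: "x \<in> X \<Longrightarrow> replicate n (x, b) \<in> reduced_words X"
  by (auto simp: reduced_words_iff successively_conv_nth)

lemma int_pow_generator_inj:
  assumes x: "x \<in> X"
  shows "x [^] (i::int) = x [^] (j::int) \<longleftrightarrow> i = j"
proof -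
  have xc: "x \<in> carrier G" using x generators_closed by blast
  have pos: "x [^] (n::nat) \<noteq> \<one>" if "n > 0" for n
  proof
    assume "x [^] n = \<one>"
    then have "replicate n (x, True) = []"
      using word_value_inj[OF replicate_reduced[OF x] replicate_reduced[OF x], of n True 0 True]
      by (simp add: nat_pow_generator[OF x])
    then show False using that by simp
  qed
  have "i \<le> j \<Longrightarrow> x [^] i = x [^] j \<Longrightarrow> i = j" for i j :: int
  proof (rule ccontr)
    assume "i \<le> j" "x [^] i = x [^] j" "i \<noteq> j"
    have "x [^] (j - i) = \<one>"
      using \<open>x [^] i = x [^] j\<close> xc by (simp add: int_pow_diff)
    moreover have "x [^] (j - i) = x [^] nat (j - i)"
      using \<open>i \<le> j\<close> by (metis diff_ge_0_iff_ge int_nat_eq int_pow_int)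
    ultimately have "x [^] nat (j - i) = \<one>" by metis
    moreover have "0 < nat (j - i)" using \<open>i \<le> j\<close> \<open>i \<noteq> j\<close> by simp
    ultimately show False using pos by blast
  qed
  from this[of i j] this[of j i] show ?thesis by (cases "i \<le> j") auto
qed

text \<open>The reduced words of \<open>h g\<close> and \<open>g h'\<close> differ from that of \<open>g = a\<^sup>m b\<^sup>m\<close> only near their left
  and right ends, respectively. If they are equal, then the switch from \<open>a\<close> to \<open>b\<close> in the middle has
  not moved, and \<open>h g = g\<close>.\<close>

lemma conjugator_unique:
  assumes a: "a \<in> X" and b: "b \<in> X" and ab: "a \<noteq> b"
    and v: "v \<in> reduced_words X" "length v \<le> n" and v': "v' \<in> reduced_words X" "length v' \<le> n"
    and m: "2 * n < m"
    and eq: "word_value G v \<otimes> (a [^] m \<otimes> b [^] m) = (a [^] m \<otimes> b [^] m) \<otimes> word_value G v'"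
  shows "word_value G v = \<one>"
proof -
  define w where "w = replicate m (a, True) @ replicate m (b, True)"
  have len: "length w = 2 * m" by (simp add: w_def)
  have wset: "set w \<subseteq> X \<times> UNIV" using a b by (auto simp: w_def)
  have wr: "w \<in> reduced_words X"
    using replicate_reduced[OF a, of m True] replicate_reduced[OF b, of m True] ab m
    unfolding w_def reduced_words_iff successively_append_iff by simp
  have val: "word_value G w = a [^] m \<otimes> b [^] m"
    unfolding w_def nat_pow_generator[OF a, symmetric] nat_pow_generator[OF b, symmetric]
    by (rule word_value_append) (use a b in auto)
  have nth: "w ! k = (if k < m then (a, True) else (b, True))" if "k < 2 * m" for k
    using that by (simp add: w_def nth_append)
  have vs: "set v \<subseteq> X \<times> UNIV" "set v' \<subseteq> X \<times> UNIV" using v(1) v'(1) by (simp_all add: reduced_words_iff)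
  obtain u j where u: "length u \<le> length v" "j \<le> length v" "u @ drop j w \<in> reduced_words X"
      "word_value G (u @ drop j w) = word_value G v \<otimes> word_value G w"
    using left_mult_reduced[OF vs(1) wr] by blast
  obtain u' i where u': "length u' \<le> length v'" "i \<le> length v'" "take (2 * m - i) w @ u' \<in> reduced_words X"
      "word_value G (take (2 * m - i) w @ u') = word_value G w \<otimes> word_value G v'"
    using right_mult_reduced[OF vs(2) wr] unfolding len by blast
  have words: "u @ drop j w = take (2 * m - i) w @ u'"
    by (rule word_value_inj[OF u(3) u'(3)]) (simp only: u(4) u'(4) val eq)
  have j: "j < m" and i: "i \<le> n" using u(2) v(2) m u'(2) v'(2) by linarith+
  have left: "(u @ drop j w) ! (length u + k) = w ! (j + k)" for k
    using j by (simp add: nth_append len)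
  have right: "(take (2 * m - i) w @ u') ! k = w ! k" if "k < 2 * m - i" for k
    using that by (simp add: nth_append len)
  let ?p = "length u + (m - j)"
  have p: "?p < 2 * m - i" "0 < ?p" using u(1) v(2) m i j by linarith+
  have shift: "w ! (length u + k) = w ! (j + k)" if "length u + k < 2 * m - i" for k
    using left[of k] right[OF that] by (simp only: words)
  have "w ! ?p = w ! m"
    using shift[of "m - j"] p j by simp
  moreover have "w ! (?p - 1) = w ! (m - 1)"
    using shift[of "m - j - 1"] p j by simp
  moreover have "w ! m = (b, True)" "w ! (m - 1) = (a, True)"
    using nth[of m] nth[of "m - 1"] m by simp_all
  ultimately have "w ! ?p = (b, True)" "w ! (?p - 1) = (a, True)" by simp_all
  moreover have "w ! k = (b, True) \<Longrightarrow> \<not> k < m" "w ! k = (a, True) \<Longrightarrow> k < m" if "k < 2 * m" for k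
    using nth[OF that] ab by (auto split: if_splits)
  moreover have "?p < 2 * m" "?p - 1 < 2 * m" using p by linarith+
  ultimately have "\<not> ?p < m" "?p - 1 < m" by blast+
  then have "?p = m" by linarith
  then have uj: "length u = j" using j by linarith
  have "u = take j (take (2 * m - i) w @ u')"
    by (simp flip: words add: uj)
  also have "\<dots> = take j w"
    using j i m by (simp add: len)
  finally have "u @ drop j w = w" by simp
  then have "word_value G v \<otimes> word_value G w = word_value G w" using u(4) by simp
  then show ?thesis
    using word_value_closed[OF wset] word_value_closed[OF vs(1)] by (simp add: r_cancel_one)
qed

theorem conjugate_disjoint:
  assumes gens: "\<exists>a\<in>X. \<exists>b\<in>X. a \<noteq> b" and F: "finite F" "F \<subseteq> carrier G" "\<one> \<notin> F"
  shows "\<exists>g\<in>carrier G. \<forall>h\<in>F. inv g \<otimes> h \<otimes> g \<notin> F"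
proof -
  obtain a b where ab: "a \<in> X" "b \<in> X" "a \<noteq> b" using gens by blast
  have "\<forall>h\<in>F. \<exists>w. w \<in> reduced_words X \<and> word_value G w = h"
    using reduced_word_exists F(2) by blast
  from bchoice[OF this] obtain W where W: "\<And>h. h \<in> F \<Longrightarrow> W h \<in> reduced_words X \<and> word_value G (W h) = h"
    by blast
  define n where "n = (\<Sum>h\<in>F. length (W h))"
  have n: "length (W h) \<le> n" if "h \<in> F" for h
    unfolding n_def using F(1) that by (intro member_le_sum) auto
  define m where "m = Suc (2 * n)"
  define g where "g = a [^] m \<otimes> b [^] m"
  have g: "g \<in> carrier G" using ab generators_closed by (auto simp: g_def)
  have "inv g \<otimes> h \<otimes> g \<notin> F" if h: "h \<in> F" for h
  proof
    let ?h' = "inv g \<otimes> h \<otimes> g"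
    assume h': "?h' \<in> F"
    have hc: "h \<in> carrier G" using h F(2) by blast
    have "g \<otimes> ?h' = h \<otimes> g" using g hc by (simp add: m_assoc[symmetric])
    then have "word_value G (W h) = \<one>"
      using conjugator_unique[OF ab, of "W h" n "W ?h'" m] W[OF h] W[OF h'] n[OF h] n[OF h']
      by (simp add: m_def g_def)
    then show False using W[OF h] h F(3) by simp
  qed
  then show ?thesis using g by blast
qed

end

section \<open>Operators on functions that vanish off the group\<close>

lemma coord_Abs_l2:
  assumes "f \<in> l2 A"
  shows "coord (Abs_ell2 f) = f"
proof -
  have "(\<lambda>x. (cmod (f x))\<^sup>2) summable_on UNIV"
    by (rule summable_on_cong_neutral[THEN iffD1, rotated -1, of _ A]) (use assms in \<open>auto simp: l2_def\<close>)
  then show ?thesis by (simp add: Abs_ell2_inverse)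
qed

lemma cinner_single: "cinner f (single x 1) = coord f x"
  by (simp add: cinner_def scaleC_single complex_eq_iff inner_complex_def)

lemma has_sum_cinner: "((\<lambda>x. coord f x * cnj (coord g x)) has_sum cinner f g) UNIV"
proof -
  have "((\<lambda>x. complex_of_real (inner (coord f x) (coord g x)) + \<i> * complex_of_real (inner (coord f x) (coord (scaleC \<i> g) x)))
      has_sum (complex_of_real (inner f g) + \<i> * complex_of_real (inner f (scaleC \<i> g)))) UNIV"
    by (intro has_sum_add has_sum_cmult_right has_sum_of_real inner_has_sum)
  moreover have "complex_of_real (inner z w) + \<i> * complex_of_real (inner z (\<i> * w)) = z * cnj w" for z w
    by (simp add: complex_eq_iff inner_complex_def)
  ultimately show ?thesis by (simp add: cinner_def Complex_eq)
qed

context group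
begin

definition embed :: "('a \<Rightarrow> complex) \<Rightarrow> 'a ell2" where
  "embed f = Abs_ell2 f"

lemma coord_embed: "f \<in> l2 S \<Longrightarrow> coord (embed f) = f"
  unfolding embed_def by (rule coord_Abs_l2)

lemma embed_coord: "embed (coord F) = F"
  by (simp add: embed_def coord_inverse)

lemma cut_embed: "f \<in> l2 S \<Longrightarrow> cut (embed f) = embed f"
  by (rule ell2_eqI) (simp add: coord_cut coord_embed l2_def)

lemma coord_zero_outside: "cut F = F \<Longrightarrow> x \<notin> S \<Longrightarrow> coord F x = 0"
  using coord_cut[of F x] by simp

lemma coord_in_l2:
  assumes "cut F = F"
  shows "coord F \<in> l2 S"
proof -
  have "(\<lambda>x. (cmod (coord F x))\<^sup>2) summable_on S"
    by (rule summable_on_subset[OF square_summable]) simp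
  then show ?thesis
    using coord_zero_outside[OF assms] by (simp add: l2_def)
qed

lemma l2_norm_coord:
  assumes "cut F = F"
  shows "l2_norm S (coord F) = norm F"
proof -
  have "((\<lambda>x. (cmod (coord F x))\<^sup>2) has_sum (norm F)\<^sup>2) S"
    by (rule has_sum_cong_neutral[THEN iffD1, rotated -1, OF norm_has_sum])
      (auto simp: coord_zero_outside[OF assms])
  then show ?thesis by (simp add: l2_norm_def infsumI)
qed

lemma l2_inner_coord:
  assumes "cut F = F"
  shows "l2_inner S (coord F) (coord H) = cinner F H"
proof -
  have "((\<lambda>x. coord F x * cnj (coord H x)) has_sum cinner F H) S"
    by (rule has_sum_cong_neutral[THEN iffD1, rotated -1, OF has_sum_cinner])
      (auto simp: coord_zero_outside[OF assms])
  then show ?thesis by (simp add: l2_inner_def infsumI)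
qed

lemma l2_norm_embed: "f \<in> l2 S \<Longrightarrow> l2_norm S f = norm (embed f)"
  using l2_norm_coord[OF cut_embed] by (simp add: coord_embed)

lemma left_regular_coord:
  assumes "g \<in> S" "cut F = F"
  shows "left_regular G g (coord F) = coord (left_tr g F)"
  using coord_in_l2[OF assms(2)] by (simp add: left_regular_def coord_left_tr[OF assms(1)] fun_eq_iff)

lemma embed_combination:
  assumes "f \<in> l2 S" "h \<in> l2 S"
  shows "(\<lambda>x. c * f x + d * h x) \<in> l2 S \<and>
    embed (\<lambda>x. c * f x + d * h x) = scaleC c (embed f) + scaleC d (embed h)"
proof -
  let ?H = "scaleC c (embed f) + scaleC d (embed h)"
  have coord: "coord ?H = (\<lambda>x. c * f x + d * h x)"
    by (simp add: fun_eq_iff coord_embed[OF assms(1)] coord_embed[OF assms(2)])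
  have "cut ?H = ?H"
    by (rule ell2_eqI) (use assms in \<open>auto simp: coord_cut coord_embed l2_def\<close>)
  then have "coord ?H \<in> l2 S" by (rule coord_in_l2)
  moreover have "embed (coord ?H) = ?H" by (rule embed_coord)
  ultimately show ?thesis by (simp only: coord simp_thms)
qed

text \<open>Back from the type \<open>ell2\<close> to extensional operators on \<open>l2 S\<close>.\<close>

definition to_l2 :: "('a ell2 \<Rightarrow> 'a ell2) \<Rightarrow> 'a l2_op" where
  "to_l2 T = (\<lambda>f\<in>l2 S. coord (T (embed f)))"

lemma to_l2_coord: "cut F = F \<Longrightarrow> to_l2 T (coord F) = coord (T F)"
  by (simp add: to_l2_def coord_in_l2 embed_coord)

lemma to_l2_bounded:
  assumes T: "bounded_linear T" and cplx: "\<And>c f. T (scaleC c f) = scaleC c (T f)" and cut: "\<And>f. cut (T f) = T f"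
  shows "to_l2 T \<in> bounded_ops S"
proof -
  interpret bounded_linear T by fact
  obtain K where K: "\<And>f. norm (T f) \<le> norm f * K" using bounded by blast
  have ext: "to_l2 T \<in> l2 S \<rightarrow>\<^sub>E l2 S"
    by (auto simp: to_l2_def intro: coord_in_l2 cut)
  moreover have "to_l2 T (\<lambda>x. c * f x + d * h x) = (\<lambda>x. c * to_l2 T f x + d * to_l2 T h x)"
    if "f \<in> l2 S" "h \<in> l2 S" for f h c d
    using embed_combination[OF that, of c d] that by (simp add: to_l2_def add cplx fun_eq_iff)
  moreover have "l2_norm S (to_l2 T f) \<le> K * l2_norm S f" if "f \<in> l2 S" for f
    using K[of "embed f"] that by (simp add: to_l2_def l2_norm_coord[OF cut] l2_norm_embed mult.commute)
  ultimately show ?thesis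
    unfolding bounded_ops_def by blast
qed

lemma left_regular_to_l2: "g \<in> S \<Longrightarrow> left_regular G g = to_l2 (left_tr g)"
  by (rule ext) (auto simp: left_regular_def to_l2_def coord_left_tr coord_embed restrict_def fun_eq_iff)

lemma left_regular_bounded: "g \<in> S \<Longrightarrow> left_regular G g \<in> bounded_ops S"
  unfolding left_regular_to_l2 by (rule to_l2_bounded) (simp_all add: bounded_left_tr left_tr_scaleC cut_left_tr)

end

section \<open>Double commutants\<close>

lemma commutant_antimono: "A \<subseteq> B \<Longrightarrow> commutant R B \<subseteq> commutant R A"
  by (auto simp: commutant_def)

lemma subset_double_commutant: "A \<subseteq> bounded_ops R \<Longrightarrow> A \<subseteq> commutant R (commutant R A)"
  by (auto simp: commutant_def)

lemma commutant_bounded: "commutant R A \<subseteq> bounded_ops R"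
  by (auto simp: commutant_def)

lemma triple_commutant: "A \<subseteq> bounded_ops R \<Longrightarrow> commutant R (commutant R (commutant R A)) = commutant R A"
  by (rule subset_antisym[OF commutant_antimono[OF subset_double_commutant] subset_double_commutant[OF commutant_bounded] ])

context group
begin

lemma bounded_ops_closed: "T \<in> bounded_ops S \<Longrightarrow> f \<in> l2 S \<Longrightarrow> T f \<in> l2 S"
  by (auto simp: bounded_ops_def)

lemma l2_inner_eqI:
  assumes "f \<in> l2 S" "h \<in> l2 S" "\<And>k. k \<in> l2 S \<Longrightarrow> l2_inner S k f = l2_inner S k h"
  shows "f = h"
proof
  fix x
  show "f x = h x"
  proof (cases "x \<in> S")
    case True
    have d: "delta x \<in> l2 S" by (rule delta_in_l2[OF True])
    have "l2_inner S (delta x) k = cnj (k x)" for k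
    proof -
      have "((\<lambda>y. delta x y * cnj (k y)) has_sum cnj (k x)) S"
        by (rule has_sum_finite_neutralI[of "{x}"]) (use True in \<open>auto simp: delta_def\<close>)
      then show ?thesis by (simp add: l2_inner_def infsumI)
    qed
    then show ?thesis using assms(3)[OF d] by simp
  next
    case False
    then show ?thesis using assms(1,2) by (simp add: l2_def)
  qed
qed

text \<open>The commutant of a self-adjoint operator is a von Neumann algebra. Hence an operator that
  commutes with the left translations commutes with everything that they generate.\<close>

lemma self_adjoint_commutant_vN:
  assumes p: "p \<in> bounded_ops S" and sa: "adjoint_ops S p p"
  shows "von_neumann_algebra S (commutant S {p})"
proof -
  have "U \<in> commutant S {p}"
    if T: "T \<in> commutant S {p}" and U: "U \<in> bounded_ops S" and TU: "adjoint_ops S T U" for T U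
  proof -
    have "U (p f) = p (U f)" if f: "f \<in> l2 S" for f
    proof (rule l2_inner_eqI)
      have Tb: "T \<in> bounded_ops S" and Tp: "\<And>f. f \<in> l2 S \<Longrightarrow> T (p f) = p (T f)"
        using T by (auto simp: commutant_def)
      note closed = bounded_ops_closed[OF p] bounded_ops_closed[OF U] bounded_ops_closed[OF Tb]
      show "U (p f) \<in> l2 S" "p (U f) \<in> l2 S" using f by (auto intro: closed)
      fix k assume k: "k \<in> l2 S"
      have "l2_inner S k (U (p f)) = l2_inner S (T k) (p f)"
        using TU k f closed by (simp add: adjoint_ops_def)
      also have "\<dots> = l2_inner S (p (T k)) f"
        using sa k f closed by (simp add: adjoint_ops_def)
      also have "\<dots> = l2_inner S (T (p k)) f"
        using Tp[OF k] by simp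
      also have "\<dots> = l2_inner S k (p (U f))"
        using TU sa k f closed by (simp add: adjoint_ops_def)
      finally show "l2_inner S k (U (p f)) = l2_inner S k (p (U f))" .
    qed
    then show ?thesis using U by (auto simp: commutant_def)
  qed
  moreover have "commutant S (commutant S (commutant S {p})) = commutant S {p}"
    by (rule triple_commutant) (use p in simp)
  ultimately show ?thesis
    unfolding von_neumann_algebra_def using commutant_bounded by blast
qed

lemma group_vN_commutantI:
  assumes p: "p \<in> bounded_ops S" and sa: "adjoint_ops S p p"
    and comm: "\<And>g f. g \<in> S \<Longrightarrow> f \<in> l2 S \<Longrightarrow> p (left_regular G g f) = left_regular G g (p f)"
  shows "p \<in> group_vN_commutant G"
proof -
  have "left_regular G ` S \<subseteq> commutant S {p}"
    using left_regular_bounded comm by (auto simp: commutant_def)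
  then have "group_vN G \<subseteq> commutant S {p}"
    using self_adjoint_commutant_vN[OF p sa] unfolding group_vN_def generated_von_neumann_algebra_def by blast
  then show ?thesis
    using p by (auto simp: group_vN_commutant_def commutant_def)
qed

lemma group_vN_commutantD:
  assumes "p \<in> group_vN_commutant G"
  shows "p \<in> bounded_ops S" "\<And>g f. g \<in> S \<Longrightarrow> f \<in> l2 S \<Longrightarrow> p (left_regular G g f) = left_regular G g (p f)"
proof -
  have "left_regular G g \<in> group_vN G" if "g \<in> S" for g
    using that by (auto simp: group_vN_def generated_von_neumann_algebra_def)
  then show "p \<in> bounded_ops S" "\<And>g f. g \<in> S \<Longrightarrow> f \<in> l2 S \<Longrightarrow> p (left_regular G g f) = left_regular G g (p f)"
    using assms by (auto simp: group_vN_commutant_def commutant_def)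
qed

lemma to_l2_projection:
  assumes T: "T \<in> right_algebra" and sai: "self_adjoint_idempotent T"
  shows "to_l2 T \<in> group_vN_commutant G" "orthogonal_projection S (to_l2 T)"
    "trace_commutant G (to_l2 T) = complex_of_real (inner (T \<delta>) \<delta>)"
proof -
  have adj: "adj T T" and idem: "\<And>f. T (T f) = T f" using sai by (auto simp: self_adjoint_idempotent_def)
  have b: "to_l2 T \<in> bounded_ops S"
    by (rule to_l2_bounded[OF right_algebraD(1,2,5)[OF T] ])
  have sa: "adjoint_ops S (to_l2 T) (to_l2 T)"
    unfolding adjoint_ops_def
  proof (intro ballI)
    fix f h assume fh: "f \<in> l2 S" "h \<in> l2 S"
    have "l2_inner S (to_l2 T f) h = cinner (T (embed f)) (embed h)"
      using l2_inner_coord[OF right_algebraD(5)[OF T], of "embed f" "embed h"] fh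
      by (simp add: to_l2_def coord_embed)
    also have "\<dots> = cinner (embed f) (T (embed h))"
      by (simp add: cinner_def adjD[OF adj] right_algebraD(2)[OF T])
    also have "\<dots> = l2_inner S f (to_l2 T h)"
      using l2_inner_coord[OF cut_embed[OF fh(1)], of "T (embed h)"] fh
      by (simp add: to_l2_def coord_embed)
    finally show "l2_inner S (to_l2 T f) h = l2_inner S f (to_l2 T h)" .
  qed
  have coord: "to_l2 T f = coord (T (embed f))" if "f \<in> l2 S" for f
    using that by (simp add: to_l2_def)
  show "to_l2 T \<in> group_vN_commutant G"
  proof (rule group_vN_commutantI[OF b sa])
    fix g f assume gf: "g \<in> S" "f \<in> l2 S"
    have "to_l2 T (left_regular G g (coord (embed f))) = coord (T (left_tr g (embed f)))"
      by (simp only: left_regular_coord[OF gf(1) cut_embed[OF gf(2)] ] to_l2_coord[OF cut_left_tr[OF gf(1)] ])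
    also have "\<dots> = coord (left_tr g (T (embed f)))"
      by (simp only: right_algebraD(3)[OF T gf(1)])
    also have "\<dots> = left_regular G g (coord (T (embed f)))"
      by (simp only: left_regular_coord[OF gf(1) right_algebraD(5)[OF T] ])
    finally show "to_l2 T (left_regular G g f) = left_regular G g (to_l2 T f)"
      by (simp only: coord[OF gf(2)] coord_embed[OF gf(2)])
  qed
  have "to_l2 T (to_l2 T f) = to_l2 T f" if "f \<in> l2 S" for f
    by (simp only: coord[OF that] to_l2_coord[OF right_algebraD(5)[OF T] ] idem)
  then show "orthogonal_projection S (to_l2 T)"
    using b sa by (simp add: orthogonal_projection_def)
  have \<delta>: "delta \<one> = coord \<delta>" by (simp add: delta_def \<delta>_def fun_eq_iff)
  have cut\<delta>: "cut \<delta> = \<delta>" by (simp add: \<delta>_def cut_single)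
  have "inner (T \<delta>) (scaleC \<i> \<delta>) = inner (T \<delta>) (scaleC \<i> (T \<delta>))"
    using adjD[OF adj, of "T \<delta>" "scaleC \<i> \<delta>"] by (simp add: idem right_algebraD(2)[OF T])
  then have "cinner (T \<delta>) \<delta> = complex_of_real (inner (T \<delta>) \<delta>)"
    by (simp add: cinner_def inner_scaleC_ii_self complex_eq_iff)
  then show "trace_commutant G (to_l2 T) = complex_of_real (inner (T \<delta>) \<delta>)"
    by (simp only: trace_commutant_def \<delta> to_l2_coord[OF cut\<delta>] l2_inner_coord[OF right_algebraD(5)[OF T] ])
qed

text \<open>The extension by zero off the group of a projection in the commutant.\<close>

lemma from_l2_projection:
  assumes p: "p \<in> group_vN_commutant G" and proj: "orthogonal_projection S p"
  shows "\<exists>P\<in>right_algebra. self_adjoint_idempotent P \<and> (\<forall>F. cut F = F \<longrightarrow> p (coord F) = coord (P F))"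
proof -
  have b: "p \<in> bounded_ops S" and sa: "adjoint_ops S p p" and idem: "\<And>f. f \<in> l2 S \<Longrightarrow> p (p f) = p f"
    using proj by (auto simp: orthogonal_projection_def)
  note comm = group_vN_commutantD(2)[OF p]
  have cutcut: "cut (cut F) = cut F" for F
    by (rule ell2_eqI) (simp add: coord_cut)
  have l2: "coord (cut F) \<in> l2 S" "p (coord (cut F)) \<in> l2 S" for F
    using coord_in_l2[OF cutcut] bounded_ops_closed[OF b] by blast+
  define P where "P = (\<lambda>F. embed (p (coord (cut F))))"
  have coordP: "coord (P F) = p (coord (cut F))" for F
    by (simp add: P_def coord_embed l2)
  have lin: "p (\<lambda>x. c * f x + d * h x) = (\<lambda>x. c * p f x + d * p h x)" if "f \<in> l2 S" "h \<in> l2 S" for f h c d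
    using b that by (simp add: bounded_ops_def)
  have combine: "P (scaleC c F + scaleC d H) = scaleC c (P F) + scaleC d (P H)" for c d F H
  proof (rule ell2_eqI)
    have "coord (cut (scaleC c F + scaleC d H)) = (\<lambda>x. c * coord (cut F) x + d * coord (cut H) x)"
      by (simp add: fun_eq_iff coord_cut)
    then show "coord (P (scaleC c F + scaleC d H)) x = coord (scaleC c (P F) + scaleC d (P H)) x" for x
      by (simp add: coordP lin l2)
  qed
  obtain C where C: "\<And>f. f \<in> l2 S \<Longrightarrow> l2_norm S (p f) \<le> C * l2_norm S f"
    using b unfolding bounded_ops_def by blast
  have cutP: "cut (P F) = P F" for F
    unfolding P_def by (rule cut_embed) (rule l2)
  have normcut: "norm (cut F) \<le> norm F" for F
    unfolding cut_def by (rule norm_pullback_le) simp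
  have bound: "norm (P F) \<le> norm F * \<bar>C\<bar>" for F
  proof -
    have "norm (P F) \<le> C * norm (cut F)"
      using C[OF l2(1)[of F] ] l2_norm_coord[OF cutP[of F] ] l2_norm_coord[OF cutcut[of F] ] by (simp add: coordP)
    also have "\<dots> \<le> \<bar>C\<bar> * norm F"
      by (intro mult_mono normcut) auto
    finally show ?thesis by (simp add: mult.commute)
  qed
  have "P \<in> right_algebra"
  proof (rule right_algebraI)
    show "bounded_linear P"
    proof (rule bounded_linear_intro[OF _ _ bound])
      show "P (F + H) = P F + P H" for F H
        using combine[of 1 F 1 H] by simp
      show "P (r *\<^sub>R F) = r *\<^sub>R P F" for r F
        using combine[of "of_real r" F 0 0] by (simp add: scaleC_of_real scaleC_of_real[of 0, simplified])
    qed
    show "P (scaleC c F) = scaleC c (P F)" for c F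
      using combine[of c F 0 0] by (simp add: scaleC_of_real[of 0, simplified])
    show "P (left_tr g F) = left_tr g (P F)" if g: "g \<in> S" for g F
    proof -
      have "coord (P (left_tr g F)) = p (coord (left_tr g (cut F)))"
        by (simp only: coordP cut_left_tr[OF g] left_tr_cut[OF g])
      also have "\<dots> = p (left_regular G g (coord (cut F)))"
        by (simp only: left_regular_coord[OF g cutcut])
      also have "\<dots> = left_regular G g (coord (P F))"
        by (simp only: comm[OF g l2(1)] coordP)
      also have "\<dots> = coord (left_tr g (P F))"
        by (rule left_regular_coord[OF g cutP])
      finally show ?thesis by (simp add: coord_inject)
    qed
    show "P (cut F) = P F" for F
      by (simp add: P_def cutcut)
    show "cut (P F) = P F" for F
      by (rule cutP)
  qed
  moreover have "self_adjoint_idempotent P"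
    unfolding self_adjoint_idempotent_def adj_def
  proof (intro conjI allI)
    fix F H
    have "cinner (P F) (cut H) = cinner (cut F) (P H)"
      using sa l2[of F] l2[of H]
        l2_inner_coord[OF cutP[of F], of "cut H"] l2_inner_coord[OF cutcut[of F], of "P H"]
      by (simp add: adjoint_ops_def coordP)
    then have "inner (P F) (cut H) = inner (cut F) (P H)"
      by (simp add: cinner_def)
    then show "inner (P F) H = inner F (P H)"
      using adjD[OF adj_cut, of "P F" H] adjD[OF adj_cut, of F "P H"] by (simp add: cutP)
    show "P (P F) = P F"
      by (rule ell2_eqI) (simp add: coordP cutP idem l2)
  qed
  moreover have "p (coord F) = coord (P F)" if "cut F = F" for F
    using that by (simp add: coordP)
  ultimately show ?thesis by blast
qed

end

section \<open>Orbits that are finite unions of Riesz sequences\<close>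

lemma lin_comb_cong: "(\<And>i. i \<in> F \<Longrightarrow> v i = w i) \<Longrightarrow> lin_comb F c v = lin_comb F c w"
  by (simp add: lin_comb_def)

lemma riesz_sequence_cong:
  assumes "riesz_sequence R I v" "\<And>i. i \<in> I \<Longrightarrow> v i = w i"
  shows "riesz_sequence R I w"
proof -
  have "lin_comb F c w = lin_comb F c v" if "F \<subseteq> I" for F c
    by (rule lin_comb_cong) (use assms(2) that in auto)
  moreover have "w \<in> I \<rightarrow> l2 R"
    using assms by (auto simp: riesz_sequence_def Pi_iff)
  ultimately show ?thesis
    using assms(1) unfolding riesz_sequence_def by metis
qed

lemma finite_union_riesz_cong:
  assumes "finite_union_of_riesz_sequences R J v" "\<And>i. i \<in> J \<Longrightarrow> v i = w i"
  shows "finite_union_of_riesz_sequences R J w"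
proof -
  obtain P where P: "partition_on J P" "finite P" "\<And>I. I \<in> P \<Longrightarrow> riesz_sequence R I v"
    using assms(1) unfolding finite_union_of_riesz_sequences_def by blast
  have "riesz_sequence R I w" if "I \<in> P" for I
    by (rule riesz_sequence_cong[OF P(3)[OF that] ])
      (use assms(2) partition_onD1[OF P(1)] that in blast)
  then show ?thesis
    using P(1,2) unfolding finite_union_of_riesz_sequences_def by blast
qed

lemma finite_union_orthogonal_riesz_cong:
  assumes "finite_union_of_orthogonal_riesz_sequences R J v" "\<And>i. i \<in> J \<Longrightarrow> v i = w i"
  shows "finite_union_of_orthogonal_riesz_sequences R J w"
proof -
  obtain P where P: "partition_on J P" "finite P" "\<And>I. I \<in> P \<Longrightarrow> orthogonal_riesz_sequence R I v"
    using assms(1) unfolding finite_union_of_orthogonal_riesz_sequences_def by blast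
  have "orthogonal_riesz_sequence R I w" if I: "I \<in> P" for I
  proof -
    have eq: "v i = w i" if "i \<in> I" for i
      using assms(2) partition_onD1[OF P(1)] I that by blast
    have "riesz_sequence R I w"
      by (rule riesz_sequence_cong[of R I v]) (use P(3)[OF I] eq in \<open>auto simp: orthogonal_riesz_sequence_def\<close>)
    moreover have "pairwise (\<lambda>i j. l2_inner R (w i) (w j) = 0) I"
      using P(3)[OF I] eq by (simp add: orthogonal_riesz_sequence_def pairwise_def)
    ultimately show ?thesis by (simp add: orthogonal_riesz_sequence_def)
  qed
  then show ?thesis
    using P(1,2) unfolding finite_union_of_orthogonal_riesz_sequences_def by blast
qed

context group
begin

lemma coord_sum_scaleC: "coord (\<Sum>i\<in>F. scaleC (c i) (Y i)) = lin_comb F c (\<lambda>i. coord (Y i))"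
  by (simp add: lin_comb_def fun_eq_iff)

text \<open>Convolution by \<open>\<Psi>\<close> maps the basis vectors to the orbit of \<open>\<Psi>\<close>.\<close>

lemma orthonormal_orbit_isometry:
  assumes cut\<Psi>: "cut \<Psi> = \<Psi>"
    and on: "\<And>g h. g \<in> S \<Longrightarrow> h \<in> S \<Longrightarrow> cinner (left_tr g \<Psi>) (left_tr h \<Psi>) = (if g = h then 1 else 0)"
  shows "\<exists>w w'. w \<in> right_algebra \<and> adj w w' \<and> w \<delta> = \<Psi> \<and> (\<forall>f. w' (w f) = cut f)"
proof -
  have inner: "inner (scaleC z (left_tr g \<Psi>)) (left_tr h \<Psi>) = (if g = h then Re z else 0)"
    if "g \<in> S" "h \<in> S" for g h z
  proof -
    have "inner (scaleC z (left_tr g \<Psi>)) (left_tr h \<Psi>) = inner (left_tr g \<Psi>) (scaleC (cnj z) (left_tr h \<Psi>))"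
      by (rule inner_scaleC)
    also have "\<dots> = inner (cinner (left_tr g \<Psi>) (left_tr h \<Psi>)) (cnj z)"
      by (simp only: inner_cinner)
    finally show ?thesis by (simp add: on[OF that] inner_complex_def)
  qed
  have "(norm (\<Sum>g\<in>F. scaleC (c g) (left_tr g \<Psi>)))\<^sup>2 = (\<Sum>g\<in>F. (cmod (c g))\<^sup>2)"
    if F: "finite F" "F \<subseteq> S" for F c
  proof -
    have "(\<Sum>h\<in>F. inner (scaleC (c g * cnj (c h)) (left_tr g \<Psi>)) (left_tr h \<Psi>)) = (cmod (c g))\<^sup>2"
      if g: "g \<in> F" for g
    proof -
      have "(\<Sum>h\<in>F. inner (scaleC (c g * cnj (c h)) (left_tr g \<Psi>)) (left_tr h \<Psi>))
          = (\<Sum>h\<in>F. if g = h then Re (c g * cnj (c g)) else 0)"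
        by (rule sum.cong) (use F g inner in \<open>auto simp: subset_iff\<close>)
      also have "\<dots> = Re (complex_of_real ((cmod (c g))\<^sup>2))"
        using F g by (simp add: complex_norm_square del: of_real_power)
      finally show ?thesis by simp
    qed
    then show ?thesis by (simp add: norm_sum_scaleC)
  qed
  then obtain w where w: "w \<in> right_algebra" and w\<delta>: "w \<delta> = \<Psi>"
    using right_algebra_of_vector[OF cut\<Psi>, of 1] by auto
  note bw = right_algebraD(1)[OF w]
  obtain w' where a: "adj w w'"
    using adjoint_exists[OF right_algebraD(1,2)[OF w] ] by blast
  have w': "w' \<in> right_algebra" by (rule right_algebra_adj[OF w a])
  have w0: "w' 0 = 0" using linear_simps(3)[OF right_algebraD(1)[OF w'] ] .
  have "inner (w' (w (single g c))) (single h d) = inner (cut (single g c)) (single h d)" for g c h d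
  proof (cases "g \<in> S")
    case g: True
    show ?thesis
    proof (cases "h \<in> S")
      case h: True
      have "inner (w' (w (single g c))) (single h d) = inner (w (single g c)) (w (single h d))"
        by (rule adjD[OF adj_sym[OF a] ])
      also have "\<dots> = inner (scaleC (c * cnj d) (left_tr g \<Psi>)) (left_tr h \<Psi>)"
        unfolding right_algebra_single[OF w g] right_algebra_single[OF w h] w\<delta> by (rule inner_scaleC_scaleC)
      also have "\<dots> = inner (cut (single g c)) (single h d)"
        unfolding inner[OF g h] using g by (simp add: cut_single inner_complex_def)
      finally show ?thesis .
    next
      case False
      then have "coord (w' (w (single g c))) h = 0"
        by (rule coord_zero_outside[OF right_algebraD(5)[OF w'] ])
      then show ?thesis using False by (simp add: coord_cut)
    qed
  next
    case False
    then show ?thesis by (simp add: right_algebra_single_outside[OF w False] w0 cut_single)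
  qed
  then have "w' (w (single g c)) = cut (single g c)" for g c
    by (rule ell2_eq_inner_singleI)
  then have "w' (w f) = cut f" for f
    by (rule eq_on_singles[OF bounded_linear_compose[OF right_algebraD(1)[OF w'] bw] bounded_cut])
  then show ?thesis using w a w\<delta> by blast
qed

end

context infinite_order_element
begin

lemma residue_class_partition:
  assumes "0 < N"
  shows "partition_on S (residue_class N ` {0..<int N} - {{}}) \<and> finite (residue_class N ` {0..<int N} - {{}})"
proof -
  have "g \<in> residue_class N (exponent g mod int N) \<and> exponent g mod int N \<in> {0..<int N}" if "g \<in> S" for g
    using that assms by (simp add: residue_class_def)
  then have "S \<subseteq> \<Union> (residue_class N ` {0..<int N} - {{}})"
    by blast
  moreover have "\<Union> (residue_class N ` {0..<int N} - {{}}) \<subseteq> S"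
    by (auto simp: residue_class_def)
  moreover have "disjoint (residue_class N ` {0..<int N} - {{}})"
    by (rule disjointI) (auto simp: residue_class_def)
  ultimately show ?thesis by (simp add: partition_on_def subset_antisym)
qed

text \<open>The inner products within the orbit of \<open>u \<delta>\<close> depend on \<open>u\<close> only through \<open>u\<^sup>* u\<close>. So all \<open>u\<close> for
  which this is the projection of a given arc lead to the same estimates.\<close>

lemma orbit_gram:
  assumes u: "u \<in> right_algebra" "adj u u'" "\<And>f. u' (u f) = q f"
    and q: "q \<in> right_algebra" "q \<delta> = arc_vector b" "self_adjoint_idempotent q" and b: "0 < b" "b \<le> 1"
    and gh: "g \<in> S" "h \<in> S"
  shows "inner (scaleC z (u (single g 1))) (u (single h 1)) = Re (z * coord (arc_vector b) (inv g \<otimes> h))"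
proof -
  have adjq: "adj q q" and idem: "\<And>f. q (q f) = q f"
    using q(3) by (auto simp: self_adjoint_idempotent_def)
  have "inner (scaleC z (u (single g 1))) (u (single h 1)) = inner (u (single g z)) (u (single h 1))"
    by (simp add: right_algebraD(2)[OF u(1), symmetric] scaleC_single)
  also have "\<dots> = inner (single g z) (q (single h 1))"
    by (simp add: adjD[OF u(2)] u(3))
  also have "\<dots> = inner (q (single g z)) (q (single h 1))"
    by (simp add: adjD[OF adjq] idem)
  also have "\<dots> = inner (scaleC z (left_tr g (arc_vector b))) (left_tr h (arc_vector b))"
    unfolding right_algebra_single[OF q(1) gh(1)] right_algebra_single[OF q(1) gh(2)] q(2) by simp
  finally show ?thesis by (simp only: arc_vector_gram[OF b gh])
qed

lemma orbit_riesz: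
  assumes u: "u \<in> right_algebra" "adj u u'" "\<And>f. u' (u f) = q f"
    and q: "q \<in> right_algebra" "q \<delta> = arc_vector b" "self_adjoint_idempotent q"
    and N: "0 < N" and b: "1 / real N \<le> b" "b \<le> 1"
  shows "riesz_sequence S (residue_class N j) (\<lambda>g. coord (u (single g 1)))"
proof -
  have "0 < 1 / real N" using N by simp
  then have b0: "0 < b" using b(1) by linarith
  have cut: "cut (u f) = u f" for f by (rule right_algebraD(5)[OF u(1)])
  have norm: "(l2_norm S (lin_comb F c (\<lambda>g. coord (u (single g 1)))))\<^sup>2
      = (norm (\<Sum>g\<in>F. scaleC (c g) (left_tr g (arc_vector b))))\<^sup>2" if F: "finite F" "F \<subseteq> S" for F c
  proof -
    let ?y = "\<Sum>g\<in>F. scaleC (c g) (u (single g 1))"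
    have "?y = u (\<Sum>g\<in>F. single g (c g))"
      by (simp add: linear_sum[OF bounded_linear.linear[OF right_algebraD(1)[OF u(1)] ] ]
          right_algebraD(2)[OF u(1), symmetric] scaleC_single)
    then have "cut ?y = ?y" by (simp add: cut)
    then have "l2_norm S (lin_comb F c (\<lambda>g. coord (u (single g 1)))) = norm ?y"
      using l2_norm_coord by (simp add: coord_sum_scaleC[symmetric])
    moreover have "(norm ?y)\<^sup>2 = (norm (\<Sum>g\<in>F. scaleC (c g) (left_tr g (arc_vector b))))\<^sup>2"
      unfolding norm_sum_scaleC
      by (intro sum.cong refl) (use F in \<open>auto simp: orbit_gram[OF u q b0 b(2)] arc_vector_gram[OF b0 b(2)] subset_iff\<close>)
    ultimately show ?thesis by simp
  qed
  have "(1 / real N) * (\<Sum>i\<in>F. (cmod (c i))\<^sup>2) \<le> (l2_norm S (lin_comb F c (\<lambda>g. coord (u (single g 1)))))\<^sup>2 \<and>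
      (l2_norm S (lin_comb F c (\<lambda>g. coord (u (single g 1)))))\<^sup>2 \<le> 1 * (\<Sum>i\<in>F. (cmod (c i))\<^sup>2)"
    if F: "finite F" "F \<subseteq> residue_class N j" for F c
  proof -
    have FS: "F \<subseteq> S" using F(2) by (auto simp: residue_class_def)
    show ?thesis
      unfolding norm[OF F(1) FS]
      using arc_translates_lower[OF N b F] arc_translates_upper[OF b0 b(2) F(1) FS] by simp
  qed
  moreover have "(\<lambda>g. coord (u (single g 1))) \<in> residue_class N j \<rightarrow> l2 S"
    using coord_in_l2[OF cut] by blast
  moreover have "(0::real) < 1" by simp
  ultimately show ?thesis
    unfolding riesz_sequence_def using \<open>0 < 1 / real N\<close> by blast
qed

text \<open>The number of classes is any \<open>N\<close> with \<open>1/N \<le> b\<close>.\<close>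

lemma orbit_finite_union:
  assumes u: "u \<in> right_algebra" "adj u u'" "\<And>f. u' (u f) = q f"
    and q: "q \<in> right_algebra" "q \<delta> = arc_vector b" "self_adjoint_idempotent q" and b: "0 < b" "b \<le> 1"
  shows "finite_union_of_riesz_sequences S S (\<lambda>g. coord (u (single g 1)))"
proof -
  obtain N :: nat where N: "1 / b < real N"
    using reals_Archimedean2 by blast
  have "0 < 1 / b" using b by simp
  then have N0: "0 < N" using N by (cases N) auto
  have Nb: "1 / real N \<le> b" using N b N0 by (simp add: field_simps)
  show ?thesis
    unfolding finite_union_of_riesz_sequences_def
    using residue_class_partition[OF N0] orbit_riesz[OF u q N0 Nb b(2)]
    by (intro exI[of _ "residue_class N ` {0..<int N} - {{}}"]) blast
qed

lemma orbit_finite_union_orthogonal: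
  assumes u: "u \<in> right_algebra" "adj u u'" "\<And>f. u' (u f) = q f"
    and q: "q \<in> right_algebra" "q \<delta> = arc_vector (1 / real N)" "self_adjoint_idempotent q" and N: "0 < N"
  shows "finite_union_of_orthogonal_riesz_sequences S S (\<lambda>g. coord (u (single g 1)))"
proof -
  have b: "0 < 1 / real N" "1 / real N \<le> 1" using N by auto
  have "l2_inner S (coord (u (single g 1))) (coord (u (single h 1))) = 0"
    if g: "g \<in> residue_class N j" and h: "h \<in> residue_class N j" and ne: "g \<noteq> h" for g h j
  proof -
    have gh: "g \<in> S" "h \<in> S" using g h by (auto simp: residue_class_def)
    have "inner (scaleC z (u (single g 1))) (u (single h 1)) = 0" for z
      unfolding orbit_gram[OF u q b gh] arc_vector_unit_fraction_diagonal[OF N g h] using ne by simp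
    from this[of 1] this[of "cnj \<i>"] have "cinner (u (single g 1)) (u (single h 1)) = 0"
      using inner_scaleC[of "cnj \<i>" "u (single g 1)" "u (single h 1)"] by (simp add: cinner_def complex_eq_iff)
    then show ?thesis
      by (simp add: l2_inner_coord right_algebraD(5)[OF u(1)])
  qed
  then have "orthogonal_riesz_sequence S (residue_class N j) (\<lambda>g. coord (u (single g 1)))" for j
    using orbit_riesz[OF u q N order_refl b(2), of j]
    unfolding orthogonal_riesz_sequence_def pairwise_def by blast
  then show ?thesis
    unfolding finite_union_of_orthogonal_riesz_sequences_def
    using residue_class_partition[OF N]
    by (intro exI[of _ "residue_class N ` {0..<int N} - {{}}"]) blast
qed

text \<open>Compressing the orbit of an orthonormal basis vector: \<open>w q w\<^sup>*\<close> is equivalent to the projection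
  \<open>q\<close> of the arc, and it maps the orbit of \<open>w \<delta>\<close> to that of \<open>w q \<delta>\<close>.\<close>

lemma compressed_basis_orbit:
  assumes \<psi>: "onb_vector G (l2 S) (left_regular G) \<psi>" and b: "0 < b" "b \<le> 1"
  shows "\<exists>p u u' q. p \<in> group_vN_commutant G \<and> orthogonal_projection S p \<and>
    trace_commutant G p = complex_of_real b \<and>
    (\<forall>g\<in>S. p (left_regular G g \<psi>) = coord (u (single g 1))) \<and>
    u \<in> right_algebra \<and> adj u u' \<and> (\<forall>f. u' (u f) = q f) \<and>
    q \<in> right_algebra \<and> q \<delta> = arc_vector b \<and> self_adjoint_idempotent q"
proof -
  have \<psi>l2: "\<psi> \<in> l2 S"
    and on: "\<And>g h. g \<in> S \<Longrightarrow> h \<in> S \<Longrightarrow> l2_inner S (left_regular G g \<psi>) (left_regular G h \<psi>) = (if g = h then 1 else 0)"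
    using \<psi> by (auto simp: onb_vector_def orthonormal_basis_def)
  define \<Psi> where "\<Psi> = embed \<psi>"
  have cut\<Psi>: "cut \<Psi> = \<Psi>" unfolding \<Psi>_def by (rule cut_embed[OF \<psi>l2])
  have lr: "left_regular G g \<psi> = coord (left_tr g \<Psi>)" if "g \<in> S" for g
    using left_regular_coord[OF that cut\<Psi>] by (simp add: \<Psi>_def coord_embed[OF \<psi>l2])
  have "cinner (left_tr g \<Psi>) (left_tr h \<Psi>) = (if g = h then 1 else 0)" if "g \<in> S" "h \<in> S" for g h
    using on[OF that] by (simp add: lr that l2_inner_coord cut_left_tr)
  from orthonormal_orbit_isometry[OF cut\<Psi> this] obtain w w' where
    w: "w \<in> right_algebra" and a: "adj w w'" and w\<delta>: "w \<delta> = \<Psi>" and w'w: "\<And>f. w' (w f) = cut f"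
    by blast
  obtain q where q: "q \<in> right_algebra" "q \<delta> = arc_vector b" "self_adjoint_idempotent q"
    using arc_projection[OF b] by blast
  have adjq: "adj q q" and idem: "\<And>f. q (q f) = q f"
    using q(3) by (auto simp: self_adjoint_idempotent_def)
  have w': "w' \<in> right_algebra" by (rule right_algebra_adj[OF w a])
  define u u' where "u = (\<lambda>f. w (q f))" and "u' = (\<lambda>f. q (w' f))"
  have comp: "(\<lambda>f. A (T f)) \<in> right_algebra" if "A \<in> right_algebra" "T \<in> right_algebra" for A T
    by (rule right_algebraI)
      (simp_all add: right_algebraD(2-5)[OF that(1)] right_algebraD(2-5)[OF that(2)]
        bounded_linear_compose[OF right_algebraD(1)[OF that(1)] right_algebraD(1)[OF that(2)] ])
  have u: "u \<in> right_algebra" unfolding u_def by (rule comp[OF w q(1)])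
  have au: "adj u u'" unfolding u_def u'_def by (rule adj_comp[OF a adjq])
  have u'u: "u' (u f) = q f" for f
    by (simp add: u_def u'_def w'w right_algebraD(5)[OF q(1)] idem)
  define P where "P = (\<lambda>f. u (w' f))"
  have P: "P \<in> right_algebra" unfolding P_def by (rule comp[OF u w'])
  have "self_adjoint_idempotent P"
  proof -
    have "adj P (\<lambda>f. w (u' f))" unfolding P_def by (rule adj_comp[OF au adj_sym[OF a] ])
    then have "adj P P" by (simp add: P_def u_def u'_def)
    moreover have "P (P f) = P f" for f
      by (simp add: P_def u_def w'w right_algebraD(5)[OF q(1)] idem)
    ultimately show ?thesis by (simp add: self_adjoint_idempotent_def)
  qed
  note proj = to_l2_projection[OF P this]
  have "inner (P \<delta>) \<delta> = inner (w' (u \<delta>)) \<delta>"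
    unfolding P_def by (rule right_algebra_trace[OF u w'])
  also have "\<dots> = b"
    using inner_arc_vector_delta[OF b] by (simp add: u_def w'w right_algebraD(5)[OF q(1)] q(2)[symmetric])
  finally have tr: "inner (P \<delta>) \<delta> = b" .
  have "to_l2 P (left_regular G g \<psi>) = coord (u (single g 1))" if g: "g \<in> S" for g
  proof -
    have "left_tr g \<Psi> = w (single g 1)"
      using right_algebra_single[OF w g, of 1] by (simp add: w\<delta>)
    then have "P (left_tr g \<Psi>) = u (single g 1)"
      using g by (simp add: P_def w'w cut_single)
    then show ?thesis
      by (simp add: lr[OF g] to_l2_coord[OF cut_left_tr[OF g] ])
  qed
  then show ?thesis
    using proj tr u au u'u q by (intro exI[of _ "to_l2 P"] exI[of _ u] exI[of _ u'] exI[of _ q]) auto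
qed

lemma compressed_basis_riesz:
  assumes \<psi>: "onb_vector G (l2 S) (left_regular G) \<psi>" and b: "0 < b" "b \<le> 1"
  shows "\<exists>p. p \<in> group_vN_commutant G \<and> orthogonal_projection S p \<and>
    trace_commutant G p = complex_of_real b \<and> finite_union_of_riesz_sequences S S (\<lambda>g. p (left_regular G g \<psi>))"
proof -
  obtain p u u' q where p: "p \<in> group_vN_commutant G" "orthogonal_projection S p"
      "trace_commutant G p = complex_of_real b"
    and orbit: "\<And>g. g \<in> S \<Longrightarrow> p (left_regular G g \<psi>) = coord (u (single g 1))"
    and u: "u \<in> right_algebra" "adj u u'" "\<And>f. u' (u f) = q f"
    and q: "q \<in> right_algebra" "q \<delta> = arc_vector b" "self_adjoint_idempotent q"
    using compressed_basis_orbit[OF assms] by blast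
  have "finite_union_of_riesz_sequences S S (\<lambda>g. p (left_regular G g \<psi>))"
    by (rule finite_union_riesz_cong[OF orbit_finite_union[OF u q b] ]) (simp add: orbit)
  then show ?thesis using p by blast
qed

lemma compressed_basis_orthogonal_riesz:
  assumes \<psi>: "onb_vector G (l2 S) (left_regular G) \<psi>" and N: "0 < N"
  shows "\<exists>p. p \<in> group_vN_commutant G \<and> orthogonal_projection S p \<and>
    trace_commutant G p = complex_of_real (1 / real N) \<and>
    finite_union_of_orthogonal_riesz_sequences S S (\<lambda>g. p (left_regular G g \<psi>))"
proof -
  have b: "0 < 1 / real N" "1 / real N \<le> 1" using N by auto
  obtain p u u' q where p: "p \<in> group_vN_commutant G" "orthogonal_projection S p"
      "trace_commutant G p = complex_of_real (1 / real N)"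
    and orbit: "\<And>g. g \<in> S \<Longrightarrow> p (left_regular G g \<psi>) = coord (u (single g 1))"
    and u: "u \<in> right_algebra" "adj u u'" "\<And>f. u' (u f) = q f"
    and q: "q \<in> right_algebra" "q \<delta> = arc_vector (1 / real N)" "self_adjoint_idempotent q"
    using compressed_basis_orbit[OF \<psi> b] by blast
  have "finite_union_of_orthogonal_riesz_sequences S S (\<lambda>g. p (left_regular G g \<psi>))"
    by (rule finite_union_orthogonal_riesz_cong[OF orbit_finite_union_orthogonal[OF u q N] ]) (simp add: orbit)
  then show ?thesis using p by blast
qed

end

text \<open>A partial isometry from the projection of an arc onto \<open>p\<close> turns \<open>\<delta>\<close> into a Parseval frame vector.\<close>

lemma (in scattering_group) parseval_frame_vector_riesz:
  assumes a: "infinite_order_element G a"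
    and p: "p \<in> group_vN_commutant G" and proj: "orthogonal_projection S p"
    and nonzero: "\<exists>f\<in>l2 S. p f \<noteq> (\<lambda>x. 0)" and K: "K = p ` l2 S" and \<pi>: "\<pi> = subrepresentation (left_regular G) K"
  shows "\<exists>\<eta>. parseval_frame_vector G K \<pi> \<eta> \<and> finite_union_of_riesz_sequences S S (\<lambda>g. \<pi> g \<eta>)"
proof -
  interpret infinite_order_element G a by (rule a)
  obtain P where P: "P \<in> right_algebra" "self_adjoint_idempotent P"
    and pP: "\<And>F. cut F = F \<Longrightarrow> p (coord F) = coord (P F)"
    using from_l2_projection[OF p proj] by blast
  have adjP: "adj P P" and idemP: "\<And>f. P (P f) = P f"
    using P(2) by (auto simp: self_adjoint_idempotent_def)
  define b where "b = inner (P \<delta>) \<delta>"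
  have b_norm: "b = (norm (P \<delta>))\<^sup>2"
    using adjD[OF adjP, of "P \<delta>" \<delta>] by (simp add: b_def power2_norm_eq_inner idemP)
  have "norm \<delta> = 1" by (simp add: \<delta>_def)
  have b1: "b \<le> 1"
  proof -
    have "(norm (P \<delta>))\<^sup>2 \<le> norm (P \<delta>)"
      using norm_cauchy_schwarz[of "P \<delta>" \<delta>] \<open>norm \<delta> = 1\<close> by (simp add: b_def[symmetric] b_norm)
    then have "norm (P \<delta>) \<le> 1"
      by (cases "norm (P \<delta>) = 0") (simp_all add: power2_eq_square)
    then show ?thesis unfolding b_norm by (simp add: power_le_one)
  qed
  have b0: "0 < b"
  proof -
    obtain f where f: "f \<in> l2 S" "p f \<noteq> (\<lambda>x. 0)" using nonzero by blast
    have "P (embed f) \<noteq> 0"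
      using pP[OF cut_embed[OF f(1)] ] f by (auto simp: coord_embed[OF f(1)] fun_eq_iff)
    then have "P \<delta> \<noteq> 0" using right_algebra_separating[OF P(1)] by blast
    then show ?thesis by (simp add: b_norm)
  qed
  obtain q where q: "q \<in> right_algebra" "q \<delta> = arc_vector b" "self_adjoint_idempotent q"
    using arc_projection[OF b0 b1] by blast
  have adjq: "adj q q" and idemq: "\<And>f. q (q f) = q f"
    using q(3) by (auto simp: self_adjoint_idempotent_def)
  have "inner (P \<delta>) \<delta> = inner (q \<delta>) \<delta>"
    using inner_arc_vector_delta[OF b0 b1] by (simp add: b_def q(2))
  then obtain v v' where v: "v \<in> right_algebra" "adj v v'" "\<And>f. v' (v f) = q f" "\<And>f. v (v' f) = P f"
    using equal_trace_imp_equivalent[OF P(1) q(1) P(2) q(3)] by blast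
  have v'M: "v' \<in> right_algebra" by (rule right_algebra_adj[OF v(1,2)])
  interpret v: bounded_linear v by (rule right_algebraD(1)[OF v(1)])
  interpret q: bounded_linear q by (rule right_algebraD(1)[OF q(1)])
  have vq: "v (q f) = v f" for f
  proof -
    have "inner (v (q f - f)) (v (q f - f)) = inner (q f - f) (q (q f - f))"
      by (simp only: adjD[OF v(2)] v(3))
    also have "\<dots> = 0" by (simp add: q.diff idemq)
    finally show ?thesis by (simp add: v.diff)
  qed
  have Pv: "P (v f) = v f" for f
    by (simp only: v(4)[symmetric] v(3) vq)
  define \<eta> where "\<eta> = coord (v \<delta>)"
  have cutv: "cut (v f) = v f" for f by (rule right_algebraD(5)[OF v(1)])
  have inK: "coord (v f) \<in> K" for f
  proof -
    have "coord (v f) = p (coord (v f))" using pP[OF cutv[of f] ] by (simp add: Pv)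
    then show ?thesis unfolding K using coord_in_l2[OF cutv[of f] ] by blast
  qed
  have orbit: "\<pi> g \<eta> = coord (v (single g 1))" if g: "g \<in> S" for g
  proof -
    have "\<pi> g \<eta> = left_regular G g (coord (v \<delta>))"
      using inK[of \<delta>] by (simp add: \<pi> subrepresentation_def \<eta>_def)
    then show ?thesis
      using right_algebra_single[OF v(1) g, of 1] by (simp add: left_regular_coord[OF g cutv])
  qed
  have frame: "((\<lambda>g. (cmod (l2_inner S f (\<pi> g \<eta>)))\<^sup>2) has_sum (l2_norm S f)\<^sup>2) S" if f: "f \<in> K" for f
  proof -
    obtain f0 where f0: "f0 \<in> l2 S" "f = p f0" using f K by blast
    define F where "F = P (embed f0)"
    have fF: "f = coord F"
      using pP[OF cut_embed[OF f0(1)] ] f0 by (simp add: F_def coord_embed)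
    have cutF: "cut F = F" unfolding F_def by (rule right_algebraD(5)[OF P(1)])
    have PF: "P F = F" by (simp add: F_def idemP)
    have coeff: "l2_inner S f (\<pi> g \<eta>) = coord (v' F) g" if g: "g \<in> S" for g
    proof -
      have "l2_inner S f (\<pi> g \<eta>) = cinner F (v (single g 1))"
        by (simp only: fF orbit[OF g] l2_inner_coord[OF cutF])
      also have "\<dots> = cinner (v' F) (single g 1)"
        by (simp only: cinner_def adjD[OF adj_sym[OF v(2)] ] right_algebraD(2)[OF v(1), symmetric])
      finally show ?thesis by (simp only: cinner_single)
    qed
    have "(norm (v' F))\<^sup>2 = (norm F)\<^sup>2"
      using adjD[OF adj_sym[OF v(2)], of F "v' F"] by (simp add: power2_norm_eq_inner v(4) PF)
    then have "((\<lambda>g. (cmod (coord (v' F) g))\<^sup>2) has_sum (norm F)\<^sup>2) UNIV"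
      using norm_has_sum[of "v' F"] by simp
    then have "((\<lambda>g. (cmod (coord (v' F) g))\<^sup>2) has_sum (norm F)\<^sup>2) S"
      by (rule has_sum_cong_neutral[THEN iffD1, rotated -1])
        (auto simp: coord_zero_outside[OF right_algebraD(5)[OF v'M] ])
    then have "((\<lambda>g. (cmod (l2_inner S f (\<pi> g \<eta>)))\<^sup>2) has_sum (norm F)\<^sup>2) S"
      by (rule has_sum_cong[THEN iffD1, rotated]) (simp add: coeff)
    then show ?thesis by (simp add: fF l2_norm_coord[OF cutF])
  qed
  have "parseval_frame_vector G K \<pi> \<eta>"
    unfolding parseval_frame_vector_def parseval_frame_def
  proof (intro conjI ballI Pi_I)
    show "\<eta> \<in> K" unfolding \<eta>_def by (rule inK)
    show "\<pi> g \<eta> \<in> K" if "g \<in> S" for g unfolding orbit[OF that] by (rule inK)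
  qed (rule frame)
  moreover have "finite_union_of_riesz_sequences S S (\<lambda>g. coord (v (single g 1)))"
    by (rule orbit_finite_union[OF v(1-3) q b0 b1])
  then have "finite_union_of_riesz_sequences S S (\<lambda>g. \<pi> g \<eta>)"
    by (rule finite_union_riesz_cong) (simp add: orbit)
  ultimately show ?thesis by blast
qed

theorem corollary3p9:
  fixes G :: "('a, 'b) monoid_scheme" and X :: "'a set"
  assumes free: "free_group_on G X"
    and countable: "countable (carrier G)"
    and more_than_one_generator: "\<exists>x\<in>X. \<exists>y\<in>X. x \<noteq> y"
  shows
    "(\<forall>p. p \<in> group_vN_commutant G \<and> orthogonal_projection (carrier G) p \<and>
          (\<exists>f\<in>l2 (carrier G). p f \<noteq> (\<lambda>x. 0)) \<longrightarrow>
        (let K = p ` l2 (carrier G); \<pi> = subrepresentation (left_regular G) K in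
          \<exists>\<eta>. parseval_frame_vector G K \<pi> \<eta> \<and>
              finite_union_of_riesz_sequences (carrier G) (carrier G) (\<lambda>g. \<pi> g \<eta>)))
     \<and>
     (\<forall>\<psi> (\<alpha>::real).
        onb_vector G (l2 (carrier G)) (left_regular G) \<psi> \<and> 0 < \<alpha> \<and> \<alpha> \<le> 1 \<longrightarrow>
        (\<exists>p. p \<in> group_vN_commutant G \<and> orthogonal_projection (carrier G) p \<and>
             trace_commutant G p = complex_of_real \<alpha> \<and>
             finite_union_of_riesz_sequences (carrier G) (carrier G)
               (\<lambda>g. p (left_regular G g \<psi>))) \<and>
        (\<forall>N::nat. \<alpha> = 1 / real N \<longrightarrow>
           (\<exists>p. p \<in> group_vN_commutant G \<and> orthogonal_projection (carrier G) p \<and>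
                trace_commutant G p = complex_of_real \<alpha> \<and>
                finite_union_of_orthogonal_riesz_sequences (carrier G) (carrier G)
                  (\<lambda>g. p (left_regular G g \<psi>)))))"
proof -
  interpret F: free_group G X by (rule free_group.intro[OF free])
  have scattering: "scattering_group G"
    by (rule scattering_group.intro[OF F.group_axioms], unfold_locales)
      (rule F.conjugate_disjoint[OF more_than_one_generator])
  obtain a where a: "a \<in> X" using more_than_one_generator by blast
  have "infinite_order_element G a"
    by unfold_locales (use a F.generators_closed F.int_pow_generator_inj[OF a] in auto)
  note frame = scattering_group.parseval_frame_vector_riesz[OF scattering this]
    and basis = infinite_order_element.compressed_basis_riesz[OF this]
    and orthogonal = infinite_order_element.compressed_basis_orthogonal_riesz[OF this]
  show ?thesis
    unfolding Let_def
  proof (intro conjI allI impI)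
    fix p
    assume "p \<in> group_vN_commutant G \<and> orthogonal_projection (carrier G) p \<and>
      (\<exists>f\<in>l2 (carrier G). p f \<noteq> (\<lambda>x. 0))"
    then show "\<exists>\<eta>. parseval_frame_vector G (p ` l2 (carrier G))
          (subrepresentation (left_regular G) (p ` l2 (carrier G))) \<eta> \<and>
        finite_union_of_riesz_sequences (carrier G) (carrier G)
          (\<lambda>g. subrepresentation (left_regular G) (p ` l2 (carrier G)) g \<eta>)"
      using frame[OF _ _ _ refl refl] by blast
  next
    fix \<psi> and \<alpha> :: real
    assume \<psi>: "onb_vector G (l2 (carrier G)) (left_regular G) \<psi> \<and> 0 < \<alpha> \<and> \<alpha> \<le> 1"
    then show "\<exists>p. p \<in> group_vN_commutant G \<and> orthogonal_projection (carrier G) p \<and>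
        trace_commutant G p = complex_of_real \<alpha> \<and>
        finite_union_of_riesz_sequences (carrier G) (carrier G) (\<lambda>g. p (left_regular G g \<psi>))"
      using basis by blast
    fix N :: nat
    assume \<alpha>: "\<alpha> = 1 / real N"
    with \<psi> have "0 < N" by (cases N) auto
    then show "\<exists>p. p \<in> group_vN_commutant G \<and> orthogonal_projection (carrier G) p \<and>
        trace_commutant G p = complex_of_real \<alpha> \<and>
        finite_union_of_orthogonal_riesz_sequences (carrier G) (carrier G) (\<lambda>g. p (left_regular G g \<psi>))"
      unfolding \<alpha> using orthogonal \<psi> by blast
  qed
qed

end
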